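(* Let $1\le p\le\infty$, $0<\theta\le\infty$ and $\alpha>1/p$. Then there exists a constant $c>0$ depending only on $\alpha$, $p$ and $\theta$ such that for all integers $n\ge 2$, $$\sup_{f\in U^{\alpha}_{p,\theta}(\mathbb T^2)}|\Phi_n(f)-I(f)|\le c\,b_n^{-\alpha}(\log b_n)^{(1-1/\theta)_+},$$ where $I(f)=\int_{[0,1]^2}f(x)\,dx$ and $\Phi_n$ is the Fibonacci cubature formula.
   Context: Conventions: $1/\infty=0$, $a_+=\max\{a,0\}$, $[d]=\{1,\dots,d\}$ (here $d=2$). Fibonacci cubature: $b_0=b_1=1$, $b_n=b_{n-1}+b_{n-2}$ for $n\ge2$, and $$\Phi_n(f)=\frac1{b_n}\sum_{\mu=0}^{b_n-1}f\Big(\frac{\mu}{b_n},\Big\{\mu\frac{b_{n-1}}{b_n}\Big\}\Big),$$ where $\{x\}=x-\lfloor x\rfloor$ is the fractional part. Besov spaces of mixed smoothness on the torus: $\mathbb T^d$ is $[0,1]^d$ with opposite faces identified; functions on $\mathbb T^d$ are identified with functions on $\mathbb R^d$ that are $1$-periodic in each variable. Fix an integer $\ell>\alpha$. For univariate periodic $f$ and $h\in\mathbb R$, $\Delta_h^\ell(f,x)=\sum_{j=0}^{\ell}(-1)^{\ell-j}\binom{\ell}{j}f(x+jh)$. For $e\subset[d]$ and $h\in\mathbb R^d$, $\Delta_h^{\ell,e}=\prod_{i\in e}\Delta^\ell_{h_i}$, where $\Delta^\ell_{h_i}$ acts in the variable $x_i$ with the other variables fixed, and $\Delta_h^{\ell,\emptyset}=\mathrm{Id}$.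 For $t\in[0,1]^d$, $\omega_\ell^e(f,t)_p=\sup_{|h_i|<t_i,\,i\in e}\|\Delta_h^{\ell,e}(f)\|_{L_p(\mathbb T^d)}$. Define $$|f|_{B^{\alpha,e}_{p,\theta}}=\Big(\int_{[0,1]^d}\Big[\prod_{i\in e}t_i^{-\alpha}\,\omega_\ell^e(f,t)_p\Big]^\theta\prod_{i\in e}t_i^{-1}\,dt\Big)^{1/\theta}\quad(\theta<\infty),$$ and $|f|_{B^{\alpha,e}_{p,\theta}}=\sup_{t}\prod_{i\in e}t_i^{-\alpha}\omega^e_\ell(f,t)_p$ if $\theta=\infty$; for $e=\emptyset$ this is $\|f\|_p$. Then $B^\alpha_{p,\theta}(\mathbb T^d)$ is the set of $f\in L_p(\mathbb T^d)$ with $\|f\|_{B^\alpha_{p,\theta}(\mathbb T^d)}=\sum_{e\subset[d]}|f|_{B^{\alpha,e}_{p,\theta}}<\infty$ (different choices of $\ell>\alpha$ give equivalent quasi-norms), and $U^\alpha_{p,\theta}(\mathbb T^d)$ is its unit ball. Since $\alpha>1/p$, every element has a continuous representative, which is used for point evaluations. *)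

theory Defs
  imports
    "HOL-Analysis.Analysis"
    "HOL-Probability.Essential_Supremum"
    "HOL-Number_Theory.Fib"
begin

subsection \<open>Lebesgue spaces on the torus\<close>

text \<open>Functions on the \<open>d\<close>-dimensional torus are complex-valued functions on \<open>real^'d\<close> of
  period 1 in each variable; integrals are taken over the cell \<open>[0,1]^d\<close>, where \<open>0\<close> and \<open>1\<close> in
  \<open>cbox 0 1\<close> are the constant vectors.\<close>

abbreviation unit_cell :: "(real ^ 'd::finite) measure" where
  "unit_cell \<equiv> restrict_space lborel (cbox 0 1)"

definition torus_periodic :: "(real ^ 'd::finite \<Rightarrow> 'b) \<Rightarrow> bool" where
  "torus_periodic f \<longleftrightarrow> (\<forall>x i. f (x + axis i 1) = f x)"

text \<open>Only used with a positive real exponent \<open>a\<close>.\<close>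

definition ennreal_powr :: "ennreal \<Rightarrow> real \<Rightarrow> ennreal" where
  "ennreal_powr x a = (if x = \<infinity> then \<infinity> else ennreal (enn2real x powr a))"

definition Lp_norm :: "ennreal \<Rightarrow> (real ^ 'd::finite \<Rightarrow> complex) \<Rightarrow> ennreal" where
  "Lp_norm p f =
     (if p = \<infinity> then esssup unit_cell (\<lambda>x. ennreal (cmod (f x)))
      else ennreal_powr (\<integral>\<^sup>+x. ennreal (cmod (f x) powr enn2real p) \<partial>unit_cell) (1 / enn2real p))"

text \<open>The elements are functions rather than classes modulo null sets, so all notions below are
  applied to arbitrary Borel measurable representatives.\<close>

definition Lp_torus :: "ennreal \<Rightarrow> (real ^ 'd::finite \<Rightarrow> complex) set" where
  "Lp_torus p = {f \<in> borel_measurable borel. torus_periodic f \<and> Lp_norm p f < \<infinity>}"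

definition torus_integral :: "(real ^ 'd::finite \<Rightarrow> complex) \<Rightarrow> complex" where
  "torus_integral f = (LINT x|unit_cell. f x)"

subsection \<open>Mixed differences and moduli of smoothness\<close>

definition partial_diff ::
    "nat \<Rightarrow> 'd::finite \<Rightarrow> real \<Rightarrow> (real ^ 'd \<Rightarrow> complex) \<Rightarrow> real ^ 'd \<Rightarrow> complex" where
  "partial_diff l i s f x =
     (\<Sum>j=0..l. (-1) ^ (l - j) * of_nat (l choose j) * f (x + axis i (real j * s)))"

lemma partial_diff_commute:
  "partial_diff l i s (partial_diff l k r f) = partial_diff l k r (partial_diff l i s f)"
proof
  fix x
  have "partial_diff l i s (partial_diff l k r f) x =
     (\<Sum>j=0..l. \<Sum>m=0..l. ((-1) ^ (l - j) * of_nat (l choose j)) *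
        (((-1) ^ (l - m) * of_nat (l choose m)) * f (x + axis i (real j * s) + axis k (real m * r))))"
    by (simp add: partial_diff_def sum_distrib_left)
  also have "\<dots> = (\<Sum>m=0..l. \<Sum>j=0..l. ((-1) ^ (l - j) * of_nat (l choose j)) *
        (((-1) ^ (l - m) * of_nat (l choose m)) * f (x + axis i (real j * s) + axis k (real m * r))))"
    by (rule sum.swap)
  also have "\<dots> = partial_diff l k r (partial_diff l i s f) x"
    by (simp add: partial_diff_def sum_distrib_left ac_simps)
  finally show "partial_diff l i s (partial_diff l k r f) x =
    partial_diff l k r (partial_diff l i s f) x" .
qed

text \<open>The product over \<open>e\<close> of the coordinatewise difference operators; the order of composition is
  irrelevant because they commute.\<close>

definition mixed_diff ::
    "nat \<Rightarrow> 'd::finite set \<Rightarrow> real ^ 'd \<Rightarrow> (real ^ 'd \<Rightarrow> complex) \<Rightarrow> real ^ 'd \<Rightarrow> complex" where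
  "mixed_diff l e h f = Finite_Set.fold (\<lambda>i. partial_diff l i (h $ i)) f e"

lemma mixed_diff_empty: "mixed_diff l {} h f = f"
  by (simp add: mixed_diff_def)

lemma mixed_diff_insert:
  assumes "i \<notin> e"
  shows "mixed_diff l (insert i e) h f = partial_diff l i (h $ i) (mixed_diff l e h f)"
proof -
  interpret comp_fun_commute "\<lambda>i. partial_diff l i (h $ i)"
    by unfold_locales (auto simp: fun_eq_iff partial_diff_commute)
  show ?thesis
    using assms by (simp add: mixed_diff_def)
qed

definition mixed_modulus ::
    "nat \<Rightarrow> 'd::finite set \<Rightarrow> ennreal \<Rightarrow> (real ^ 'd \<Rightarrow> complex) \<Rightarrow> real ^ 'd \<Rightarrow> ennreal" where
  "mixed_modulus l e p f t =
     (SUP h \<in> {h. \<forall>i\<in>e. \<bar>h $ i\<bar> < t $ i}. Lp_norm p (mixed_diff l e h f))"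

subsection \<open>Besov spaces of mixed smoothness\<close>

text \<open>Points \<open>t\<close> with \<open>t $ i = 0\<close> for some \<open>i \<in> e\<close> contribute 0 to the supremum (the modulus
  is then a supremum over the empty set) and form a null set for the integral.\<close>

definition besov_seminorm ::
    "nat \<Rightarrow> real \<Rightarrow> ennreal \<Rightarrow> ennreal \<Rightarrow> 'd::finite set \<Rightarrow> (real ^ 'd \<Rightarrow> complex) \<Rightarrow> ennreal" where
  "besov_seminorm l \<alpha> p \<theta> e f =
     (if \<theta> = \<infinity> then
        (SUP t \<in> cbox 0 1. ennreal (\<Prod>i\<in>e. t $ i powr (- \<alpha>)) * mixed_modulus l e p f t)
      else
        ennreal_powr
          (\<integral>\<^sup>+t. ennreal_powr (ennreal (\<Prod>i\<in>e. t $ i powr (- \<alpha>)) * mixed_modulus l e p f t)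
                   (enn2real \<theta>)
                * ennreal (\<Prod>i\<in>e. inverse (t $ i)) \<partial>unit_cell)
          (1 / enn2real \<theta>))"

definition besov_norm ::
    "nat \<Rightarrow> real \<Rightarrow> ennreal \<Rightarrow> ennreal \<Rightarrow> (real ^ 'd::finite \<Rightarrow> complex) \<Rightarrow> ennreal" where
  "besov_norm l \<alpha> p \<theta> f = (\<Sum>e\<in>Pow UNIV. besov_seminorm l \<alpha> p \<theta> e f)"

definition besov_space ::
    "nat \<Rightarrow> real \<Rightarrow> ennreal \<Rightarrow> ennreal \<Rightarrow> (real ^ 'd::finite \<Rightarrow> complex) set" where
  "besov_space l \<alpha> p \<theta> = {f \<in> Lp_torus p. besov_norm l \<alpha> p \<theta> f < \<infinity>}"

definition besov_unit_ball ::
    "nat \<Rightarrow> real \<Rightarrow> ennreal \<Rightarrow> ennreal \<Rightarrow> (real ^ 'd::finite \<Rightarrow> complex) set" where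
  "besov_unit_ball l \<alpha> p \<theta> = {f \<in> besov_space l \<alpha> p \<theta>. besov_norm l \<alpha> p \<theta> f \<le> 1}"

subsection \<open>Continuous representatives\<close>

definition is_continuous_rep ::
    "(real ^ 'd::finite \<Rightarrow> complex) \<Rightarrow> (real ^ 'd \<Rightarrow> complex) \<Rightarrow> bool" where
  "is_continuous_rep f g \<longleftrightarrow> continuous_on UNIV g \<and> (AE x in lborel. g x = f x)"

definition continuous_rep :: "(real ^ 'd::finite \<Rightarrow> complex) \<Rightarrow> real ^ 'd \<Rightarrow> complex" where
  "continuous_rep f = (THE g. is_continuous_rep f g)"

lemma is_continuous_rep_unique:
  assumes "is_continuous_rep f g" "is_continuous_rep f g'"
  shows "g = g'"
proof -
  let ?S = "{x. g x \<noteq> g' x}"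
  have "open ?S"
    using assms by (intro open_Collect_neq) (auto simp: is_continuous_rep_def)
  moreover have "AE x in lborel. x \<notin> ?S"
    using assms unfolding is_continuous_rep_def by auto
  then have "AE x in lebesgue. x \<notin> ?S"
    by (rule AE_completion)
  then have "negligible ?S"
    using \<open>open ?S\<close> by (simp add: negligible_iff_null_sets AE_iff_null_sets)
  ultimately have "?S = {}"
    using open_not_negligible by blast
  then show ?thesis
    by auto
qed

lemma continuous_rep_eqI: "is_continuous_rep f g \<Longrightarrow> continuous_rep f = g"
  unfolding continuous_rep_def by (blast intro: the_equality is_continuous_rep_unique)

subsection \<open>Fibonacci cubature\<close>

text \<open>The numbers \<open>b n\<close> are normalised by \<open>b 0 = b 1 = 1\<close>, whereas \<open>fib 0 = 0\<close>.\<close>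

definition fib_b :: "nat \<Rightarrow> nat" where
  "fib_b n = fib (Suc n)"

lemma fib_b_rec:
  "fib_b 0 = 1" "fib_b 1 = 1" "2 \<le> n \<Longrightarrow> fib_b n = fib_b (n - 1) + fib_b (n - 2)"
proof -
  show "fib_b n = fib_b (n - 1) + fib_b (n - 2)" if "2 \<le> n"
  proof -
    from that obtain m where "n = Suc (Suc m)"
      by (metis add_2_eq_Suc le_Suc_ex)
    then show ?thesis
      by (simp add: fib_b_def)
  qed
qed (simp_all add: fib_b_def)

definition fib_cubature :: "nat \<Rightarrow> (real ^ 2 \<Rightarrow> complex) \<Rightarrow> complex" where
  "fib_cubature n f = (1 / of_nat (fib_b n)) *
     (\<Sum>\<mu><fib_b n. f (vector [real \<mu> / real (fib_b n),
                              frac (real \<mu> * (real (fib_b (n - 1)) / real (fib_b n)))]))"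

end

theory Submission
  imports Defs "HOL-Probability.Probability"
begin

text \<open>
  Convolution-type operators built from generalised Jackson kernels and \<open>l\<close>-th differences split
  \<open>f\<close> into blocks \<open>f\<^sub>a\<^sub>b\<close> that are trigonometric polynomials of degree of order \<open>2^a\<close> and \<open>2^b\<close>
  in the two variables, with \<open>L\<^sub>p\<close> norms controlled by the moduli of smoothness at the scales \<open>2^-a\<close>
  and \<open>2^-b\<close>. A dual lattice point \<open>(k, m) \<noteq> (0, 0)\<close> of the Fibonacci rule satisfies
  \<open>b\<^sub>n \<le> 6 max(1, |k|) max(1, |m|)\<close>, so the rule is exact on all blocks with \<open>2^(a+b)\<close> below a small
  multiple of \<open>b\<^sub>n\<close>. On the remaining blocks a reproducing kernel of de la Vallee Poussin type bounds
  the \<open>p\<close>-th power mean of the samples by \<open>2^(a+b) / b\<^sub>n\<close> times the \<open>p\<close>-th power of the norm.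
  On each level \<open>a + b = M\<close> there are \<open>M + 1\<close> blocks, and passing from the \<open>\<theta>\<close>-norm over the level to
  the sum costs the factor \<open>(M + 1)^(1 - 1/\<theta>)\<^sub>+\<close>; the sum over the levels is geometric because
  \<open>\<alpha> > 1/p\<close>. The case \<open>p = \<infinity>\<close> follows from the embedding into a space with finite \<open>p\<close>.
\<close>

section \<open>Periodic integration\<close>

text \<open>The proof has to cover p = 1, where Fourier projections are not uniformly bounded, so
  the blocks are averages against kernels of bounded mass. The obstacle is that a kernel of width
  1/N also sees differences with steps u far larger than 1/N. Halving such a step i times costs
  \<open>kappa p l ^ i\<close>, which grows like a power of N|u|; the Jackson kernels therefore
  carry the exponent q + 1 with \<open>kappa p l \<le> 4 ^ q\<close>, and l enters the constants
  only through this q. Block kernels of positive index have mean zero, which removes the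
  one-variable differences. At index 0 these remain, so all four seminorms contribute. The error is
  governed by one level m with 2^m comparable to b_n. Blocks below it contribute nothing; at level m
  + k sampling loses 2^(k/p) while smoothness gains 2^(-\<alpha> (m + k)). The sum over k converges
  and leaves 2^(-\<alpha> m) and the power of m + 1 of a single level. As this rate does not involve
  p, passing from infinite to finite p on a cell of measure 1 loses nothing.\<close>

definition unif :: "real measure" where
  "unif = uniform_measure lborel {-1/2..1/2}"

abbreviation unif2 :: "(real \<times> real) measure" where
  "unif2 \<equiv> unif \<Otimes>\<^sub>M unif"

lemma sets_unif [simp, measurable_cong]: "sets unif = sets borel"
  by (simp add: unif_def)

lemma space_unif [simp]: "space unif = UNIV"
  by (simp add: unif_def)

lemma nn_integral_unif:
  "f \<in> borel_measurable borel \<Longrightarrow>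
    (\<integral>\<^sup>+u. f u \<partial>unif) = (\<integral>\<^sup>+u. f u * indicator {-1/2..1/2} u \<partial>lborel)"
  unfolding unif_def by (subst nn_integral_uniform_measure) (auto simp: divide_ennreal_def)

interpretation unif: prob_space unif
  unfolding unif_def by (rule prob_space_uniform_measure) auto

interpretation unif2: pair_prob_space unif unif ..

lemma sets_unif2 [simp, measurable_cong]: "sets unif2 = sets borel"
proof -
  have "sets unif2 = sets (borel \<Otimes>\<^sub>M borel :: (real \<times> real) measure)"
    by (rule sets_pair_measure_cong) simp_all
  then show ?thesis
    unfolding borel_prod .
qed

lemma measurable_fst_borel [measurable]: "(fst :: real \<times> real \<Rightarrow> real) \<in> borel_measurable borel"
  and measurable_snd_borel [measurable]: "(snd :: real \<times> real \<Rightarrow> real) \<in> borel_measurable borel"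
  by (auto intro!: borel_measurable_continuous_onI continuous_intros)

lemma space_unif2 [simp]: "space unif2 = UNIV"
  by (simp add: space_pair_measure)

text \<open>The period cell is centred at 0 because kernel decay in |u| can be required of a
  periodic function only for |u| \<le> 1/2. Kernel bounds enter integrals through this fact.\<close>

lemma AE_unif: "AE u in unif. \<bar>u\<bar> \<le> 1/2"
  unfolding unif_def by (rule AE_uniform_measureI) (auto simp: abs_le_iff)

lemma AE_unif2: "AE u in unif2. \<bar>fst u\<bar> \<le> 1/2 \<and> \<bar>snd u\<bar> \<le> 1/2"
proof (rule unif2.AE_pair_measure)
  show "AE x in unif. AE y in unif. \<bar>fst (x, y)\<bar> \<le> 1/2 \<and> \<bar>snd (x, y)\<bar> \<le> 1/2"
    using AE_unif by eventually_elim (use AE_unif in auto)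
  have "{x :: real \<times> real. \<bar>fst x\<bar> \<le> 1/2 \<and> \<bar>snd x\<bar> \<le> 1/2} \<in> sets borel"
    by (intro borel_closed closed_Collect_conj closed_Collect_le continuous_intros)
  then show "{x \<in> space unif2. \<bar>fst x\<bar> \<le> 1/2 \<and> \<bar>snd x\<bar> \<le> 1/2} \<in> sets unif2"
    by (simp only: sets_unif2 space_unif2) simp
qed

definition per :: "(real \<Rightarrow> 'a) \<Rightarrow> bool" where
  "per g \<longleftrightarrow> (\<forall>x. g (x + 1) = g x)"

lemma per_nat: "per g \<Longrightarrow> g (x + real n) = g x"
proof (induction n)
  case (Suc n)
  have "g (x + real (Suc n)) = g ((x + real n) + 1)"
    by (simp add: algebra_simps)
  then show ?case using Suc by (simp add: per_def)
qed simp

lemma per_int: "per g \<Longrightarrow> g (x + real_of_int k) = g x"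
  using per_nat[of g x "nat k"] per_nat[of g "x + of_int k" "nat (- k)"]
  by (cases "k \<ge> 0") auto

lemma per_frac: "per g \<Longrightarrow> g (frac x) = g x"
  using per_int[of g "frac x" "\<lfloor>x\<rfloor>"] by (simp add: frac_def)

lemma nn_integral_shift_indicator:
  fixes g :: "real \<Rightarrow> ennreal"
  assumes [measurable]: "g \<in> borel_measurable borel"
  shows "(\<integral>\<^sup>+x. g x * indicator {a+c..<b+c} x \<partial>lborel) = (\<integral>\<^sup>+x. g (x + c) * indicator {a..<b} x \<partial>lborel)"
proof -
  have "(\<integral>\<^sup>+x. g x * indicator {a+c..<b+c} x \<partial>lborel) =
      (\<integral>\<^sup>+x. g (c + 1 * x) * indicator {a+c..<b+c} (c + 1 * x) \<partial>lborel)"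
    by (subst nn_integral_real_affine[where c = 1 and t = c]) auto
  also have "\<dots> = (\<integral>\<^sup>+x. g (x + c) * indicator {a..<b} x \<partial>lborel)"
    by (intro nn_integral_cong) (auto simp: indicator_def add.commute)
  finally show ?thesis .
qed

lemma nn_integral_split_indicator:
  fixes g :: "real \<Rightarrow> ennreal"
  assumes [measurable]: "g \<in> borel_measurable borel" and "a \<le> b" "b \<le> c"
  shows "(\<integral>\<^sup>+x. g x * indicator {a..<c} x \<partial>lborel) =
     (\<integral>\<^sup>+x. g x * indicator {a..<b} x \<partial>lborel) + (\<integral>\<^sup>+x. g x * indicator {b..<c} x \<partial>lborel)"
  using assms by (subst nn_integral_add[symmetric])
    (auto intro!: nn_integral_cong simp: indicator_def)

text \<open>After removing the integer part of a, the interval is cut at 1 and its right piece is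
  moved back by one period.\<close>

lemma nn_integral_period:
  fixes g :: "real \<Rightarrow> ennreal"
  assumes [measurable]: "g \<in> borel_measurable borel" and p: "per g"
  shows "(\<integral>\<^sup>+x. g x * indicator {a..<a+1} x \<partial>lborel) = (\<integral>\<^sup>+x. g x * indicator {0..<1} x \<partial>lborel)"
proof -
  define k where "k = real_of_int \<lfloor>a\<rfloor>"
  define r where "r = frac a"
  have a: "a = r + k" "0 \<le> r" "r \<le> 1"
    by (auto simp: r_def k_def frac_def) (use frac_lt_1[of a] in \<open>auto simp: frac_def\<close>)
  have gk: "g (x + k) = g x" for x
    using per_int[OF p] by (simp add: k_def)
  have g1: "g (x + 1) = g x" for x
    using p by (simp add: per_def)
  have "(\<integral>\<^sup>+x. g x * indicator {a..<a+1} x \<partial>lborel) = (\<integral>\<^sup>+x. g x * indicator {r..<r+1} x \<partial>lborel)"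
    using nn_integral_shift_indicator[of g r k "r + 1"] by (simp add: a gk algebra_simps)
  also have "\<dots> = (\<integral>\<^sup>+x. g x * indicator {r..<1} x \<partial>lborel) + (\<integral>\<^sup>+x. g x * indicator {1..<r+1} x \<partial>lborel)"
    by (rule nn_integral_split_indicator) (use a in auto)
  also have "(\<integral>\<^sup>+x. g x * indicator {1..<r+1} x \<partial>lborel) = (\<integral>\<^sup>+x. g x * indicator {0..<r} x \<partial>lborel)"
    using nn_integral_shift_indicator[of g 0 1 r] by (simp add: g1)
  also have "(\<integral>\<^sup>+x. g x * indicator {r..<1} x \<partial>lborel) + \<dots> = (\<integral>\<^sup>+x. g x * indicator {0..<1} x \<partial>lborel)"
    by (subst nn_integral_split_indicator[of g 0 r 1]) (use a in \<open>auto simp: add.commute\<close>)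
  finally show ?thesis .
qed

lemma nn_integral_periods:
  fixes g :: "real \<Rightarrow> ennreal"
  assumes [measurable]: "g \<in> borel_measurable borel" and p: "per g"
  shows "(\<integral>\<^sup>+x. g x * indicator {a..<a + real n} x \<partial>lborel) = of_nat n * (\<integral>\<^sup>+x. g x * indicator {0..<1} x \<partial>lborel)"
proof (induction n)
  case (Suc n)
  have "(\<integral>\<^sup>+x. g x * indicator {a..<a + real (Suc n)} x \<partial>lborel) =
     (\<integral>\<^sup>+x. g x * indicator {a..<a + real n} x \<partial>lborel) + (\<integral>\<^sup>+x. g x * indicator {a + real n..<a + real n + 1} x \<partial>lborel)"
    by (subst nn_integral_split_indicator[of g a "a + real n"]) (auto simp: algebra_simps)
  then show ?case
    by (simp only: Suc nn_integral_period[OF assms]) (simp add: algebra_simps)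
qed simp

lemma nn_integral_unif_Ico:
  assumes [measurable]: "g \<in> borel_measurable borel"
  shows "(\<integral>\<^sup>+u. g u \<partial>unif) = (\<integral>\<^sup>+x. g x * indicator {-1/2..<1/2} x \<partial>lborel)"
proof -
  have "AE x in lborel. x \<noteq> (1/2::real)"
    by (rule AE_lborel_singleton)
  then have "AE x in lborel. g x * indicator {-1/2..1/2} x = g x * indicator {-1/2..<1/2} x"
    by eventually_elim (auto simp: indicator_def)
  then show ?thesis
    by (simp add: nn_integral_unif nn_integral_cong_AE)
qed

lemma nn_integral_unif_unit:
  assumes [measurable]: "g \<in> borel_measurable borel" and "per g"
  shows "(\<integral>\<^sup>+u. g u \<partial>unif) = (\<integral>\<^sup>+x. g x * indicator {0..<1} x \<partial>lborel)"
  using nn_integral_period[OF assms, of "-1/2"] by (simp add: nn_integral_unif_Ico)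

text \<open>The image of one period covers i periods, and this cancels the factor 1/i of the
  substitution. For i = 0 the left side would degenerate to the value at c.\<close>

lemma nn_integral_unif_affine:
  fixes g :: "real \<Rightarrow> ennreal"
  assumes [measurable]: "g \<in> borel_measurable borel" and p: "per g" and i: "i \<ge> (1::nat)"
  shows "(\<integral>\<^sup>+u. g (c + real i * u) \<partial>unif) = (\<integral>\<^sup>+u. g u \<partial>unif)"
proof -
  let ?I = "\<integral>\<^sup>+x. g x * indicator {0..<1} x \<partial>lborel"
  define a where "a = c - real i / 2"
  have "of_nat i * ?I = (\<integral>\<^sup>+x. g x * indicator {a..<a + real i} x \<partial>lborel)"
    by (rule nn_integral_periods[symmetric]) fact+
  also have "\<dots> = real i * (\<integral>\<^sup>+x. g (c + real i * x) * indicator {a..<a + real i} (c + real i * x) \<partial>lborel)"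
    by (subst nn_integral_real_affine[where c = "real i" and t = c]) (use i in auto)
  also have "(\<integral>\<^sup>+x. g (c + real i * x) * indicator {a..<a + real i} (c + real i * x) \<partial>lborel)
     = (\<integral>\<^sup>+x. g (c + real i * x) * indicator {-1/2..<1/2} x \<partial>lborel)"
  proof (intro nn_integral_cong arg_cong2[where f = "(*)"] refl)
    fix x :: real
    have "a \<le> c + real i * x \<longleftrightarrow> real i * (-1/2) \<le> real i * x"
      by (simp add: a_def)
    also have "\<dots> \<longleftrightarrow> -1/2 \<le> x"
      using i by (subst mult_le_cancel_left_pos) auto
    finally have 1: "a \<le> c + real i * x \<longleftrightarrow> -1/2 \<le> x" .
    have "c + real i * x < a + real i \<longleftrightarrow> real i * x < real i * (1/2)"
      by (simp add: a_def)
    also have "\<dots> \<longleftrightarrow> x < 1/2"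
      using i by (subst mult_less_cancel_left_pos) auto
    finally have 2: "c + real i * x < a + real i \<longleftrightarrow> x < 1/2" .
    from 1 2 show "indicator {a..<a + real i} (c + real i * x) = (indicator {-1/2..<1/2} x :: ennreal)"
      by (simp add: indicator_def)
  qed
  also have "\<dots> = (\<integral>\<^sup>+u. g (c + real i * u) \<partial>unif)"
    by (simp add: nn_integral_unif_Ico)
  finally have "of_nat i * ?I = of_nat i * (\<integral>\<^sup>+u. g (c + real i * u) \<partial>unif)"
    by (simp add: ennreal_of_nat_eq_real_of_nat)
  then have "?I = (\<integral>\<^sup>+u. g (c + real i * u) \<partial>unif)"
    using i by (simp add: ennreal_mult_cancel_left)
  then show ?thesis
    using nn_integral_unif_unit[OF assms(1,2)] by simp
qed

section \<open>Periodic functions of two variables and translation invariance\<close>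

definition per2 :: "(real \<times> real \<Rightarrow> 'a) \<Rightarrow> bool" where
  "per2 g \<longleftrightarrow> (\<forall>x y. g (x + 1, y) = g (x, y) \<and> g (x, y + 1) = g (x, y))"

lemma per2_D1: "per2 g \<Longrightarrow> per (\<lambda>x. g (x, y))"
  and per2_D2: "per2 g \<Longrightarrow> per (\<lambda>y. g (x, y))"
  by (auto simp: per_def per2_def)

lemma nn_integral_unif2_affine:
  fixes g :: "real \<times> real \<Rightarrow> ennreal"
  assumes [measurable]: "g \<in> borel_measurable borel" and p: "per2 g" and i: "i \<ge> (1::nat)" "j \<ge> (1::nat)"
  shows "(\<integral>\<^sup>+u. g (c + real i * fst u, d + real j * snd u) \<partial>unif2) = (\<integral>\<^sup>+u. g u \<partial>unif2)"
proof -
  have "(\<integral>\<^sup>+u. g (c + real i * fst u, d + real j * snd u) \<partial>unif2) =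
      (\<integral>\<^sup>+x. \<integral>\<^sup>+y. g (c + real i * x, d + real j * y) \<partial>unif \<partial>unif)"
    by (subst unif.nn_integral_fst[symmetric]) simp_all
  also have "\<dots> = (\<integral>\<^sup>+x. \<integral>\<^sup>+y. g (c + real i * x, y) \<partial>unif \<partial>unif)"
    by (intro nn_integral_cong nn_integral_unif_affine[where g = "\<lambda>y. g (_, y)"] per2_D2 p i) measurable
  also have "\<dots> = (\<integral>\<^sup>+x. \<integral>\<^sup>+y. g (x, y) \<partial>unif \<partial>unif)"
    by (rule nn_integral_unif_affine[where g = "\<lambda>x. \<integral>\<^sup>+y. g (x, y) \<partial>unif"])
       (use p i in \<open>auto simp: per_def per2_def\<close>)
  also have "\<dots> = (\<integral>\<^sup>+u. g u \<partial>unif2)"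
    by (subst unif.nn_integral_fst) simp_all
  finally show ?thesis .
qed

lemma nn_integral_unif2_shift:
  fixes g :: "real \<times> real \<Rightarrow> ennreal"
  assumes "g \<in> borel_measurable borel" "per2 g"
  shows "(\<integral>\<^sup>+u. g (u + c) \<partial>unif2) = (\<integral>\<^sup>+u. g u \<partial>unif2)"
  using nn_integral_unif2_affine[OF assms, of 1 1 "fst c" "snd c"]
  by (simp add: plus_prod_def add.commute)

lemma borel_measurable_frac [measurable]: "(frac :: real \<Rightarrow> real) \<in> borel_measurable borel"
  unfolding frac_def[abs_def] by measurable

definition frac2 :: "real \<times> real \<Rightarrow> real \<times> real" where
  "frac2 u = (frac (fst u), frac (snd u))"

lemma measurable_frac2 [measurable]: "frac2 \<in> borel_measurable borel"
  unfolding frac2_def[abs_def] by measurable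

lemma per2_frac2:
  assumes "per2 g"
  shows "g (frac2 x) = g x"
proof -
  have "g (frac2 x) = g (fst x, frac (snd x))"
    using per_frac[where g = "\<lambda>t. g (t, frac (snd x))", OF per2_D1[OF assms]] by (simp add: frac2_def)
  also have "\<dots> = g x"
    using per_frac[where g = "\<lambda>t. g (fst x, t)", OF per2_D2[OF assms]] by simp
  finally show ?thesis .
qed

text \<open>The image under \<open>frac2\<close> is Haar measure on the torus. Stating invariance
  for this measure carries it over from nonnegative integrals to Bochner integrals of complex
  functions.\<close>

lemma distr_unif2_shift: "distr unif2 borel (\<lambda>u. frac2 (u + c)) = distr unif2 borel frac2"
proof (rule measure_eqI)
  fix A assume "A \<in> sets (distr unif2 borel (\<lambda>u. frac2 (u + c)))"
  then have A [measurable]: "A \<in> sets borel" by simp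
  have "emeasure (distr unif2 borel (\<lambda>u. frac2 (u + c))) A =
    (\<integral>\<^sup>+x. indicator A x \<partial>distr unif2 borel (\<lambda>u. frac2 (u + c)))"
    by (subst nn_integral_indicator) auto
  also have "\<dots> = (\<integral>\<^sup>+u. indicator A (frac2 (u + c)) \<partial>unif2)"
    by (rule nn_integral_distr) auto
  also have "\<dots> = (\<integral>\<^sup>+u. indicator A (frac2 u) \<partial>unif2)"
    by (rule nn_integral_unif2_shift[where g = "\<lambda>u. indicator A (frac2 u)"])
       (auto simp: per2_def frac2_def frac_1_eq)
  also have "\<dots> = (\<integral>\<^sup>+x. indicator A x \<partial>distr unif2 borel frac2)"
    by (rule nn_integral_distr[symmetric]) auto
  also have "\<dots> = emeasure (distr unif2 borel frac2) A"
    by (subst nn_integral_indicator) auto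
  finally show "emeasure (distr unif2 borel (\<lambda>u. frac2 (u + c))) A = emeasure (distr unif2 borel frac2) A" .
qed simp

lemma integral_unif2_frac2:
  fixes g :: "real \<times> real \<Rightarrow> complex"
  assumes [measurable]: "g \<in> borel_measurable borel" and p: "per2 g"
  shows "(LINT x|distr unif2 borel frac2. g x) = (LINT u|unif2. g u)"
  by (subst integral_distr) (auto simp: per2_frac2[OF p])

lemma integral_unif2_shift:
  fixes g :: "real \<times> real \<Rightarrow> complex"
  assumes [measurable]: "g \<in> borel_measurable borel" and p: "per2 g"
  shows "(LINT u|unif2. g (u + c)) = (LINT u|unif2. g u)"
proof -
  have "(LINT u|unif2. g (u + c)) = (LINT u|unif2. g (frac2 (u + c)))"
    by (simp add: per2_frac2[OF p])
  also have "\<dots> = (LINT x|distr unif2 borel (\<lambda>u. frac2 (u + c)). g x)"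
    by (rule integral_distr[symmetric]) auto
  finally show ?thesis
    by (simp add: distr_unif2_shift integral_unif2_frac2[OF assms])
qed

section \<open>Trigonometric kernels\<close>

definition fchar :: "int \<Rightarrow> real \<Rightarrow> complex" where
  "fchar k u = cis (2 * pi * of_int k * u)"

lemma fchar_0 [simp]: "fchar 0 u = 1" "fchar k 0 = 1"
  by (simp_all add: fchar_def)

lemma norm_fchar [simp]: "cmod (fchar k u) = 1"
  by (simp add: fchar_def)

lemma fchar_mult: "fchar k u * fchar m u = fchar (k + m) u"
  by (simp add: fchar_def cis_mult algebra_simps)

lemma fchar_add: "fchar k (u + v) = fchar k u * fchar k v"
  by (simp add: fchar_def cis_mult algebra_simps)

lemma fchar_cnj: "cnj (fchar k u) = fchar (- k) u"
  by (simp add: fchar_def cis_cnj)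

lemma fchar_of_int: "fchar k (of_int m) = 1"
proof -
  have "2 * pi * of_int k * of_int m = 2 * pi * of_int (k * m)" by simp
  then show ?thesis unfolding fchar_def by (metis cis_multiple_2pi Ints_of_int)
qed

lemma fchar_periodic [simp]: "fchar k (u + 1) = fchar k u"
  using fchar_of_int[of k 1] by (simp add: fchar_add)

lemma continuous_on_fchar [continuous_intros]: "continuous_on A f \<Longrightarrow> continuous_on A (\<lambda>x. fchar k (f x))"
  unfolding fchar_def by (intro continuous_intros)

lemma measurable_fchar [measurable]: "fchar k \<in> borel_measurable borel"
  by (intro borel_measurable_continuous_onI continuous_intros)

lemma measure_unif_UNIV [simp]: "measure unif UNIV = 1"
  using unif.prob_space by simp

lemma measure_unif2_UNIV [simp]: "measure unif2 UNIV = 1"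
  using unif2.prob_space by (simp only: space_unif2)

lemma integral_unif2_fchar:
  "(LINT u|unif2. fchar k (fst u) * fchar m (snd u)) = (if k = 0 \<and> m = 0 then 1 else 0)"
proof (cases "k = 0 \<and> m = 0")
  case True
  then show ?thesis by simp
next
  case False
  let ?I = "LINT u|unif2. fchar k (fst u) * fchar m (snd u)"
  \<comment> \<open>A shift by half a wavelength in a variable of nonzero frequency reverses the
    sign of the integrand, so the integral equals its own negative.\<close>
  obtain c d where cd: "fchar k c * fchar m d = -1"
  proof (cases "k = 0")
    case True
    then have "m \<noteq> 0" using False by simp
    then have "fchar k 0 * fchar m (1 / (2 * of_int m)) = -1" by (simp add: fchar_def)
    then show ?thesis by (rule that)
  next
    case False
    then have "fchar k (1 / (2 * of_int k)) * fchar m 0 = -1" by (simp add: fchar_def)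
    then show ?thesis by (rule that)
  qed
  have "?I = (LINT u|unif2. fchar k (fst (u + (c, d))) * fchar m (snd (u + (c, d))))"
    by (rule integral_unif2_shift[symmetric]) (auto simp: per2_def)
  also have "\<dots> = (LINT u|unif2. (-1) * (fchar k (fst u) * fchar m (snd u)))"
    by (rule Bochner_Integration.integral_cong) (simp_all add: fchar_add cd[symmetric] ac_simps)
  also have "\<dots> = - ?I"
    by simp
  finally have "?I = 0" by simp
  then show ?thesis using False by simp
qed

lemma integral_unif2_fst:
  fixes h :: "real \<Rightarrow> complex"
  assumes [measurable]: "h \<in> borel_measurable borel"
  shows "(LINT u|unif2. h (fst u)) = (LINT u|unif. h u)"
  by (subst unif.distr_pair_fst[of unif, symmetric], subst integral_distr) auto

lemma integral_unif_fchar: "(LINT u|unif. fchar k u) = (if k = 0 then 1 else 0)"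
  using integral_unif2_fchar[of k 0] by (simp add: integral_unif2_fst)

section \<open>Univariate trigonometric polynomials of bounded degree\<close>

inductive trig :: "nat \<Rightarrow> (real \<Rightarrow> complex) \<Rightarrow> bool" for d where
  fchar: "\<bar>k\<bar> \<le> int d \<Longrightarrow> trig d (fchar k)"
| add: "trig d g \<Longrightarrow> trig d h \<Longrightarrow> trig d (\<lambda>u. g u + h u)"
| scale: "trig d g \<Longrightarrow> trig d (\<lambda>u. c * g u)"

lemma trig_const: "trig d (\<lambda>u. c)"
  using trig.scale[OF trig.fchar[of 0 d], of c] by simp

lemma trig_sum: "(\<And>i. i \<in> I \<Longrightarrow> trig d (g i)) \<Longrightarrow> trig d (\<lambda>u. \<Sum>i\<in>I. g i u)"
  by (induction I rule: infinite_finite_induct) (auto intro: trig.add trig_const)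

lemma trig_mono: "trig d g \<Longrightarrow> d \<le> d' \<Longrightarrow> trig d' g"
  by (induction rule: trig.induct) (auto intro: trig.intros)

lemma trig_cnj: "trig d g \<Longrightarrow> trig d (\<lambda>u. cnj (g u))"
  by (induction rule: trig.induct) (auto intro: trig.intros simp: fchar_cnj[abs_def])

lemma trig_shift: "trig d g \<Longrightarrow> trig d (\<lambda>u. g (u + c))"
proof (induction rule: trig.induct)
  case (fchar k)
  then show ?case
    using trig.scale[OF trig.fchar[OF fchar], of "fchar k c"] by (simp add: fchar_add mult.commute)
qed (auto intro: trig.intros)

lemma trig_mult_fchar: "trig d g \<Longrightarrow> \<bar>k\<bar> \<le> int d' \<Longrightarrow> trig (d + d') (\<lambda>u. fchar k u * g u)"
proof (induction rule: trig.induct)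
  case (fchar m)
  then show ?case by (auto simp: fchar_mult intro: trig.fchar)
next
  case (add g h)
  then show ?case by (auto simp: distrib_left intro: trig.add)
next
  case (scale g c)
  then show ?case using trig.scale[of "d + d'" "\<lambda>u. fchar k u * g u" c] by (simp add: ac_simps)
qed

lemma trig_mult: "trig d' h \<Longrightarrow> trig d g \<Longrightarrow> trig (d + d') (\<lambda>u. h u * g u)"
proof (induction rule: trig.induct)
  case (fchar k)
  then show ?case by (auto intro: trig_mult_fchar)
next
  case (add f h)
  then show ?case by (auto simp: distrib_right intro: trig.add)
next
  case (scale f c)
  then show ?case using trig.scale[of "d + d'" "\<lambda>u. f u * g u" c] by (simp add: ac_simps)
qed

lemma trig_power: "trig d g \<Longrightarrow> trig (r * d) (\<lambda>u. g u ^ r)"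
proof (induction r)
  case (Suc r)
  then show ?case using trig_mult[of d g "r * d" "\<lambda>u. g u ^ r"] by (simp add: add.commute)
qed (use trig_const in auto)

lemma trig_continuous: "trig d g \<Longrightarrow> continuous_on A g"
  by (induction rule: trig.induct) (auto intro!: continuous_intros continuous_on_fchar[of A "\<lambda>x. x"])

lemma trig_measurable: "trig d g \<Longrightarrow> g \<in> borel_measurable borel"
  by (simp add: borel_measurable_continuous_onI trig_continuous)

lemma trig_per: "trig d g \<Longrightarrow> per g"
  by (induction rule: trig.induct) (auto simp: per_def)

lemma trig_bounded: "trig d g \<Longrightarrow> \<exists>B. \<forall>u. cmod (g u) \<le> B"
proof (induction rule: trig.induct)
  case (add g h)
  then obtain B B' where "\<forall>u. cmod (g u) \<le> B" "\<forall>u. cmod (h u) \<le> B'" by blast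
  then have "\<forall>u. cmod (g u + h u) \<le> B + B'" by (meson norm_triangle_mono)
  then show ?case by blast
next
  case (scale g c)
  then obtain B where "\<forall>u. cmod (g u) \<le> B" by blast
  then have "\<forall>u. cmod (c * g u) \<le> cmod c * B" by (auto simp: norm_mult mult_left_mono)
  then show ?case by blast
qed auto

text \<open>The inductive predicate suits closure arguments; coefficients are extracted only where
  products of kernels have to be expanded frequency by frequency.\<close>

lemma trig_explicit:
  "trig d g \<Longrightarrow> \<exists>c. \<forall>u. g u = (\<Sum>k\<in>{- int d..int d}. c k * fchar k u)"
proof (induction rule: trig.induct)
  case (fchar k)
  then have "fchar k u = (\<Sum>m\<in>{- int d..int d}. (if m = k then 1 else 0) * fchar m u)" for u
    by (subst sum.remove[of _ k]) (auto intro!: sum.neutral)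
  then show ?case by (intro exI[of _ "\<lambda>m. if m = k then 1 else 0"]) blast
next
  case (add g h)
  then obtain a b where "\<forall>u. g u = (\<Sum>k\<in>{- int d..int d}. a k * fchar k u)"
    "\<forall>u. h u = (\<Sum>k\<in>{- int d..int d}. b k * fchar k u)" by blast
  then show ?case
    by (intro exI[of _ "\<lambda>k. a k + b k"]) (simp add: distrib_right sum.distrib)
next
  case (scale g c)
  then obtain a where "\<forall>u. g u = (\<Sum>k\<in>{- int d..int d}. a k * fchar k u)" by blast
  then show ?case
    by (intro exI[of _ "\<lambda>k. c * a k"]) (simp add: sum_distrib_left mult.assoc)
qed

section \<open>Dirichlet kernels: size, zeros and mean square\<close>

definition dirichlet :: "nat \<Rightarrow> real \<Rightarrow> complex" where
  "dirichlet N u = (\<Sum>k<N. fchar (int k) u)"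

lemma trig_dirichlet: "trig (N - 1) (dirichlet N)"
  unfolding dirichlet_def[abs_def] by (intro trig_sum trig.fchar) auto

lemma dirichlet_continuous [continuous_intros]: "continuous_on A (dirichlet N)"
  by (rule trig_continuous[OF trig_dirichlet])

lemma dirichlet_measurable [measurable]: "dirichlet N \<in> borel_measurable borel"
  by (rule trig_measurable[OF trig_dirichlet])

lemma norm_dirichlet_le: "cmod (dirichlet N u) \<le> real N"
  unfolding dirichlet_def by (rule order_trans[OF norm_sum]) simp

lemma norm_one_minus_cis: "cmod (1 - cis t) = 2 * \<bar>sin (t / 2)\<bar>"
proof -
  have "(cmod (1 - cis t))\<^sup>2 = (1 - cos t)\<^sup>2 + (sin t)\<^sup>2"
    by (simp add: cmod_power2)
  also have "\<dots> = 2 - 2 * cos t"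
    using sin_cos_squared_add[of t] by (simp add: power2_diff algebra_simps)
  also have "\<dots> = (2 * \<bar>sin (t / 2)\<bar>)\<^sup>2"
    using cos_double_sin[of "t / 2"] by (simp add: power_mult_distrib)
  finally show ?thesis
    by (subst (asm) power2_eq_iff_nonneg) auto
qed

lemma dirichlet_sin: "cmod (dirichlet N u) * \<bar>sin (pi * u)\<bar> = \<bar>sin (pi * real N * u)\<bar>"
proof -
  have "dirichlet N u * (1 - fchar 1 u) = 1 - fchar (int N) u"
  proof (induction N)
    case (Suc N)
    have "dirichlet (Suc N) u * (1 - fchar 1 u) = (1 - fchar (int N) u) + fchar (int N) u * (1 - fchar 1 u)"
      by (simp add: Suc[symmetric] dirichlet_def distrib_right)
    then show ?case by (simp add: right_diff_distrib fchar_mult add.commute)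
  qed (simp add: dirichlet_def)
  then have "cmod (dirichlet N u) * cmod (1 - fchar 1 u) = cmod (1 - fchar (int N) u)"
    by (metis norm_mult)
  then show ?thesis
    by (simp add: fchar_def norm_one_minus_cis mult.assoc)
qed

text \<open>The mean value theorem is applied at half the angle: sin x = 2 sin (x/2) cos (x/2)
  becomes x cos z cos (x/2), where both cosines have arguments in [0, pi/4] and hence a product of
  at least 1/2.\<close>

lemma sin_ge_half:
  assumes "0 \<le> x" "x \<le> pi / 2"
  shows "x / 2 \<le> sin x"
proof (cases "x = 0")
  case False
  then have x: "0 < x / 2" using assms by simp
  obtain z where z: "0 < z" "z < x / 2" "sin (x / 2) - sin 0 = (x / 2 - 0) * cos z"
    using MVT2[OF x, of sin cos] by (auto simp: DERIV_sin)
  have c: "sqrt 2 / 2 \<le> cos y" if "0 \<le> y" "y \<le> pi / 4" for y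
    using cos_monotone_0_pi_le[of y "pi / 4"] that by (simp add: cos_45)
  have "sqrt 2 / 2 * (sqrt 2 / 2) \<le> cos z * cos (x / 2)"
    using z x assms by (intro mult_mono c) (auto intro!: order_trans[OF _ c])
  then have "1 / 2 \<le> cos z * cos (x / 2)" by simp
  then have "x * (1 / 2) \<le> x * (cos z * cos (x / 2))"
    using assms by (intro mult_left_mono) auto
  also have "\<dots> = sin x"
    using z(3) sin_double[of "x / 2"] by simp
  finally show ?thesis by simp
qed simp

lemma abs_sin_pi_ge:
  assumes "\<bar>u\<bar> \<le> 1/2"
  shows "\<bar>u\<bar> \<le> \<bar>sin (pi * u)\<bar>"
proof -
  have "pi * \<bar>u\<bar> \<le> pi * (1/2)"
    by (rule mult_left_mono[OF assms]) simp
  then have "pi * \<bar>u\<bar> / 2 \<le> sin (pi * \<bar>u\<bar>)"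
    by (intro sin_ge_half) auto
  also have "\<dots> \<le> \<bar>sin (pi * u)\<bar>"
    by (cases "u \<ge> 0") auto
  finally have "pi * \<bar>u\<bar> / 2 \<le> \<bar>sin (pi * u)\<bar>" .
  moreover have "2 * \<bar>u\<bar> \<le> pi * \<bar>u\<bar>"
    using pi_gt3 by (intro mult_right_mono) auto
  ultimately show ?thesis by linarith
qed

text \<open>Adds the two elementary bounds |D| \<le> N and |D| |u| \<le> 1, squared, the second one
  multiplied by N^2.\<close>

lemma dirichlet_sq_le:
  assumes "\<bar>u\<bar> \<le> 1/2"
  shows "(cmod (dirichlet N u))\<^sup>2 * (1 + (real N * u)\<^sup>2) \<le> 2 * (real N)\<^sup>2"
proof -
  have "cmod (dirichlet N u) * \<bar>u\<bar> \<le> cmod (dirichlet N u) * \<bar>sin (pi * u)\<bar>"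
    using abs_sin_pi_ge[OF assms] by (intro mult_left_mono) auto
  also have "\<dots> \<le> 1" by (simp add: dirichlet_sin)
  finally have "(cmod (dirichlet N u) * \<bar>u\<bar>)\<^sup>2 \<le> 1\<^sup>2"
    by (intro power_mono) auto
  then have "(real N)\<^sup>2 * (cmod (dirichlet N u) * \<bar>u\<bar>)\<^sup>2 \<le> (real N)\<^sup>2 * 1"
    by (intro mult_left_mono) auto
  moreover have "(cmod (dirichlet N u))\<^sup>2 \<le> (real N)\<^sup>2"
    using norm_dirichlet_le by (intro power_mono) auto
  moreover have "(cmod (dirichlet N u))\<^sup>2 * (1 + (real N * u)\<^sup>2) =
      (cmod (dirichlet N u))\<^sup>2 + (real N)\<^sup>2 * (cmod (dirichlet N u) * \<bar>u\<bar>)\<^sup>2"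
    by (simp add: algebra_simps power_mult_distrib)
  ultimately show ?thesis
    by linarith
qed

text \<open>In this range every phase 2 pi k u with k < N is at most pi/3 in absolute value, so each
  summand has real part at least 1/2.\<close>

lemma dirichlet_lower:
  assumes "N \<ge> 1" "\<bar>u\<bar> \<le> 1 / (6 * real N)"
  shows "real N / 2 \<le> cmod (dirichlet N u)"
proof -
  have "1/2 \<le> cos (2 * pi * real k * u)" if "k < N" for k
  proof -
    have "real k * \<bar>u\<bar> \<le> real N * (1 / (6 * real N))"
      using that assms by (intro mult_mono) auto
    also have "\<dots> = 1/6" using assms by simp
    finally have "2 * pi * (real k * \<bar>u\<bar>) \<le> 2 * pi * (1/6)"
      by (intro mult_left_mono) auto
    then have "cos (pi / 3) \<le> cos (2 * pi * (real k * \<bar>u\<bar>))"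
      by (intro cos_monotone_0_pi_le) auto
    also have "\<dots> = cos (2 * pi * real k * u)"
      by (cases "u \<ge> 0") (auto simp: mult.assoc)
    finally show ?thesis by (simp add: cos_60)
  qed
  then have "(\<Sum>k<N. 1/2) \<le> (\<Sum>k<N. cos (2 * pi * real k * u))"
    by (intro sum_mono) auto
  also have "\<dots> = Re (dirichlet N u)"
    by (simp add: dirichlet_def fchar_def)
  also have "\<dots> \<le> cmod (dirichlet N u)"
    by (rule complex_Re_le_cmod)
  finally show ?thesis by simp
qed

lemma integrable_unif_bounded:
  fixes g :: "real \<Rightarrow> 'a :: {banach, second_countable_topology}"
  assumes [measurable]: "g \<in> borel_measurable borel" and "\<And>u. norm (g u) \<le> B"
  shows "integrable unif g"
  by (rule unif.integrable_const_bound[where B = B]) (use assms in auto)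

lemma cmod_sq_dirichlet: "complex_of_real ((cmod (dirichlet N u))\<^sup>2) = (\<Sum>k<N. \<Sum>m<N. fchar (int k - int m) u)"
proof -
  have "complex_of_real ((cmod (dirichlet N u))\<^sup>2) = dirichlet N u * cnj (dirichlet N u)"
    by (rule complex_norm_square)
  also have "\<dots> = (\<Sum>k<N. \<Sum>m<N. fchar (int k) u * fchar (- int m) u)"
    by (simp add: dirichlet_def sum_product fchar_cnj)
  finally show ?thesis by (simp add: fchar_mult)
qed

text \<open>Parseval: of the N^2 pairs of frequencies only the N diagonal ones survive
  integration.\<close>

lemma nn_integral_dirichlet: "(\<integral>\<^sup>+u. ennreal ((cmod (dirichlet N u))\<^sup>2) \<partial>unif) = ennreal (real N)"
proof -
  have i: "integrable unif (\<lambda>u. (cmod (dirichlet N u))\<^sup>2)"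
    by (rule integrable_unif_bounded[where B = "(real N)\<^sup>2"]) (auto intro!: power_mono norm_dirichlet_le)
  have ic: "integrable unif (fchar k)" for k
    by (rule integrable_unif_bounded[where B = 1]) auto
  have "complex_of_real (LINT u|unif. (cmod (dirichlet N u))\<^sup>2) = (LINT u|unif. complex_of_real ((cmod (dirichlet N u))\<^sup>2))"
    by (rule integral_complex_of_real[symmetric])
  also have "\<dots> = (\<Sum>k<N. \<Sum>m<N. LINT u|unif. fchar (int k - int m) u)"
    unfolding cmod_sq_dirichlet by (simp add: ic)
  also have "\<dots> = (\<Sum>k<N. \<Sum>m<N. if k = m then 1 else 0)"
    by (simp add: integral_unif_fchar)
  also have "\<dots> = complex_of_real (real N)"
    by simp
  finally have "(LINT u|unif. (cmod (dirichlet N u))\<^sup>2) = real N"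
    using of_real_eq_iff by blast
  then show ?thesis
    by (subst nn_integral_eq_integral[OF i]) auto
qed

section \<open>Decaying kernels of bounded mass\<close>

definition wker :: "nat \<Rightarrow> real \<Rightarrow> real" where
  "wker N u = real N / (1 + (real N * u)\<^sup>2)"

text \<open>
  A single Fejer kernel has zeros, so it cannot dominate the decay kernel. Shifting by half a zero
  spacing turns the numerator into \<open>sin\<^sup>2 + cos\<^sup>2\<close>, which removes the zeros.
\<close>

definition fejer :: "nat \<Rightarrow> real \<Rightarrow> real" where
  "fejer N u = ((cmod (dirichlet N u))\<^sup>2 + (cmod (dirichlet N (u + 1 / (2 * real N))))\<^sup>2) / real N"

lemma wker_pos: "1 + (real N * u)\<^sup>2 > 0"
  by (simp add: add_pos_nonneg)

lemma wker_nonneg [simp]: "0 \<le> wker N u"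
  and fejer_nonneg [simp]: "0 \<le> fejer N u"
  by (auto simp: wker_def fejer_def)

lemma measurable_wker [measurable]: "wker N \<in> borel_measurable borel"
  unfolding wker_def[abs_def] by measurable

lemma measurable_fejer [measurable]: "fejer N \<in> borel_measurable borel"
  unfolding fejer_def[abs_def] by measurable

lemma wker_le_fejer:
  assumes "N \<ge> 1"
  shows "wker N u \<le> 20 * fejer N u"
proof -
  define v where "v = u + 1 / (2 * real N)"
  define n where "n = real N"
  have n: "n \<ge> 1" using assms by (simp add: n_def)
  \<comment> \<open>A common upper bound for the squared sines at u and v, from sin^2 x \<le> x^2
    and (x + y)^2 \<le> 2 x^2 + 2 y^2. The final constant 20 is 2 times the bound 10 for
    pi^2.\<close>
  define q where "q = 2 * pi\<^sup>2 * (u\<^sup>2 + 1 / (4 * n\<^sup>2))"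
  have q: "q > 0" using n unfolding q_def by (intro mult_pos_pos add_nonneg_pos) auto
  have s: "(sin (pi * x))\<^sup>2 \<le> (pi * x)\<^sup>2" for x
    using abs_sin_x_le_abs_x[of "pi * x"] by (metis abs_le_square_iff)
  have "(pi * u)\<^sup>2 \<le> q"
    unfolding q_def by (simp add: power_mult_distrib algebra_simps)
  with s[of u] have su: "(sin (pi * u))\<^sup>2 \<le> q" by linarith
  have "v\<^sup>2 \<le> 2 * (u\<^sup>2 + (1 / (2 * n))\<^sup>2)"
    unfolding v_def n_def[symmetric] using zero_le_power2[of "u - 1 / (2 * n)"]
    by (simp add: power2_sum power2_diff algebra_simps)
  then have "pi\<^sup>2 * v\<^sup>2 \<le> pi\<^sup>2 * (2 * (u\<^sup>2 + (1 / (2 * n))\<^sup>2))"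
    by (intro mult_left_mono) auto
  then have "(pi * v)\<^sup>2 \<le> q"
    unfolding q_def by (simp add: power_mult_distrib power_divide algebra_simps)
  with s[of v] have shift_sum: "(sin (pi * v))\<^sup>2 \<le> q" by linarith
  have "pi * real N * v = pi * real N * u + pi / 2"
    using assms by (simp add: v_def field_simps)
  then have "sin (pi * real N * v) = cos (pi * real N * u)"
    by (simp add: sin_add)
  then have "1 = (sin (pi * real N * u))\<^sup>2 + (sin (pi * real N * v))\<^sup>2"
    by simp
  also have "\<dots> = (cmod (dirichlet N u))\<^sup>2 * (sin (pi * u))\<^sup>2 + (cmod (dirichlet N v))\<^sup>2 * (sin (pi * v))\<^sup>2"
    using dirichlet_sin[of N u, symmetric] dirichlet_sin[of N v, symmetric]
    by (metis power2_abs power_mult_distrib)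
  also have "\<dots> \<le> (cmod (dirichlet N u))\<^sup>2 * q + (cmod (dirichlet N v))\<^sup>2 * q"
    by (intro add_mono mult_left_mono su shift_sum) auto
  also have "\<dots> = fejer N u * (n * q)"
    using n by (simp add: fejer_def v_def n_def field_simps)
  finally have 1: "1 \<le> fejer N u * (n * q)" .
  have "n * q = pi\<^sup>2 * (2 * n * u\<^sup>2 + 1 / (2 * n))"
    using n by (simp add: q_def field_simps power2_eq_square)
  also have "\<dots> \<le> 10 * (2 * n * u\<^sup>2 + 1 / (2 * n))"
  proof (intro mult_right_mono)
    have "pi \<le> 3.15" using pi_approx by simp
    then have "pi\<^sup>2 \<le> 3.15\<^sup>2" by (intro power_mono) auto
    also have "\<dots> \<le> (10::real)" by (simp add: power2_eq_square)
    finally show "pi\<^sup>2 \<le> 10" .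
  qed (use n in auto)
  also have "\<dots> \<le> 20 * (n * u\<^sup>2 + 1 / n)"
    using n by (simp add: field_simps)
  finally have "fejer N u * (n * q) \<le> fejer N u * (20 * (n * u\<^sup>2 + 1 / n))"
    by (intro mult_left_mono) auto
  with 1 have "1 \<le> fejer N u * (20 * (n * u\<^sup>2 + 1 / n))" by linarith
  then have "n * 1 \<le> n * (fejer N u * (20 * (n * u\<^sup>2 + 1 / n)))"
    using n by (intro mult_left_mono) auto
  also have "\<dots> = 20 * fejer N u * (1 + (n * u)\<^sup>2)"
    using n by (simp add: field_simps power2_eq_square)
  finally show ?thesis
    unfolding wker_def n_def[symmetric] using wker_pos[of N u]
    by (simp add: pos_divide_le_eq n_def)
qed

lemma nn_integral_fejer:
  assumes "N \<ge> 1"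
  shows "(\<integral>\<^sup>+u. ennreal (fejer N u) \<partial>unif) = 2"
proof -
  have p: "per (\<lambda>u. ennreal ((cmod (dirichlet N u))\<^sup>2))"
    using trig_per[OF trig_dirichlet] by (simp add: per_def)
  have "(\<integral>\<^sup>+u. ennreal ((cmod (dirichlet N (1 / (2 * real N) + real 1 * u)))\<^sup>2) \<partial>unif) = ennreal (real N)"
    by (subst nn_integral_unif_affine[OF _ p]) (auto simp: nn_integral_dirichlet)
  then have s: "(\<integral>\<^sup>+u. ennreal ((cmod (dirichlet N (u + 1 / (2 * real N))))\<^sup>2) \<partial>unif) = ennreal (real N)"
    by (simp add: add.commute)
  have "(\<integral>\<^sup>+u. ennreal (fejer N u) \<partial>unif) =
    (\<integral>\<^sup>+u. ennreal (1 / real N) * (ennreal ((cmod (dirichlet N u))\<^sup>2) + ennreal ((cmod (dirichlet N (u + 1 / (2 * real N))))\<^sup>2)) \<partial>unif)"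
    by (intro nn_integral_cong) (simp add: fejer_def ennreal_mult[symmetric] ennreal_plus[symmetric] del: ennreal_plus)
  also have "\<dots> = ennreal (1 / real N) * (ennreal (real N) + ennreal (real N))"
    by (simp add: nn_integral_cmult nn_integral_add nn_integral_dirichlet s)
  also have "\<dots> = ennreal 2"
    using assms by (simp add: ennreal_mult[symmetric] ennreal_plus[symmetric] del: ennreal_plus)
  finally show ?thesis by simp
qed

lemma nn_integral_wker:
  assumes "N \<ge> 1"
  shows "(\<integral>\<^sup>+u. ennreal (wker N u) \<partial>unif) \<le> 40"
proof -
  have "(\<integral>\<^sup>+u. ennreal (wker N u) \<partial>unif) \<le> (\<integral>\<^sup>+u. 20 * ennreal (fejer N u) \<partial>unif)"
    using wker_le_fejer[OF assms] by (intro nn_integral_mono) (simp add: ennreal_mult'[symmetric] ennreal_leI flip: ennreal_numeral)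
  also have "\<dots> = 20 * 2"
    by (simp add: nn_integral_cmult nn_integral_fejer[OF assms])
  finally show ?thesis by simp
qed

text \<open>The factor N on the right is the normalisation of a kernel of width 1/N. The product
  form lets powers of the weight be split off without divisions.\<close>

definition decays :: "nat \<Rightarrow> real \<Rightarrow> nat \<Rightarrow> (real \<Rightarrow> complex) \<Rightarrow> bool" where
  "decays r C N A \<longleftrightarrow> (\<forall>u. \<bar>u\<bar> \<le> 1/2 \<longrightarrow> cmod (A u) * (1 + (real N * u)\<^sup>2) ^ r \<le> C * real N)"

text \<open>The kernel is |D_N|^(2r) divided by its integral I. Its decay is the r-th power of
  \<open>dirichlet_sq_le\<close>, and a lower bound for I of the right order turns this into a
  constant independent of N.\<close>

lemma jackson_kernel:
  assumes N: "N \<ge> 1"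
  shows "\<exists>J. trig (2 * r * N) J \<and> decays r (3 * 8 ^ r) N J \<and> (LINT u|unif. J u) = 1"
proof -
  define I where "I = (LINT u|unif. cmod (dirichlet N u) ^ (2 * r))"
  define J where "J = (\<lambda>u. complex_of_real (cmod (dirichlet N u) ^ (2 * r) / I))"
  have i: "integrable unif (\<lambda>u. cmod (dirichlet N u) ^ (2 * r))"
    by (rule integrable_unif_bounded[where B = "real N ^ (2 * r)"]) (auto intro!: power_mono norm_dirichlet_le)
  define c where "c = (real N / 2) ^ (2 * r)"
  \<comment> \<open>On |u| \<le> a the integrand is at least c by \<open>dirichlet_lower\<close>, so
    c times the length 2a = 1/(3N) bounds I from below. This is the origin of the 3; the 8 is 2 *
    2^2, from 2 N^2 = 8 (N/2)^2.\<close>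
  define a where "a = 1 / (6 * real N)"
  have a: "0 \<le> a" "a \<le> 1/2" using N by (auto simp: a_def field_simps)
  have "ennreal (c / (3 * real N)) = ennreal c * emeasure lborel {-a..a}"
    using a N by (simp add: a_def c_def ennreal_mult[symmetric])
  also have "\<dots> = (\<integral>\<^sup>+u. ennreal c * indicator {-a..a} u \<partial>lborel)"
    by (rule nn_integral_cmult_indicator[symmetric]) auto
  also have "\<dots> \<le> (\<integral>\<^sup>+u. ennreal (cmod (dirichlet N u) ^ (2 * r)) * indicator {-1/2..1/2} u \<partial>lborel)"
  proof (intro nn_integral_mono)
    fix u :: real
    show "ennreal c * indicator {-a..a} u \<le> ennreal (cmod (dirichlet N u) ^ (2 * r)) * indicator {-1/2..1/2} u"
    proof (cases "u \<in> {-a..a}")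
      case True
      then have "c \<le> cmod (dirichlet N u) ^ (2 * r)"
        unfolding c_def by (intro power_mono dirichlet_lower N) (auto simp: a_def)
      then show ?thesis using True a by (auto simp: indicator_def ennreal_leI)
    qed auto
  qed
  also have "\<dots> = (\<integral>\<^sup>+u. ennreal (cmod (dirichlet N u) ^ (2 * r)) \<partial>unif)"
    by (rule nn_integral_unif[symmetric]) auto
  also have "\<dots> = ennreal I"
    unfolding I_def by (rule nn_integral_eq_integral[OF i]) auto
  finally have "ennreal (c / (3 * real N)) \<le> ennreal I" .
  moreover have I0: "0 \<le> I" unfolding I_def by (intro integral_nonneg_AE) auto
  ultimately have Ic: "c / (3 * real N) \<le> I" by simp
  have c0: "c > 0" using N by (simp add: c_def)
  then have "0 < c / (3 * real N)" using N by simp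
  with Ic have Ipos: "I > 0" by linarith
  have "trig (r * (2 * N)) (\<lambda>u. (cnj (dirichlet N u) * dirichlet N u) ^ r)"
    by (intro trig_power trig_mono[OF trig_mult[OF trig_cnj[OF trig_dirichlet] trig_dirichlet]]) auto
  then have "trig (r * (2 * N)) (\<lambda>u. (1 / of_real I) * (cnj (dirichlet N u) * dirichlet N u) ^ r)"
    by (rule trig.scale)
  moreover have "(1 / of_real I) * (cnj (dirichlet N u) * dirichlet N u) ^ r = J u" for u
  proof -
    have "cnj (dirichlet N u) * dirichlet N u = complex_of_real ((cmod (dirichlet N u))\<^sup>2)"
      by (simp only: complex_norm_square mult.commute)
    then show ?thesis
      unfolding J_def by (simp only: power_mult of_real_power of_real_divide) simp
  qed
  ultimately have 1: "trig (2 * r * N) J"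
    by (simp add: mult.commute mult.left_commute)
  have 2: "decays r (3 * 8 ^ r) N J"
    unfolding decays_def
  proof (intro allI impI)
    fix u :: real assume u: "\<bar>u\<bar> \<le> 1/2"
    have "cmod (J u) * (1 + (real N * u)\<^sup>2) ^ r = ((cmod (dirichlet N u))\<^sup>2 * (1 + (real N * u)\<^sup>2)) ^ r / I"
      using Ipos by (simp add: J_def norm_divide norm_power power_mult power_mult_distrib)
    also have "\<dots> \<le> (2 * (real N)\<^sup>2) ^ r / (c / (3 * real N))"
      using dirichlet_sq_le[OF u, of N] Ic c0 N
      by (intro frac_le power_mono mult_nonneg_nonneg) auto
    also have "\<dots> = 3 * 8 ^ r * real N"
    proof -
      have "(2 * (real N)\<^sup>2) ^ r = 8 ^ r * c"
      proof -
        have "8 ^ r * c = (8 * (real N / 2)\<^sup>2) ^ r"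
          by (simp only: c_def power_mult power_mult_distrib[of 8])
        also have "8 * (real N / 2)\<^sup>2 = 2 * (real N)\<^sup>2"
          by (simp add: power_divide)
        finally show ?thesis by simp
      qed
      then show ?thesis using c0 N by simp
    qed
    finally show "cmod (J u) * (1 + (real N * u)\<^sup>2) ^ r \<le> 3 * 8 ^ r * real N" .
  qed
  have "(LINT u|unif. J u) = complex_of_real (LINT u|unif. cmod (dirichlet N u) ^ (2 * r) / I)"
    unfolding J_def by (rule integral_complex_of_real)
  also have "\<dots> = 1" using Ipos by (simp add: I_def)
  finally have 3: "(LINT u|unif. J u) = 1" .
  with 1 2 show ?thesis by blast
qed

text \<open>An average over b < N of sums over windows of M = 2d + N consecutive frequencies, d =
  RN. Every window contains [-d, d], so each frequency there has coefficient 1. The average is, up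
  to a character, the product of D_M and the conjugate of D_N divided by N; having two Dirichlet
  factors is what gives quadratic decay.\<close>

lemma vallee_poussin_kernel:
  assumes N: "N \<ge> 1"
  shows "\<exists>V. trig (2 * R * N + N) V \<and> decays 1 ((2 * real R + 1)\<^sup>2 + 1) N V \<and>
     (\<forall>k. \<bar>k\<bar> \<le> int (R * N) \<longrightarrow> (LINT u|unif. V u * fchar k u) = 1)"
proof -
  define d where "d = R * N"
  define M where "M = 2 * d + N"
  define V where "V = (\<lambda>u. (1 / of_nat N) * (\<Sum>a<M. \<Sum>b<N. fchar (int a - int d - int b) u))"
  have "trig (2 * d + N) V"
    unfolding V_def by (intro trig.scale trig_sum trig.fchar) (auto simp: M_def)
  then have 1: "trig (2 * R * N + N) V"
    by (simp add: d_def mult.assoc)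
  have Vn: "cmod (V u) = cmod (dirichlet M u) * cmod (dirichlet N u) / real N" for u
  proof -
    have "(\<Sum>a<M. \<Sum>b<N. fchar (int a - int d - int b) u) = fchar (- int d) u * (dirichlet M u * cnj (dirichlet N u))"
    proof -
      have "fchar (int a - int d - int b) u = fchar (- int d) u * (fchar (int a) u * fchar (- int b) u)" for a b
        by (simp add: fchar_mult algebra_simps)
      then show ?thesis
        unfolding dirichlet_def cnj_sum fchar_cnj sum_product by (simp only: sum_distrib_left)
    qed
    then show ?thesis by (simp add: V_def norm_mult norm_divide)
  qed
  have 2: "decays 1 ((2 * real R + 1)\<^sup>2 + 1) N V"
    unfolding decays_def
  proof (intro allI impI)
    fix u :: real assume u: "\<bar>u\<bar> \<le> 1/2"
    let ?w = "1 + (real N * u)\<^sup>2"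
    have "(real N * u)\<^sup>2 \<le> (real M * u)\<^sup>2"
      unfolding power_mult_distrib by (intro mult_right_mono power_mono) (auto simp: M_def)
    then have "(cmod (dirichlet M u))\<^sup>2 * ?w \<le> (cmod (dirichlet M u))\<^sup>2 * (1 + (real M * u)\<^sup>2)"
      by (intro mult_left_mono) auto
    also have "\<dots> \<le> 2 * (real M)\<^sup>2" by (rule dirichlet_sq_le[OF u])
    finally have a: "(cmod (dirichlet M u))\<^sup>2 * ?w \<le> 2 * (real M)\<^sup>2" .
    have b: "(cmod (dirichlet N u))\<^sup>2 * ?w \<le> 2 * (real N)\<^sup>2" by (rule dirichlet_sq_le[OF u])
    have "2 * (cmod (dirichlet M u) * cmod (dirichlet N u)) \<le> (cmod (dirichlet M u))\<^sup>2 + (cmod (dirichlet N u))\<^sup>2"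
      using zero_le_power2[of "cmod (dirichlet M u) - cmod (dirichlet N u)"] by (simp add: power2_diff)
    then have "2 * (cmod (dirichlet M u) * cmod (dirichlet N u)) * ?w \<le> ((cmod (dirichlet M u))\<^sup>2 + (cmod (dirichlet N u))\<^sup>2) * ?w"
      by (intro mult_right_mono) auto
    also have "\<dots> \<le> 2 * (real M)\<^sup>2 + 2 * (real N)\<^sup>2"
      using a b by (simp add: distrib_right)
    finally have "cmod (dirichlet M u) * cmod (dirichlet N u) * ?w \<le> (real M)\<^sup>2 + (real N)\<^sup>2" by simp
    also have "real M = (2 * real R + 1) * real N"
      by (simp add: M_def d_def algebra_simps)
    finally have "cmod (dirichlet M u) * cmod (dirichlet N u) * ?w / real N \<le> (((2 * real R + 1) * real N)\<^sup>2 + (real N)\<^sup>2) / real N"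
      by (intro divide_right_mono) auto
    also have "\<dots> = ((2 * real R + 1)\<^sup>2 + 1) * real N"
      using N by (simp add: power_mult_distrib power2_eq_square field_simps)
    finally show "cmod (V u) * (1 + (real N * u)\<^sup>2) ^ 1 \<le> ((2 * real R + 1)\<^sup>2 + 1) * real N"
      by (simp add: Vn mult.commute)
  qed
  have "(LINT u|unif. V u * fchar k u) = 1" if k: "\<bar>k\<bar> \<le> int (R * N)" for k
  proof -
    have ic: "integrable unif (fchar k)" for k
      by (rule integrable_unif_bounded[where B = 1]) auto
    have "(LINT u|unif. V u * fchar k u) =
      (LINT u|unif. (1 / of_nat N) * (\<Sum>b<N. \<Sum>a<M. fchar (int a - int d - int b + k) u))"
      by (subst sum.swap) (simp add: V_def sum_distrib_right fchar_mult mult.assoc)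
    also have "\<dots> = (1 / of_nat N) * (\<Sum>b<N. \<Sum>a<M. if int a - int d - int b + k = 0 then 1 else 0)"
      by (simp add: ic integral_unif_fchar)
    also have "(\<Sum>b<N. \<Sum>a<M. if int a - int d - int b + k = 0 then 1 else (0::complex)) = (\<Sum>b<N. 1)"
    proof (rule sum.cong[OF refl])
      fix b assume b: "b \<in> {..<N}"
      define a0 where "a0 = nat (int d + int b - k)"
      have a0: "a0 < M" "int a0 = int d + int b - k"
        using k[folded d_def] b by (auto simp: a0_def M_def)
      have "(\<Sum>a<M. if int a - int d - int b + k = 0 then 1 else (0::complex)) = (\<Sum>a<M. if a = a0 then 1 else 0)"
        using a0 by (intro sum.cong) auto
      then show "(\<Sum>a<M. if int a - int d - int b + k = 0 then 1 else (0::complex)) = 1"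
        using a0 by simp
    qed
    finally show ?thesis using N by simp
  qed
  with 1 2 show ?thesis by blast
qed

text \<open>Integrates \<open>t \<le> s + s powr (1 - p) * t powr p\<close> and optimises over \<open>s\<close>.\<close>

lemma nn_jensen:
  fixes K g :: "'a \<Rightarrow> real"
  assumes [measurable]: "K \<in> borel_measurable M" "g \<in> borel_measurable M"
    and nn: "\<And>x. 0 \<le> K x" "\<And>x. 0 \<le> g x" and p: "1 \<le> p"
    and c: "0 \<le> c" "(\<integral>\<^sup>+x. ennreal (K x) \<partial>M) \<le> ennreal c"
    and a: "0 \<le> a" "ennreal a \<le> (\<integral>\<^sup>+x. ennreal (K x * g x) \<partial>M)"
  shows "ennreal (a powr p) \<le> ennreal ((1 + c) powr p) * (\<integral>\<^sup>+x. ennreal (K x * g x powr p) \<partial>M)"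
proof (cases "(\<integral>\<^sup>+x. ennreal (K x * g x powr p) \<partial>M) = \<infinity>")
  case True
  then show ?thesis using c by (simp add: ennreal_mult_top)
next
  case False
  then obtain S where S: "0 \<le> S" "(\<integral>\<^sup>+x. ennreal (K x * g x powr p) \<partial>M) = ennreal S"
    by (cases "(\<integral>\<^sup>+x. ennreal (K x * g x powr p) \<partial>M)") auto
  show ?thesis
  proof (cases "S = 0")
    case True
    then have "(\<integral>\<^sup>+x. ennreal (K x * g x powr p) \<partial>M) = 0"
      using S by simp
    then have "AE x in M. ennreal (K x * g x powr p) = 0"
      by (subst (asm) nn_integral_0_iff_AE) auto
    then have "AE x in M. ennreal (K x * g x) = 0"
    proof eventually_elim
      case (elim x)
      then have "K x * g x powr p = 0"
        using nn[of x] by (intro antisym mult_nonneg_nonneg) (auto simp: ennreal_eq_0_iff)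
      then show ?case by auto
    qed
    then have "(\<integral>\<^sup>+x. ennreal (K x * g x) \<partial>M) = 0"
      by (subst nn_integral_0_iff_AE) auto
    then have "a = 0" using a by simp
    then show ?thesis using p by simp
  next
    case False
    with S have Sp: "S > 0" by simp
    define l where "l = S powr (1 / p)"
    have l: "l > 0" using Sp by (simp add: l_def)
    have lp: "l powr p = S" using Sp p by (simp add: l_def powr_powr)
    have y: "t \<le> l + l powr (1 - p) * t powr p" if "0 \<le> t" for t
    proof (cases "t \<le> l")
      case False
      then have t: "t > l" by simp
      have "l powr (1 - p) * t powr p = (t / l) powr (p - 1) * t"
        using l t by (simp add: powr_divide powr_diff powr_add field_simps)
      also have "\<dots> \<ge> 1 * t"
        using l t p by (intro mult_right_mono ge_one_powr_ge_zero) auto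
      finally show ?thesis using l by simp
    qed (use l in \<open>auto intro: add_increasing2\<close>)
    have "ennreal a \<le> (\<integral>\<^sup>+x. ennreal (K x * g x) \<partial>M)" by (rule a)
    also have "\<dots> \<le> (\<integral>\<^sup>+x. ennreal l * ennreal (K x) + ennreal (l powr (1 - p)) * ennreal (K x * g x powr p) \<partial>M)"
    proof (intro nn_integral_mono)
      fix x
      have "K x * g x \<le> K x * (l + l powr (1 - p) * g x powr p)"
        by (intro mult_left_mono y nn)
      then show "ennreal (K x * g x) \<le> ennreal l * ennreal (K x) + ennreal (l powr (1 - p)) * ennreal (K x * g x powr p)"
        using l nn[of x] by (simp add: ennreal_mult[symmetric] ennreal_plus[symmetric] algebra_simps del: ennreal_plus)
    qed
    also have "\<dots> = ennreal l * (\<integral>\<^sup>+x. ennreal (K x) \<partial>M) + ennreal (l powr (1 - p)) * ennreal S"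
      by (simp add: nn_integral_add nn_integral_cmult S)
    also have "\<dots> \<le> ennreal l * ennreal c + ennreal (l powr (1 - p)) * ennreal S"
      by (intro add_mono mult_left_mono c) auto
    also have "\<dots> = ennreal (l * c + l powr (1 - p) * S)"
      using l c Sp by (simp add: ennreal_mult[symmetric] ennreal_plus[symmetric] del: ennreal_plus)
    also have "l powr (1 - p) * S = l"
      using l by (simp add: lp[symmetric] powr_add[symmetric])
    finally have "ennreal a \<le> ennreal (l * c + l)" .
    then have "a \<le> l * c + l"
      using l c by (subst (asm) ennreal_le_iff) auto
    then have "a \<le> (1 + c) * l"
      by (simp add: algebra_simps)
    then have "a powr p \<le> ((1 + c) * l) powr p"
      using a p by (intro powr_mono2) auto
    also have "\<dots> = (1 + c) powr p * S"
      using l c by (simp add: powr_mult lp)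
    finally show ?thesis
      unfolding S(2) using S(1) c by (simp add: ennreal_mult[symmetric] ennreal_leI)
  qed
qed

lemma norm_integral_le_nn_integral:
  fixes f :: "'a \<Rightarrow> 'b :: {banach, second_countable_topology}"
  shows "ennreal (norm (integral\<^sup>L M f)) \<le> (\<integral>\<^sup>+x. ennreal (norm (f x)) \<partial>M)"
  by (cases "integrable M f") (auto simp: integral_norm_bound_ennreal not_integrable_integral_eq)

text \<open>Hoelder's inequality for the measure with density |K|, with (1 + c)^p in place of
  c^(p-1); this form needs no distinction between p = 1 and p > 1.\<close>

lemma norm_integral_powr_le:
  fixes K g :: "'a \<Rightarrow> complex"
  assumes [measurable]: "K \<in> borel_measurable M" "g \<in> borel_measurable M"
    and p: "1 \<le> p"
    and c: "0 \<le> c" "(\<integral>\<^sup>+x. ennreal (cmod (K x)) \<partial>M) \<le> ennreal c"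
  shows "ennreal (cmod (LINT x|M. K x * g x) powr p) \<le>
      ennreal ((1 + c) powr p) * (\<integral>\<^sup>+x. ennreal (cmod (K x) * cmod (g x) powr p) \<partial>M)"
  by (rule nn_jensen)
     (use p c norm_integral_le_nn_integral[of M "\<lambda>x. K x * g x"] in \<open>auto simp: norm_mult\<close>)

section \<open>Differences and Jackson approximation\<close>

definition ldiff :: "nat \<Rightarrow> real \<times> real \<Rightarrow> (real \<times> real \<Rightarrow> complex) \<Rightarrow> real \<times> real \<Rightarrow> complex" where
  "ldiff l w F z = (\<Sum>j\<le>l. (-1) ^ (l - j) * of_nat (l choose j) * F (z + real j *\<^sub>R w))"

text \<open>The p-th power of the norm, without the root: averages can then be handled by Tonelli's
  theorem, and the triangle inequality is replaced by \<open>Npow_add\<close> with a factor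
  2^p.\<close>

definition Npow :: "real \<Rightarrow> (real \<times> real \<Rightarrow> complex) \<Rightarrow> ennreal" where
  "Npow p F = (\<integral>\<^sup>+z. ennreal (cmod (F z) powr p) \<partial>unif2)"

definition permeas :: "(real \<times> real \<Rightarrow> complex) \<Rightarrow> bool" where
  "permeas F \<longleftrightarrow> F \<in> borel_measurable borel \<and> per2 F"

lemma permeas_measurable [measurable_dest]: "permeas F \<Longrightarrow> F \<in> borel_measurable borel"
  and permeas_per2: "permeas F \<Longrightarrow> per2 F"
  by (simp_all add: permeas_def)

section \<open>Growth of differences under doubling of the step\<close>

lemma ldiff_0: "ldiff 0 w F = F"
  by (simp add: ldiff_def fun_eq_iff)

lemma ldiff_Suc: "ldiff (Suc l) w F z = ldiff l w F (z + w) - ldiff l w F z"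
proof -
  define a where "a = (\<lambda>j. F (z + real j *\<^sub>R w))"
  define g where "g = (\<lambda>j. (-1) ^ (Suc l + j) * of_nat (Suc l choose j) * a j)"
  have s: "(-1) ^ (n - j) = ((-1) ^ (n + j) :: complex)" if "j \<le> n" for n j
    using that by (simp add: minus_one_power_iff)
  have "ldiff (Suc l) w F z = (\<Sum>j\<le>Suc l. g j)"
    unfolding ldiff_def g_def a_def by (intro sum.cong refl) (simp only: s atMost_iff)
  also have "\<dots> = g 0 + (\<Sum>j\<le>l. g (Suc j))"
    by (rule sum.atMost_Suc_shift)
  also have "(\<Sum>j\<le>l. g (Suc j)) = (\<Sum>j\<le>l. (-1) ^ (l + j) * of_nat (l choose j) * a (Suc j)) +
     (\<Sum>j\<le>l. (-1) ^ (l + j) * of_nat (l choose Suc j) * a (Suc j))"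
    unfolding sum.distrib[symmetric] by (intro sum.cong refl) (simp add: g_def algebra_simps)
  also have "(\<Sum>j\<le>l. (-1) ^ (l + j) * of_nat (l choose j) * a (Suc j)) = ldiff l w F (z + w)"
    unfolding ldiff_def a_def by (intro sum.cong refl) (simp add: s algebra_simps)
  finally have 1: "ldiff (Suc l) w F z =
    g 0 + (ldiff l w F (z + w) + (\<Sum>j\<le>l. (-1) ^ (l + j) * of_nat (l choose Suc j) * a (Suc j)))" .
  have "ldiff l w F z = (\<Sum>j\<le>l. (-1) ^ (l + j) * of_nat (l choose j) * a j)"
    unfolding ldiff_def a_def by (intro sum.cong refl) (simp add: s)
  also have "\<dots> = (\<Sum>j\<le>Suc l. (-1) ^ (l + j) * of_nat (l choose j) * a j)"
    by simp
  also have "\<dots> = (-1) ^ l * a 0 - (\<Sum>j\<le>l. (-1) ^ (l + j) * of_nat (l choose Suc j) * a (Suc j))"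
    by (subst sum.atMost_Suc_shift) (simp add: sum_negf)
  finally have "ldiff l w F z = - g 0 - (\<Sum>j\<le>l. (-1) ^ (l + j) * of_nat (l choose Suc j) * a (Suc j))"
    by (simp add: g_def)
  with 1 show ?thesis by simp
qed

definition shift_sum :: "real \<times> real \<Rightarrow> (real \<times> real \<Rightarrow> complex) \<Rightarrow> real \<times> real \<Rightarrow> complex" where
  "shift_sum w F z = F (z + w) + F z"

text \<open>The factorisation \<open>x\<^sup>2 - 1 = (x + 1) (x - 1)\<close> of shift operators gives the doubling bound for differences.\<close>

lemma shift_sum_funpow_diff: "(shift_sum w ^^ n) (\<lambda>z. F (z + w') - F z) z = (shift_sum w ^^ n) F (z + w') - (shift_sum w ^^ n) F z"
  by (induction n arbitrary: z) (auto simp: shift_sum_def algebra_simps)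

lemma shift_sum_Suc: "(shift_sum w ^^ Suc n) F z = (shift_sum w ^^ n) F (z + w) + (shift_sum w ^^ n) F z"
  by (simp add: shift_sum_def)

lemma ldiff_double: "ldiff l (2 *\<^sub>R w) F = (shift_sum w ^^ l) (ldiff l w F)"
proof (induction l)
  case 0
  then show ?case by (simp add: ldiff_0)
next
  case (Suc l)
  show ?case
  proof
    fix z
    have d: "ldiff (Suc l) w F = (\<lambda>z. ldiff l w F (z + w) - ldiff l w F z)"
      by (simp add: ldiff_Suc fun_eq_iff)
    have t: "2 *\<^sub>R w = w + w" by (simp add: scaleR_2)
    show "ldiff (Suc l) (2 *\<^sub>R w) F z = (shift_sum w ^^ Suc l) (ldiff (Suc l) w F) z"
      unfolding d ldiff_Suc Suc shift_sum_funpow_diff by (simp add: shift_sum_Suc t add.assoc del: funpow.simps)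
  qed
qed

lemma permeas_shift:
  assumes "permeas F"
  shows "permeas (\<lambda>z. F (z + w))"
proof -
  have [measurable]: "F \<in> borel_measurable borel" using assms by (rule permeas_measurable)
  have p: "F (x + 1, y) = F (x, y)" "F (x, y + 1) = F (x, y)" for x y
    using permeas_per2[OF assms] by (simp_all add: per2_def)
  have "F (x + 1 + a, y) = F (x + a, y)" for x y a
    using p(1)[of "x + a" y] by (simp only: add.assoc add.commute[of 1])
  moreover have "F (x, y + 1 + b) = F (x, y + b)" for x y b
    using p(2)[of x "y + b"] by (simp only: add.assoc add.commute[of 1])
  ultimately have "per2 (\<lambda>z. F (z + w))"
    by (simp add: per2_def plus_prod_def)
  then show ?thesis by (simp add: permeas_def)
qed

lemma powr_add_le:
  fixes a b p :: real
  assumes "0 \<le> a" "0 \<le> b" "0 \<le> p"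
  shows "(a + b) powr p \<le> 2 powr p * (a powr p + b powr p)"
proof -
  have "(a + b) powr p \<le> (2 * max a b) powr p"
    using assms by (intro powr_mono2) auto
  also have "\<dots> = 2 powr p * max a b powr p"
    using assms by (simp add: powr_mult)
  also have "\<dots> \<le> 2 powr p * (a powr p + b powr p)"
    by (intro mult_left_mono) (auto simp: max_def)
  finally show ?thesis .
qed

lemma Npow_add:
  assumes [measurable]: "F \<in> borel_measurable borel" "G \<in> borel_measurable borel" and p: "0 \<le> p"
  shows "Npow p (\<lambda>z. F z + G z) \<le> ennreal (2 powr p) * (Npow p F + Npow p G)"
proof -
  have "Npow p (\<lambda>z. F z + G z) \<le>
      (\<integral>\<^sup>+z. ennreal (2 powr p) * (ennreal (cmod (F z) powr p) + ennreal (cmod (G z) powr p)) \<partial>unif2)"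
    unfolding Npow_def
  proof (rule nn_integral_mono)
    fix z
    have "cmod (F z + G z) powr p \<le> (cmod (F z) + cmod (G z)) powr p"
      by (intro powr_mono2 norm_triangle_ineq p) auto
    also have "\<dots> \<le> 2 powr p * (cmod (F z) powr p + cmod (G z) powr p)"
      by (intro powr_add_le p) auto
    finally show "ennreal (cmod (F z + G z) powr p) \<le>
        ennreal (2 powr p) * (ennreal (cmod (F z) powr p) + ennreal (cmod (G z) powr p))"
      by (simp add: ennreal_mult[symmetric] ennreal_plus[symmetric] ennreal_leI del: ennreal_plus)
  qed
  also have "\<dots> = ennreal (2 powr p) * (Npow p F + Npow p G)"
    unfolding Npow_def by (simp add: nn_integral_cmult nn_integral_add)
  finally show ?thesis .
qed

lemma Npow_scale:
  assumes [measurable]: "F \<in> borel_measurable borel"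
  shows "Npow p (\<lambda>z. c * F z) = ennreal (cmod c powr p) * Npow p F"
  unfolding Npow_def by (simp add: norm_mult powr_mult ennreal_mult nn_integral_cmult)

lemma permeas_lincomb:
  assumes "\<And>i. i \<in> I \<Longrightarrow> permeas (F i)"
  shows "permeas (\<lambda>z. \<Sum>i\<in>I. c i * F i z)"
proof -
  have [measurable]: "i \<in> I \<Longrightarrow> F i \<in> borel_measurable borel" for i using assms by (simp add: permeas_def)
  show ?thesis using assms by (auto simp: permeas_def per2_def)
qed

lemma permeas_add: "permeas F \<Longrightarrow> permeas G \<Longrightarrow> permeas (\<lambda>z. F z + G z)"
  by (auto simp: permeas_def per2_def)

lemma permeas_ldiff: "permeas F \<Longrightarrow> permeas (ldiff l w F)"
  unfolding ldiff_def[abs_def] by (intro permeas_lincomb permeas_shift)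

lemma permeas_shift_sum: "permeas F \<Longrightarrow> permeas (shift_sum w F)"
  unfolding shift_sum_def[abs_def] by (intro permeas_add permeas_shift)

lemma permeas_shift_sum_funpow: "permeas F \<Longrightarrow> permeas ((shift_sum w ^^ n) F)"
  by (induction n) (auto intro: permeas_shift_sum)

lemma Npow_shift:
  assumes "permeas F"
  shows "Npow p (\<lambda>z. F (z + w)) = Npow p F"
proof -
  have [measurable]: "F \<in> borel_measurable borel" using assms by (simp add: permeas_def)
  show ?thesis
    unfolding Npow_def using permeas_per2[OF assms]
    by (intro nn_integral_unif2_shift[where g = "\<lambda>z. ennreal (cmod (F z) powr p)"]) (auto simp: per2_def)
qed

lemma Npow_shift_sum:
  assumes F: "permeas F" and p: "0 \<le> p"
  shows "Npow p (shift_sum w F) \<le> ennreal (2 powr (p + 1)) * Npow p F"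
proof -
  have "Npow p (shift_sum w F) \<le> ennreal (2 powr p) * (Npow p (\<lambda>z. F (z + w)) + Npow p F)"
    unfolding shift_sum_def[abs_def] by (intro Npow_add p permeas_measurable permeas_shift F)
  also have "\<dots> = ennreal (2 powr p) * (2 * Npow p F)"
    by (simp add: Npow_shift[OF F] mult_2)
  also have "\<dots> = ennreal (2 powr (p + 1)) * Npow p F"
    by (simp add: powr_add ennreal_mult mult.assoc)
  finally show ?thesis .
qed

lemma Npow_shift_sum_funpow:
  assumes F: "permeas F" and p: "0 \<le> p"
  shows "Npow p ((shift_sum w ^^ n) F) \<le> ennreal ((2 powr (p + 1)) ^ n) * Npow p F"
proof (induction n)
  case (Suc n)
  have "Npow p ((shift_sum w ^^ Suc n) F) \<le> ennreal (2 powr (p + 1)) * Npow p ((shift_sum w ^^ n) F)"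
    using Npow_shift_sum[OF permeas_shift_sum_funpow[OF F] p] by simp
  also have "\<dots> \<le> ennreal (2 powr (p + 1)) * (ennreal ((2 powr (p + 1)) ^ n) * Npow p F)"
    by (intro mult_left_mono Suc) auto
  finally show ?case by (simp add: ennreal_mult mult.assoc)
qed simp

text \<open>The loss in the p-th power when the step of an l-th difference is doubled: each of the l
  factors \<open>shift_sum\<close> costs 2^p * 2. A sharper constant would only lower the decay
  exponent demanded of the kernels.\<close>

definition kappa :: "real \<Rightarrow> nat \<Rightarrow> real" where
  "kappa p l = (2 powr (p + 1)) ^ l"

lemma kappa_ge_1: "0 \<le> p \<Longrightarrow> 1 \<le> kappa p l"
  unfolding kappa_def by (intro one_le_power ge_one_powr_ge_zero) auto

lemma Npow_ldiff_pow2: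
  assumes F: "permeas F" and p: "0 \<le> p"
  shows "Npow p (ldiff l (2 ^ j *\<^sub>R w) F) \<le> ennreal (kappa p l ^ j) * Npow p (ldiff l w F)"
proof (induction j)
  case (Suc j)
  have "Npow p (ldiff l (2 ^ Suc j *\<^sub>R w) F) = Npow p ((shift_sum (2 ^ j *\<^sub>R w) ^^ l) (ldiff l (2 ^ j *\<^sub>R w) F))"
    by (simp add: ldiff_double[symmetric])
  also have "\<dots> \<le> ennreal (kappa p l) * Npow p (ldiff l (2 ^ j *\<^sub>R w) F)"
    unfolding kappa_def by (intro Npow_shift_sum_funpow permeas_ldiff F p)
  also have "\<dots> \<le> ennreal (kappa p l) * (ennreal (kappa p l ^ j) * Npow p (ldiff l w F))"
    by (intro mult_left_mono Suc) auto
  finally show ?case using kappa_ge_1[OF p, of l] by (simp add: ennreal_mult mult.assoc)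
qed simp

lemma ldiff_commute: "ldiff l w (ldiff l w' F) = ldiff l w' (ldiff l w F)"
proof
  fix z
  have "ldiff l w (ldiff l w' F) z = (\<Sum>i\<le>l. \<Sum>j\<le>l. ((-1) ^ (l - i) * of_nat (l choose i)) *
     (((-1) ^ (l - j) * of_nat (l choose j)) * F (z + real i *\<^sub>R w + real j *\<^sub>R w')))"
    by (simp add: ldiff_def sum_distrib_left)
  also have "\<dots> = (\<Sum>j\<le>l. \<Sum>i\<le>l. ((-1) ^ (l - i) * of_nat (l choose i)) *
     (((-1) ^ (l - j) * of_nat (l choose j)) * F (z + real i *\<^sub>R w + real j *\<^sub>R w')))"
    by (rule sum.swap)
  also have "\<dots> = ldiff l w' (ldiff l w F) z"
    by (simp add: ldiff_def sum_distrib_left ac_simps)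
  finally show "ldiff l w (ldiff l w' F) z = ldiff l w' (ldiff l w F) z" .
qed

lemma Npow_dv1_scale:
  assumes F: "permeas F" and p: "0 \<le> p"
    and H: "\<And>h. \<bar>h\<bar> < s \<Longrightarrow> Npow p (ldiff l (h, 0) F) \<le> W"
    and u: "\<bar>u\<bar> < 2 ^ i * s"
  shows "Npow p (ldiff l (u, 0) F) \<le> ennreal (kappa p l ^ i) * W"
proof -
  have "Npow p (ldiff l (u, 0) F) = Npow p (ldiff l (2 ^ i *\<^sub>R (u / 2 ^ i, 0)) F)"
    by simp
  also have "\<dots> \<le> ennreal (kappa p l ^ i) * Npow p (ldiff l (u / 2 ^ i, 0) F)"
    by (rule Npow_ldiff_pow2[OF F p])
  also have "\<dots> \<le> ennreal (kappa p l ^ i) * W"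
    using u by (intro mult_left_mono H) (auto simp: field_simps)
  finally show ?thesis .
qed

lemma Npow_dv2_scale:
  assumes F: "permeas F" and p: "0 \<le> p"
    and H: "\<And>h. \<bar>h\<bar> < s \<Longrightarrow> Npow p (ldiff l (0, h) F) \<le> W"
    and u: "\<bar>u\<bar> < 2 ^ i * s"
  shows "Npow p (ldiff l (0, u) F) \<le> ennreal (kappa p l ^ i) * W"
proof -
  have "Npow p (ldiff l (0, u) F) = Npow p (ldiff l (2 ^ i *\<^sub>R (0, u / 2 ^ i)) F)"
    by simp
  also have "\<dots> \<le> ennreal (kappa p l ^ i) * Npow p (ldiff l (0, u / 2 ^ i) F)"
    by (rule Npow_ldiff_pow2[OF F p])
  also have "\<dots> \<le> ennreal (kappa p l ^ i) * W"
    using u by (intro mult_left_mono H) (auto simp: field_simps)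
  finally show ?thesis .
qed

lemma Npow_dv12_scale:
  assumes F: "permeas F" and p: "0 \<le> p"
    and H: "\<And>h k. \<bar>h\<bar> < s \<Longrightarrow> \<bar>k\<bar> < t \<Longrightarrow> Npow p (ldiff l (h, 0) (ldiff l (0, k) F)) \<le> W"
    and u: "\<bar>u\<bar> < 2 ^ i * s" "\<bar>v\<bar> < 2 ^ j * t"
  shows "Npow p (ldiff l (u, 0) (ldiff l (0, v) F)) \<le> ennreal (kappa p l ^ i) * (ennreal (kappa p l ^ j) * W)"
proof (rule Npow_dv1_scale[OF _ p _ u(1)])
  show "permeas (ldiff l (0, v) F)" by (rule permeas_ldiff[OF F])
  show "Npow p (ldiff l (h, 0) (ldiff l (0, v) F)) \<le> ennreal (kappa p l ^ j) * W" if h: "\<bar>h\<bar> < s" for h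
    unfolding ldiff_commute[of l "(h, 0)"]
  proof (rule Npow_dv2_scale[OF _ p _ u(2)])
    show "permeas (ldiff l (h, 0) F)" by (rule permeas_ldiff[OF F])
    show "Npow p (ldiff l (0, k) (ldiff l (h, 0) F)) \<le> W" if "\<bar>k\<bar> < t" for k
      using H[OF h that] by (simp add: ldiff_commute[of l "(h, 0)"])
  qed
qed

text \<open>The least number of halvings that bring u below 1/(2N). Minimality bounds 4^i by the
  kernel weight, so a loss of at most (4^q)^i is at most 16^q times the q-th power of the
  weight.\<close>

lemma dyadic_index:
  assumes "N \<ge> 1"
  obtains i :: nat where "\<bar>u\<bar> < 2 ^ i * (1 / (2 * real N))" "4 ^ i \<le> 16 * (1 + (real N * u)\<^sup>2)"
proof -
  define P where "P = (\<lambda>i. 2 * real N * \<bar>u\<bar> < 2 ^ i)"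
  obtain i0 where "P i0" using real_arch_pow[of 2 "2 * real N * \<bar>u\<bar>"] by (auto simp: P_def)
  define i where "i = (LEAST i. P i)"
  have i: "P i" unfolding i_def by (rule LeastI) fact
  have "4 ^ i \<le> 16 * (1 + (real N * u)\<^sup>2)"
  proof (cases i)
    case (Suc k)
    then have "\<not> P k" using not_less_Least[of k P] by (simp add: i_def)
    then have "2 ^ k \<le> 2 * real N * \<bar>u\<bar>" by (simp add: P_def)
    then have "(2 ^ k)\<^sup>2 \<le> (2 * real N * \<bar>u\<bar>)\<^sup>2" by (intro power_mono) auto
    moreover have "(4::real) ^ i = 4 * (2 ^ k)\<^sup>2"
      by (simp add: Suc power_mult[symmetric] mult.commute[of k]) (simp add: power_mult)
    ultimately show ?thesis by (simp add: power_mult_distrib)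
  qed simp
  moreover have "\<bar>u\<bar> < 2 ^ i * (1 / (2 * real N))"
    using i assms by (simp add: P_def field_simps)
  ultimately show ?thesis using that by blast
qed

section \<open>Averages of differences against decaying kernels\<close>

lemma decays_nonneg: "decays r C N A \<Longrightarrow> N \<ge> 1 \<Longrightarrow> C \<ge> 0"
proof -
  assume "decays r C N A" "N \<ge> 1"
  then have "cmod (A 0) \<le> C * real N" by (auto simp: decays_def dest!: spec[of _ 0])
  then have "0 \<le> C * real N" using norm_ge_zero order_trans by blast
  then show "C \<ge> 0" using \<open>N \<ge> 1\<close> by (simp add: zero_le_mult_iff)
qed

text \<open>Of the q + 1 powers of decay, q pay for the growing factor x and the last one leaves the
  integrable kernel \<open>wker\<close>.\<close>

lemma decays_le_wker:
  assumes k: "decays (Suc q) C N A" and N: "N \<ge> 1" and u: "\<bar>u\<bar> \<le> 1/2"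
    and x: "x \<le> 16 ^ q * (1 + (real N * u)\<^sup>2) ^ q"
  shows "cmod (A u) * x \<le> 16 ^ q * C * wker N u"
proof -
  let ?w = "1 + (real N * u)\<^sup>2"
  have "cmod (A u) * x * ?w \<le> cmod (A u) * (16 ^ q * ?w ^ q) * ?w"
    by (intro mult_right_mono mult_left_mono x) auto
  also have "\<dots> = 16 ^ q * (cmod (A u) * ?w ^ Suc q)" by simp
  also have "\<dots> \<le> 16 ^ q * (C * real N)"
    using k u by (intro mult_left_mono) (auto simp: decays_def)
  finally show ?thesis
    using wker_pos[of N u] by (simp add: wker_def pos_le_divide_eq mult.assoc)
qed

lemma nn_integral_wker2:
  assumes "N1 \<ge> 1" "N2 \<ge> 1"
  shows "(\<integral>\<^sup>+u. ennreal (wker N1 (fst u) * wker N2 (snd u)) \<partial>unif2) \<le> 1600"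
proof -
  have "(\<integral>\<^sup>+u. ennreal (wker N1 (fst u) * wker N2 (snd u)) \<partial>unif2) =
     (\<integral>\<^sup>+x. \<integral>\<^sup>+y. ennreal (wker N1 x) * ennreal (wker N2 y) \<partial>unif \<partial>unif)"
    by (subst unif.nn_integral_fst[symmetric]) (auto simp: ennreal_mult)
  also have "\<dots> = (\<integral>\<^sup>+x. ennreal (wker N1 x) \<partial>unif) * (\<integral>\<^sup>+y. ennreal (wker N2 y) \<partial>unif)"
    by (simp add: nn_integral_cmult nn_integral_multc)
  also have "\<dots> \<le> 40 * 40"
    by (intro mult_mono nn_integral_wker assms) auto
  finally show ?thesis by simp
qed

interpretation unif4: pair_sigma_finite unif2 unif2 ..

text \<open>A substitute for Minkowski's integral inequality on the level of p-th powers: Jensen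
  inside, then an exchange of the two integrations.\<close>

lemma Npow_average:
  fixes Op :: "real \<times> real \<Rightarrow> real \<times> real \<Rightarrow> complex" and K :: "real \<times> real \<Rightarrow> complex"
  assumes M [measurable]: "(\<lambda>(z, u). Op u z) \<in> borel_measurable (unif2 \<Otimes>\<^sub>M unif2)"
    and [measurable]: "K \<in> borel_measurable borel" and p: "1 \<le> p"
    and c: "0 \<le> c" "(\<integral>\<^sup>+u. ennreal (cmod (K u)) \<partial>unif2) \<le> ennreal c"
  shows "Npow p (\<lambda>z. LINT u|unif2. K u * Op u z) \<le>
    ennreal ((1 + c) powr p) * (\<integral>\<^sup>+u. ennreal (cmod (K u)) * Npow p (Op u) \<partial>unif2)"
proof -
  have [measurable]: "(\<lambda>u. Op u z) \<in> borel_measurable unif2" for z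
    using measurable_compose[OF measurable_Pair1'[of z unif2 unif2] M] by simp
  have [measurable]: "Op u \<in> borel_measurable unif2" for u
    using measurable_compose[OF measurable_Pair2'[of u unif2 unif2] M] by simp
  have M' [measurable]: "(\<lambda>x. Op (snd x) (fst x)) \<in> borel_measurable (unif2 \<Otimes>\<^sub>M unif2)"
    using M by (simp add: case_prod_beta')
  have m: "(\<lambda>(z, u). ennreal (cmod (K u) * cmod (Op u z) powr p)) \<in> borel_measurable (unif2 \<Otimes>\<^sub>M unif2)"
    unfolding case_prod_beta' by measurable
  have "Npow p (\<lambda>z. LINT u|unif2. K u * Op u z) \<le>
    (\<integral>\<^sup>+z. ennreal ((1 + c) powr p) * (\<integral>\<^sup>+u. ennreal (cmod (K u) * cmod (Op u z) powr p) \<partial>unif2) \<partial>unif2)"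
    unfolding Npow_def by (intro nn_integral_mono norm_integral_powr_le p c) auto
  also have "\<dots> = ennreal ((1 + c) powr p) * (\<integral>\<^sup>+z. \<integral>\<^sup>+u. ennreal (cmod (K u) * cmod (Op u z) powr p) \<partial>unif2 \<partial>unif2)"
    by (rule nn_integral_cmult) (use m in measurable)
  also have "(\<integral>\<^sup>+z. \<integral>\<^sup>+u. ennreal (cmod (K u) * cmod (Op u z) powr p) \<partial>unif2 \<partial>unif2) =
      (\<integral>\<^sup>+u. \<integral>\<^sup>+z. ennreal (cmod (K u) * cmod (Op u z) powr p) \<partial>unif2 \<partial>unif2)"
    by (rule unif4.Fubini'[symmetric]) (rule m)
  also have "\<dots> = (\<integral>\<^sup>+u. ennreal (cmod (K u)) * Npow p (Op u) \<partial>unif2)"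
    unfolding Npow_def by (intro nn_integral_cong) (simp add: ennreal_mult nn_integral_cmult)
  finally show ?thesis .
qed

text \<open>The first factor comes from Jensen's inequality and the kernel mass, the second from the
  mass weighted with the doubling losses. The 16 stems from \<open>dyadic_index\<close>, and 1600 =
  40^2 from the masses of two kernels \<open>wker\<close>.\<close>

definition cJ :: "real \<Rightarrow> nat \<Rightarrow> real \<Rightarrow> real" where
  "cJ p q C = (1 + (16 ^ q * C)\<^sup>2 * 1600) powr p * ((16 ^ q * C)\<^sup>2 * 1600)"

text \<open>The hypothesis on \<open>Op\<close> allows exponential growth in the numbers of
  doublings i and j. These are chosen from the distance of u to the origin, and the decay of the two
  kernels absorbs the growth in each variable separately.\<close>

lemma Npow_kernel_average:
  assumes M: "(\<lambda>(z, u). Op u z) \<in> borel_measurable (unif2 \<Otimes>\<^sub>M unif2)"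
    and [measurable]: "A \<in> borel_measurable borel" "B \<in> borel_measurable borel" and p: "1 \<le> p"
    and q: "kappa p l \<le> 4 ^ q" and N: "N1 \<ge> 1" "N2 \<ge> 1"
    and A: "decays (Suc q) C N1 A" and B: "decays (Suc q) C N2 B"
    and W: "0 \<le> W" and H: "\<And>u i j. \<bar>fst u\<bar> < 2 ^ i * (1 / (2 * real N1)) \<Longrightarrow> \<bar>snd u\<bar> < 2 ^ j * (1 / (2 * real N2)) \<Longrightarrow>
       Npow p (Op u) \<le> ennreal (kappa p l ^ i) * (ennreal (kappa p l ^ j) * ennreal W)"
  shows "Npow p (\<lambda>z. LINT u|unif2. A (fst u) * B (snd u) * Op u z) \<le> ennreal (cJ p q C * W)"
proof -
  have C: "C \<ge> 0" by (rule decays_nonneg[OF A N(1)])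
  define D where "D = (16 ^ q * C)\<^sup>2"
  have D: "D \<ge> 0" by (simp add: D_def)
  have pt: "ennreal (cmod (A (fst u) * B (snd u))) * Npow p (Op u) \<le>
      ennreal (D * W) * ennreal (wker N1 (fst u) * wker N2 (snd u))"
    and pt1: "cmod (A (fst u) * B (snd u)) \<le> D * (wker N1 (fst u) * wker N2 (snd u))"
    if u: "\<bar>fst u\<bar> \<le> 1/2 \<and> \<bar>snd u\<bar> \<le> 1/2" for u
  proof -
    have kq: "kappa p l ^ i \<le> 16 ^ q * w ^ q" if "4 ^ i \<le> 16 * w" for i w
    proof -
      have "kappa p l ^ i \<le> (4 ^ q) ^ i"
        using q kappa_ge_1[of p l] p by (intro power_mono) auto
      also have "\<dots> = (4 ^ i) ^ q" by (simp add: power_mult[symmetric] mult.commute)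
      also have "\<dots> \<le> (16 * w) ^ q" using that by (intro power_mono) auto
      finally show ?thesis by (simp add: power_mult_distrib)
    qed
    obtain i where i: "\<bar>fst u\<bar> < 2 ^ i * (1 / (2 * real N1))" "4 ^ i \<le> 16 * (1 + (real N1 * fst u)\<^sup>2)"
      by (rule dyadic_index[OF N(1)])
    obtain j where j: "\<bar>snd u\<bar> < 2 ^ j * (1 / (2 * real N2))" "4 ^ j \<le> 16 * (1 + (real N2 * snd u)\<^sup>2)"
      by (rule dyadic_index[OF N(2)])
    have a: "cmod (A (fst u)) * kappa p l ^ i \<le> 16 ^ q * C * wker N1 (fst u)"
      using u by (intro decays_le_wker[OF A N(1)] kq i) auto
    have b: "cmod (B (snd u)) * kappa p l ^ j \<le> 16 ^ q * C * wker N2 (snd u)"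
      using u by (intro decays_le_wker[OF B N(2)] kq j) auto
    have ab: "(cmod (A (fst u)) * kappa p l ^ i) * (cmod (B (snd u)) * kappa p l ^ j) \<le> D * (wker N1 (fst u) * wker N2 (snd u))"
    proof -
      have "(cmod (A (fst u)) * kappa p l ^ i) * (cmod (B (snd u)) * kappa p l ^ j) \<le>
         (16 ^ q * C * wker N1 (fst u)) * (16 ^ q * C * wker N2 (snd u))"
        using C kappa_ge_1[of p l] p by (intro mult_mono[OF a b] mult_nonneg_nonneg) auto
      then show ?thesis by (simp add: D_def power2_eq_square ac_simps)
    qed
    have k1: "1 \<le> kappa p l ^ i" "1 \<le> kappa p l ^ j"
      using kappa_ge_1[of p l] p by (auto intro: one_le_power)
    have "cmod (A (fst u)) * 1 * (cmod (B (snd u)) * 1) \<le> (cmod (A (fst u)) * kappa p l ^ i) * (cmod (B (snd u)) * kappa p l ^ j)"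
      using k1 by (intro mult_mono mult_left_mono) auto
    with ab show "cmod (A (fst u) * B (snd u)) \<le> D * (wker N1 (fst u) * wker N2 (snd u))"
      by (simp add: norm_mult)
    have "ennreal (cmod (A (fst u) * B (snd u))) * Npow p (Op u) \<le>
       ennreal (cmod (A (fst u) * B (snd u))) * (ennreal (kappa p l ^ i) * (ennreal (kappa p l ^ j) * ennreal W))"
      by (intro mult_left_mono H i j) auto
    also have "\<dots> = ennreal ((cmod (A (fst u)) * kappa p l ^ i) * (cmod (B (snd u)) * kappa p l ^ j) * W)"
      using k1 W by (simp add: ennreal_mult[symmetric] norm_mult ac_simps)
    also have "\<dots> \<le> ennreal (D * (wker N1 (fst u) * wker N2 (snd u)) * W)"
      by (intro ennreal_leI mult_right_mono ab W)
    also have "\<dots> = ennreal (D * W) * ennreal (wker N1 (fst u) * wker N2 (snd u))"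
      using D W by (simp add: ennreal_mult[symmetric] ac_simps)
    finally show "ennreal (cmod (A (fst u) * B (snd u))) * Npow p (Op u) \<le>
      ennreal (D * W) * ennreal (wker N1 (fst u) * wker N2 (snd u))" .
  qed
  have 1: "(\<integral>\<^sup>+u. ennreal (cmod (A (fst u) * B (snd u))) \<partial>unif2) \<le> ennreal (D * 1600)"
  proof -
    have "(\<integral>\<^sup>+u. ennreal (cmod (A (fst u) * B (snd u))) \<partial>unif2) \<le>
        (\<integral>\<^sup>+u. ennreal D * ennreal (wker N1 (fst u) * wker N2 (snd u)) \<partial>unif2)"
      by (intro nn_integral_mono_AE eventually_mono[OF AE_unif2])
        (unfold ennreal_mult'[OF D, symmetric], intro ennreal_leI pt1)
    also have "\<dots> \<le> ennreal D * 1600"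
      by (subst nn_integral_cmult) (auto intro!: mult_left_mono nn_integral_wker2 N)
    finally show ?thesis using D by (simp add: ennreal_mult)
  qed
  have 2: "(\<integral>\<^sup>+u. ennreal (cmod (A (fst u) * B (snd u))) * Npow p (Op u) \<partial>unif2) \<le> ennreal (D * W * 1600)"
  proof -
    have "(\<integral>\<^sup>+u. ennreal (cmod (A (fst u) * B (snd u))) * Npow p (Op u) \<partial>unif2) \<le>
        (\<integral>\<^sup>+u. ennreal (D * W) * ennreal (wker N1 (fst u) * wker N2 (snd u)) \<partial>unif2)"
      by (intro nn_integral_mono_AE eventually_mono[OF AE_unif2] pt)
    also have "\<dots> \<le> ennreal (D * W) * 1600"
      by (subst nn_integral_cmult) (auto intro!: mult_left_mono nn_integral_wker2 N)
    finally show ?thesis using D W by (simp add: ennreal_mult)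
  qed
  have "Npow p (\<lambda>z. LINT u|unif2. A (fst u) * B (snd u) * Op u z) \<le>
    ennreal ((1 + D * 1600) powr p) * (\<integral>\<^sup>+u. ennreal (cmod (A (fst u) * B (snd u))) * Npow p (Op u) \<partial>unif2)"
    by (rule Npow_average[OF M _ p _ 1]) (use D in auto)
  also have "\<dots> \<le> ennreal ((1 + D * 1600) powr p) * ennreal (D * W * 1600)"
    by (intro mult_left_mono 2) auto
  also have "\<dots> = ennreal (cJ p q C * W)"
    using D W by (simp add: cJ_def D_def ennreal_mult[symmetric] ac_simps)
  finally show ?thesis .
qed

section \<open>Block operators and their approximation error\<close>

definition dcoef :: "nat \<Rightarrow> nat \<Rightarrow> complex" where
  "dcoef l j = (-1) ^ (l - j) * of_nat (l choose j)"

definition dilate :: "nat \<Rightarrow> nat \<Rightarrow> real \<times> real \<Rightarrow> real \<times> real" where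
  "dilate i j u = (real i * fst u, real j * snd u)"

lemma measurable_dilate [measurable]: "dilate i j \<in> borel_measurable borel"
  unfolding dilate_def[abs_def] by measurable

text \<open>
  Since \<open>dcoef l 0 = (-1)^l\<close>, the one-dimensional operator
  \<open>T = (-1)^(l+1) * (\<Sum>i=1..l. dcoef l i * \<integral> A(u) f(x + i u) du)\<close> is \<open>m f\<close> minus an average of
  \<open>l\<close>-th differences, \<open>m\<close> being the mean of \<open>A\<close>; the block is the tensor product of two such
  operators, in which the two signs cancel. Omitting the index 0 makes it a trigonometric
  polynomial for every integrable \<open>F\<close>.
\<close>

definition block ::
  "nat \<Rightarrow> (real \<Rightarrow> complex) \<Rightarrow> (real \<Rightarrow> complex) \<Rightarrow> (real \<times> real \<Rightarrow> complex) \<Rightarrow> real \<times> real \<Rightarrow> complex" where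
  "block l A B F z = (\<Sum>i=1..l. \<Sum>j=1..l. dcoef l i * dcoef l j *
      (LINT u|unif2. A (fst u) * B (snd u) * F (z + dilate i j u)))"

lemma ldiff_dcoef: "ldiff l w F z = (\<Sum>j\<le>l. dcoef l j * F (z + real j *\<^sub>R w))"
  by (simp add: ldiff_def dcoef_def)

lemma measurable_dv12:
  assumes [measurable]: "F \<in> borel_measurable borel"
  shows "(\<lambda>(z, u). ldiff l (fst u, 0) (ldiff l (0, snd u) F) z) \<in> borel_measurable (unif2 \<Otimes>\<^sub>M unif2)"
    "(\<lambda>(z, u). ldiff l (fst u, 0) F z) \<in> borel_measurable (unif2 \<Otimes>\<^sub>M unif2)"
    "(\<lambda>(z, u). ldiff l (0, snd u) F z) \<in> borel_measurable (unif2 \<Otimes>\<^sub>M unif2)"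
  unfolding ldiff_def case_prod_beta' by measurable

text \<open>If z is integrated first, every u contributes the full norm of F by translation
  invariance, whatever i and j are. Hence the double integral is finite and the inner one is finite
  for almost every z, even for the index 0, where no change of variables in u is possible.\<close>

lemma AE_integrable_dilate:
  assumes F: "permeas F" and fin: "(\<integral>\<^sup>+z. ennreal (cmod (F z)) \<partial>unif2) < \<infinity>"
  shows "AE z in unif2. \<forall>i j. integrable unif2 (\<lambda>u. F (z + dilate i j u))"
proof -
  have [measurable]: "F \<in> borel_measurable borel" by (rule permeas_measurable[OF F])
  have "AE z in unif2. integrable unif2 (\<lambda>u. F (z + dilate i j u))" for i j
  proof -
    let ?I = "\<lambda>z. \<integral>\<^sup>+u. ennreal (cmod (F (z + dilate i j u))) \<partial>unif2"
    have "(\<integral>\<^sup>+z. ?I z \<partial>unif2) = (\<integral>\<^sup>+u. \<integral>\<^sup>+z. ennreal (cmod (F (z + dilate i j u))) \<partial>unif2 \<partial>unif2)"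
      by (rule unif4.Fubini'[symmetric]) (unfold case_prod_beta', measurable)
    also have "\<dots> = (\<integral>\<^sup>+u. \<integral>\<^sup>+z. ennreal (cmod (F z)) \<partial>unif2 \<partial>unif2)"
      using permeas_per2[OF F]
      by (intro nn_integral_cong nn_integral_unif2_shift[where g = "\<lambda>z. ennreal (cmod (F z))"]) (auto simp: per2_def)
    also have "\<dots> = (\<integral>\<^sup>+z. ennreal (cmod (F z)) \<partial>unif2)"
      using unif2.emeasure_space_1 by (simp add: space_pair_measure)
    finally have "(\<integral>\<^sup>+z. ?I z \<partial>unif2) \<noteq> \<infinity>" using fin by simp
    then have "AE z in unif2. ?I z \<noteq> \<infinity>"
      by (intro nn_integral_PInf_AE) measurable
    then show ?thesis
      by eventually_elim (auto intro!: integrableI_bounded simp: top.not_eq_extremum)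
  qed
  then show ?thesis by (simp add: AE_all_countable)
qed

lemma integrable_kernel_mult:
  assumes A: "trig d A" and B: "trig d' B" and G: "integrable unif2 G"
  shows "integrable unif2 (\<lambda>u. A (fst u) * B (snd u) * G u)"
proof -
  obtain a where a: "\<And>u. cmod (A u) \<le> a" using trig_bounded[OF A] by blast
  obtain b where b: "\<And>u. cmod (B u) \<le> b" using trig_bounded[OF B] by blast
  have [measurable]: "A \<in> borel_measurable borel" "B \<in> borel_measurable borel"
    using trig_measurable A B by auto
  have [measurable]: "G \<in> borel_measurable unif2" using G by auto
  have a0: "0 \<le> a" using a[of 0] norm_ge_zero order_trans by blast
  show ?thesis
  proof (rule Bochner_Integration.integrable_bound[OF integrable_mult_right[OF G, of "of_real (a * b)"]])
    show "AE u in unif2. norm (A (fst u) * B (snd u) * G u) \<le> norm (complex_of_real (a * b) * G u)"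
    proof (rule AE_I2)
      fix u
      have "cmod (A (fst u)) * cmod (B (snd u)) * cmod (G u) \<le> (a * b) * cmod (G u)"
        by (intro mult_right_mono mult_mono a b a0) auto
      also have "\<dots> \<le> \<bar>a * b\<bar> * cmod (G u)"
        by (intro mult_right_mono) auto
      finally show "norm (A (fst u) * B (snd u) * G u) \<le> norm (complex_of_real (a * b) * G u)"
        by (simp add: norm_mult abs_mult)
    qed
  qed measurable
qed

lemma integral_unif2_product:
  fixes a b :: "real \<Rightarrow> complex"
  assumes "integrable unif2 (\<lambda>u. a (fst u) * b (snd u))"
  shows "(LINT u|unif2. a (fst u) * b (snd u)) = (LINT x|unif. a x) * (LINT y|unif. b y)"
  using unif2.integral_fst'[OF assms] by simp

text \<open>Inclusion and exclusion of the index 0, which relates the block to full l-th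
  differences.\<close>

lemma sum_atMost_split:
  fixes f :: "nat \<Rightarrow> nat \<Rightarrow> complex"
  shows "(\<Sum>i=1..l. \<Sum>j=1..l. f i j) =
    (\<Sum>i\<le>l. \<Sum>j\<le>l. f i j) - (\<Sum>i\<le>l. f i 0) - (\<Sum>j\<le>l. f 0 j) + f 0 0"
proof -
  have s: "(\<Sum>j\<le>l. g j) = g 0 + (\<Sum>j=1..l. g j)" for g :: "nat \<Rightarrow> complex"
    by (simp add: atMost_atLeast0 sum.atLeast_Suc_atMost)
  show ?thesis by (simp add: s sum.distrib)
qed

lemma dcoef_0: "dcoef l 0 * dcoef l 0 = 1" "cmod (dcoef l 0) = 1"
  by (auto simp: dcoef_def norm_power power_add[symmetric] mult_2[symmetric])

text \<open>The index 0 terms put slices of \<open>F\<close> into the integrals, so integrability holds only for almost every \<open>z\<close>.\<close>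

lemma block_identity:
  fixes l :: nat
  assumes A: "trig dA A" and B: "trig dB B"
    and int: "\<And>i j. integrable unif2 (\<lambda>u. F (z + dilate i j u))"
  defines "mA \<equiv> (LINT u|unif. A u)" and "mB \<equiv> (LINT u|unif. B u)"
  defines "P1 \<equiv> (LINT u|unif2. A (fst u) * B (snd u) * ldiff l (fst u, 0) F z)"
    and "P2 \<equiv> (LINT u|unif2. A (fst u) * B (snd u) * ldiff l (0, snd u) F z)"
    and "P12 \<equiv> (LINT u|unif2. A (fst u) * B (snd u) * ldiff l (fst u, 0) (ldiff l (0, snd u) F) z)"
  shows "block l A B F z = P12 - dcoef l 0 * P1 - dcoef l 0 * P2 + mA * mB * F z"
    and "mB = 0 \<Longrightarrow> P1 = 0" and "mA = 0 \<Longrightarrow> P2 = 0"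
proof -
  define X where "X = (\<lambda>i j u. A (fst u) * B (snd u) * F (z + dilate i j u))"
  define I where "I = (\<lambda>i j. LINT u|unif2. X i j u)"
  have iX [simp]: "integrable unif2 (X i j)" for i j
    unfolding X_def by (rule integrable_kernel_mult[OF A B int])
  have e1: "A (fst u) * B (snd u) * ldiff l (fst u, 0) F z = (\<Sum>i\<le>l. dcoef l i * X i 0 u)" for u
    by (simp add: ldiff_dcoef X_def dilate_def sum_distrib_left ac_simps)
  have e2: "A (fst u) * B (snd u) * ldiff l (0, snd u) F z = (\<Sum>j\<le>l. dcoef l j * X 0 j u)" for u
    by (simp add: ldiff_dcoef X_def dilate_def sum_distrib_left ac_simps)
  have e12: "A (fst u) * B (snd u) * ldiff l (fst u, 0) (ldiff l (0, snd u) F) z =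
      (\<Sum>i\<le>l. \<Sum>j\<le>l. dcoef l i * dcoef l j * X i j u)" for u
    by (simp add: ldiff_dcoef X_def dilate_def sum_distrib_left ac_simps)
  have i1: "integrable unif2 (\<lambda>u. A (fst u) * B (snd u) * ldiff l (fst u, 0) F z)"
    unfolding e1 by (intro Bochner_Integration.integrable_sum integrable_mult_right iX)
  have i2: "integrable unif2 (\<lambda>u. A (fst u) * B (snd u) * ldiff l (0, snd u) F z)"
    unfolding e2 by (intro Bochner_Integration.integrable_sum integrable_mult_right iX)
  have p1: "P1 = (\<Sum>i\<le>l. dcoef l i * I i 0)"
    unfolding P1_def e1 I_def by simp
  have p2: "P2 = (\<Sum>j\<le>l. dcoef l j * I 0 j)"
    unfolding P2_def e2 I_def by simp
  have p12: "P12 = (\<Sum>i\<le>l. \<Sum>j\<le>l. dcoef l i * dcoef l j * I i j)"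
    unfolding P12_def e12 I_def by simp
  have "I 0 0 = (LINT u|unif2. A (fst u) * B (snd u)) * F z"
    by (simp add: I_def X_def dilate_def zero_prod_def[symmetric])
  also have "(LINT u|unif2. A (fst u) * B (snd u)) = mA * mB"
    unfolding mA_def mB_def using integrable_kernel_mult[OF A B, of "\<lambda>_. 1"]
    by (intro integral_unif2_product) auto
  finally have I00: "I 0 0 = mA * mB * F z" .
  have "block l A B F z = (\<Sum>i=1..l. \<Sum>j=1..l. dcoef l i * dcoef l j * I i j)"
    by (simp add: block_def I_def X_def)
  also have "\<dots> = P12 - dcoef l 0 * P1 - dcoef l 0 * P2 + dcoef l 0 * dcoef l 0 * I 0 0"
    unfolding sum_atMost_split p1 p2 p12 by (simp add: sum_distrib_left ac_simps)
  finally show "block l A B F z = P12 - dcoef l 0 * P1 - dcoef l 0 * P2 + mA * mB * F z"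
    by (simp add: dcoef_0 I00)
  show "P1 = 0" if "mB = 0"
  proof -
    have "P1 = (LINT u|unif2. (A (fst u) * ldiff l (fst u, 0) F z) * B (snd u))"
      unfolding P1_def by (simp add: ac_simps)
    also have "\<dots> = (LINT x|unif. A x * ldiff l (x, 0) F z) * mB"
      unfolding mB_def using i1 by (intro integral_unif2_product[where a = "\<lambda>x. A x * ldiff l (x, 0) F z"]) (simp add: ac_simps)
    finally show ?thesis using that by simp
  qed
  show "P2 = 0" if "mA = 0"
  proof -
    have "P2 = (LINT u|unif2. A (fst u) * (B (snd u) * ldiff l (0, snd u) F z))"
      unfolding P2_def by (simp add: ac_simps)
    also have "\<dots> = mA * (LINT y|unif. B y * ldiff l (0, y) F z)"
      unfolding mA_def using i2 by (intro integral_unif2_product[where b = "\<lambda>y. B y * ldiff l (0, y) F z"]) (simp add: ac_simps)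
    finally show ?thesis using that by simp
  qed
qed

lemma nn_integral_le_Npow:
  assumes [measurable]: "F \<in> borel_measurable borel" and p: "1 \<le> p"
  shows "(\<integral>\<^sup>+z. ennreal (cmod (F z)) \<partial>unif2) \<le> 1 + Npow p F"
proof -
  have "(\<integral>\<^sup>+z. ennreal (cmod (F z)) \<partial>unif2) \<le> (\<integral>\<^sup>+z. 1 + ennreal (cmod (F z) powr p) \<partial>unif2)"
  proof (rule nn_integral_mono)
    fix z
    have "t \<le> 1 + t powr p" if "0 \<le> t" for t
    proof (cases "t \<le> 1")
      case False
      then have "t powr 1 \<le> t powr p" using p by (intro powr_mono) auto
      then show ?thesis using that by simp
    qed (auto intro: add_increasing2)
    then have "ennreal (cmod (F z)) \<le> ennreal (1 + cmod (F z) powr p)" by (intro ennreal_leI) auto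
    then show "ennreal (cmod (F z)) \<le> 1 + ennreal (cmod (F z) powr p)" by simp
  qed
  also have "\<dots> = 1 + Npow p F"
    using unif2.emeasure_space_1 unfolding Npow_def by (subst nn_integral_add) (auto simp: space_pair_measure)
  finally show ?thesis .
qed

lemma measurable_kernel_average:
  fixes Op :: "real \<times> real \<Rightarrow> real \<times> real \<Rightarrow> complex"
  assumes M [measurable]: "(\<lambda>(z, u). Op u z) \<in> borel_measurable (unif2 \<Otimes>\<^sub>M unif2)"
    and [measurable]: "A \<in> borel_measurable borel" "B \<in> borel_measurable borel"
  shows "(\<lambda>z. LINT u|unif2. A (fst u) * B (snd u) * Op u z) \<in> borel_measurable borel"
proof -
  have M' [measurable]: "(\<lambda>x. Op (snd x) (fst x)) \<in> borel_measurable (unif2 \<Otimes>\<^sub>M unif2)"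
    using M by (simp add: case_prod_beta')
  have "(\<lambda>z. LINT u|unif2. A (fst u) * B (snd u) * Op u z) \<in> borel_measurable unif2"
    by (rule unif2.borel_measurable_lebesgue_integral) (unfold case_prod_beta', measurable)
  then show ?thesis by simp
qed

text \<open>Serves two purposes: with means 1 it is the approximation error of a Jackson operator,
  with a mean 0 it bounds a block. In the term with differences in the first variable alone, the
  second variable enters only through B; the integral factorises and vanishes with the mean of B.
  Therefore \<open>H1\<close> and \<open>H2\<close> are demanded only for nonzero means. The factor
  4^p comes from splitting three terms by two uses of \<open>Npow_add\<close>.\<close>

lemma jackson_estimate:
  assumes F: "permeas F" and p: "1 \<le> p" and fin: "Npow p F < \<infinity>"
    and q: "kappa p l \<le> 4 ^ q" and N: "N1 \<ge> 1" "N2 \<ge> 1"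
    and A: "trig dA A" "decays (Suc q) C N1 A" and B: "trig dB B" "decays (Suc q) C N2 B"
    and W: "0 \<le> W12" "0 \<le> W1" "0 \<le> W2"
    and H12: "\<And>h k. \<bar>h\<bar> < 1 / (2 * real N1) \<Longrightarrow> \<bar>k\<bar> < 1 / (2 * real N2) \<Longrightarrow>
      Npow p (ldiff l (h, 0) (ldiff l (0, k) F)) \<le> ennreal W12"
    and H1: "\<And>h. (LINT u|unif. B u) \<noteq> 0 \<Longrightarrow> \<bar>h\<bar> < 1 / (2 * real N1) \<Longrightarrow> Npow p (ldiff l (h, 0) F) \<le> ennreal W1"
    and H2: "\<And>k. (LINT u|unif. A u) \<noteq> 0 \<Longrightarrow> \<bar>k\<bar> < 1 / (2 * real N2) \<Longrightarrow> Npow p (ldiff l (0, k) F) \<le> ennreal W2"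
  shows "Npow p (\<lambda>z. block l A B F z - (LINT u|unif. A u) * (LINT u|unif. B u) * F z) \<le>
    ennreal (4 powr p * cJ p q C * (W12 + (if (LINT u|unif. B u) = 0 then 0 else W1) + (if (LINT u|unif. A u) = 0 then 0 else W2)))"
proof -
  define mA where "mA = (LINT u|unif. A u)"
  define mB where "mB = (LINT u|unif. B u)"
  define P1 where "P1 = (\<lambda>z. LINT u|unif2. A (fst u) * B (snd u) * ldiff l (fst u, 0) F z)"
  define P2 where "P2 = (\<lambda>z. LINT u|unif2. A (fst u) * B (snd u) * ldiff l (0, snd u) F z)"
  define P12 where "P12 = (\<lambda>z. LINT u|unif2. A (fst u) * B (snd u) * ldiff l (fst u, 0) (ldiff l (0, snd u) F) z)"
  have Fm [measurable]: "F \<in> borel_measurable borel" by (rule permeas_measurable[OF F])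
  have [measurable]: "A \<in> borel_measurable borel" "B \<in> borel_measurable borel"
    using trig_measurable A B by auto
  note m = measurable_dv12[OF Fm, of l]
  have meas [measurable]: "P1 \<in> borel_measurable borel" "P2 \<in> borel_measurable borel" "P12 \<in> borel_measurable borel"
    unfolding P1_def P2_def P12_def by (intro measurable_kernel_average m; measurable)+
  have p0: "0 \<le> p" using p by simp
  have k1: "1 \<le> ennreal (kappa p l ^ i)" for i
    using kappa_ge_1[OF p0, of l] by (simp add: one_le_power)
  have C: "C \<ge> 0" by (rule decays_nonneg[OF A(2) N(1)])
  then have cJ: "cJ p q C \<ge> 0" by (simp add: cJ_def)
  have n12: "Npow p P12 \<le> ennreal (cJ p q C * W12)"
    unfolding P12_def using A(1) B(1)
    by (intro Npow_kernel_average[OF m(1) _ _ p q N A(2) B(2) W(1)] Npow_dv12_scale[OF F p0 H12]) (auto intro: trig_measurable)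
  have n1: "Npow p P1 \<le> ennreal (cJ p q C * W1)" if "mB \<noteq> 0"
    unfolding P1_def
  proof (intro Npow_kernel_average[OF m(2) _ _ p q N A(2) B(2) W(2)])
    fix u i j assume u: "\<bar>fst u\<bar> < 2 ^ i * (1 / (2 * real N1))"
    have "Npow p (ldiff l (fst u, 0) F) \<le> ennreal (kappa p l ^ i) * ennreal W1"
      by (rule Npow_dv1_scale[OF F p0 H1 u]) (use that in \<open>auto simp: mB_def\<close>)
    also have "\<dots> \<le> ennreal (kappa p l ^ i) * (ennreal (kappa p l ^ j) * ennreal W1)"
      using mult_right_mono[OF k1, of "ennreal W1" j] by (intro mult_left_mono) auto
    finally show "Npow p (ldiff l (fst u, 0) F) \<le> ennreal (kappa p l ^ i) * (ennreal (kappa p l ^ j) * ennreal W1)" .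
  qed measurable
  have n2: "Npow p P2 \<le> ennreal (cJ p q C * W2)" if "mA \<noteq> 0"
    unfolding P2_def
  proof (intro Npow_kernel_average[OF m(3) _ _ p q N A(2) B(2) W(3)])
    fix u i j assume u: "\<bar>snd u\<bar> < 2 ^ j * (1 / (2 * real N2))"
    have "Npow p (ldiff l (0, snd u) F) \<le> ennreal (kappa p l ^ j) * ennreal W2"
      by (rule Npow_dv2_scale[OF F p0 H2 u]) (use that in \<open>auto simp: mA_def\<close>)
    also have "\<dots> \<le> ennreal (kappa p l ^ i) * (ennreal (kappa p l ^ j) * ennreal W2)"
      using mult_right_mono[OF k1, of "ennreal (kappa p l ^ j) * ennreal W2" i] by simp
    finally show "Npow p (ldiff l (0, snd u) F) \<le> ennreal (kappa p l ^ i) * (ennreal (kappa p l ^ j) * ennreal W2)" .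
  qed measurable
  \<comment> \<open>The coefficient 0 stands for a term that vanishes identically, so that no bound
    for it has to be supplied.\<close>
  define P1' where "P1' = (\<lambda>z. (if mB = 0 then 0 else - dcoef l 0) * P1 z)"
  define P2' where "P2' = (\<lambda>z. (if mA = 0 then 0 else - dcoef l 0) * P2 z)"
  have meas' [measurable]: "P1' \<in> borel_measurable borel" "P2' \<in> borel_measurable borel"
    unfolding P1'_def P2'_def by measurable
  have n1': "Npow p P1' \<le> ennreal (cJ p q C * (if mB = 0 then 0 else W1))"
    unfolding P1'_def Npow_scale[OF meas(1)] using n1 p by (auto simp: dcoef_0)
  have n2': "Npow p P2' \<le> ennreal (cJ p q C * (if mA = 0 then 0 else W2))"
    unfolding P2'_def Npow_scale[OF meas(2)] using n2 p by (auto simp: dcoef_0)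
  have "(\<integral>\<^sup>+z. ennreal (cmod (F z)) \<partial>unif2) < \<infinity>"
    using nn_integral_le_Npow[OF Fm p] fin by (auto simp: ennreal_add_less_top intro: le_less_trans)
  \<comment> \<open>The block identity is available for almost every z only, which suffices for p-th
    means.\<close>
  from AE_integrable_dilate[OF F this]
  have "AE z in unif2. block l A B F z - mA * mB * F z = P12 z + (P1' z + P2' z)"
  proof eventually_elim
    case (elim z)
    then have int: "\<And>i j. integrable unif2 (\<lambda>u. F (z + dilate i j u))" by blast
    show ?case
      using block_identity[OF A(1) B(1) int, of l]
      by (auto simp: P1'_def P2'_def P12_def P1_def P2_def mA_def mB_def)
  qed
  then have "Npow p (\<lambda>z. block l A B F z - mA * mB * F z) = Npow p (\<lambda>z. P12 z + (P1' z + P2' z))"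
    unfolding Npow_def by (intro nn_integral_cong_AE) auto
  also have "\<dots> \<le> ennreal (2 powr p) * (Npow p P12 + Npow p (\<lambda>z. P1' z + P2' z))"
    by (intro Npow_add p0) measurable
  also have "\<dots> \<le> ennreal (2 powr p) * (Npow p P12 + ennreal (2 powr p) * (Npow p P1' + Npow p P2'))"
    by (intro mult_left_mono add_left_mono Npow_add p0) auto
  also have "\<dots> \<le> ennreal (2 powr p) * (ennreal (2 powr p) * Npow p P12 + ennreal (2 powr p) * (Npow p P1' + Npow p P2'))"
    using mult_right_mono[of 1 "ennreal (2 powr p)" "Npow p P12"] p0
    by (intro mult_left_mono add_right_mono) (auto simp: ge_one_powr_ge_zero)
  also have "\<dots> = ennreal (4 powr p) * (Npow p P12 + (Npow p P1' + Npow p P2'))"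
    using powr_mult[of 2 2 p] by (simp add: distrib_left ennreal_mult mult.assoc)
  also have "\<dots> \<le> ennreal (4 powr p) * (ennreal (cJ p q C * W12) +
      (ennreal (cJ p q C * (if mB = 0 then 0 else W1)) + ennreal (cJ p q C * (if mA = 0 then 0 else W2))))"
    by (intro mult_left_mono add_mono n12 n1' n2') auto
  also have "\<dots> = ennreal (4 powr p * cJ p q C * (W12 + (if mB = 0 then 0 else W1) + (if mA = 0 then 0 else W2)))"
    using W cJ by (simp add: ennreal_mult[symmetric] ennreal_plus[symmetric] algebra_simps del: ennreal_plus)
  finally show ?thesis unfolding mA_def mB_def .
qed

section \<open>Sampling bivariate trigonometric polynomials\<close>

inductive trig2 :: "nat \<Rightarrow> nat \<Rightarrow> (real \<times> real \<Rightarrow> complex) \<Rightarrow> bool" for d d' where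
  fchar: "\<bar>k\<bar> \<le> int d \<Longrightarrow> \<bar>m\<bar> \<le> int d' \<Longrightarrow> trig2 d d' (\<lambda>z. fchar k (fst z) * fchar m (snd z))"
| add: "trig2 d d' g \<Longrightarrow> trig2 d d' h \<Longrightarrow> trig2 d d' (\<lambda>z. g z + h z)"
| scale: "trig2 d d' g \<Longrightarrow> trig2 d d' (\<lambda>z. c * g z)"

lemma trig2_const: "trig2 d d' (\<lambda>z. c)"
  using trig2.scale[OF trig2.fchar[of 0 d 0 d'], of c] by simp

lemma trig2_sum: "(\<And>i. i \<in> I \<Longrightarrow> trig2 d d' (g i)) \<Longrightarrow> trig2 d d' (\<lambda>u. \<Sum>i\<in>I. g i u)"
  by (induction I rule: infinite_finite_induct) (auto intro: trig2.add trig2_const)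

lemma trig2_continuous: "trig2 d d' g \<Longrightarrow> continuous_on A g"
  by (induction rule: trig2.induct) (auto intro!: continuous_intros)

lemma trig2_measurable: "trig2 d d' g \<Longrightarrow> g \<in> borel_measurable borel"
  by (simp add: borel_measurable_continuous_onI trig2_continuous)

lemma trig2_permeas: "trig2 d d' g \<Longrightarrow> permeas g"
proof -
  assume g: "trig2 d d' g"
  then have "per2 g" by (induction rule: trig2.induct) (auto simp: per2_def)
  with g show "permeas g" by (simp add: permeas_def trig2_measurable)
qed

lemma trig2_bounded: "trig2 d d' g \<Longrightarrow> \<exists>B. \<forall>z. cmod (g z) \<le> B"
proof (induction rule: trig2.induct)
  case (fchar k m)
  then show ?case by (auto simp: norm_mult)
next
  case (add g h)
  then obtain B B' where "\<forall>u. cmod (g u) \<le> B" "\<forall>u. cmod (h u) \<le> B'" by blast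
  then have "\<forall>u. cmod (g u + h u) \<le> B + B'" by (meson norm_triangle_mono)
  then show ?case by blast
next
  case (scale g c)
  then obtain B where "\<forall>u. cmod (g u) \<le> B" by blast
  then have "\<forall>u. cmod (c * g u) \<le> cmod c * B" by (auto simp: norm_mult mult_left_mono)
  then show ?case by blast
qed

lemma trig2_integrable:
  assumes g: "trig2 d d' g"
  shows "integrable unif2 g"
proof -
  obtain B where "\<forall>z. cmod (g z) \<le> B" using trig2_bounded[OF g] by blast
  then show ?thesis
    using trig2_measurable[OF g] by (intro unif2.integrable_const_bound[where B = B]) auto
qed

lemma trig2_product:
  assumes "trig d g" "trig d' h"
  shows "trig2 d d' (\<lambda>z. g (fst z) * h (snd z))"
proof -
  obtain a where a: "\<And>u. g u = (\<Sum>k\<in>{- int d..int d}. a k * fchar k u)" using trig_explicit[OF assms(1)] by blast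
  obtain b where b: "\<And>u. h u = (\<Sum>k\<in>{- int d'..int d'}. b k * fchar k u)" using trig_explicit[OF assms(2)] by blast
  have "(\<lambda>z. g (fst z) * h (snd z)) = (\<lambda>z. \<Sum>k\<in>{- int d..int d}. \<Sum>m\<in>{- int d'..int d'}.
      (a k * b m) * (fchar k (fst z) * fchar m (snd z)))"
    by (simp add: a b sum_product ac_simps)
  moreover have "trig2 d d' \<dots>"
    by (intro trig2_sum trig2.scale trig2.fchar) auto
  ultimately show ?thesis by simp
qed

text \<open>
  Translation invariance of the integral gives \<open>g (z + dilate i j c) = fchar k (- fst c) * fchar m (- snd c) * g z\<close>;
  as \<open>g\<close> is also periodic, it vanishes unless \<open>i\<close> divides \<open>k\<close> and \<open>j\<close> divides \<open>m\<close>, and is otherwise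
  a multiple of a character.
\<close>

lemma trig2_dilated_coefficient:
  assumes F: "permeas F" and ij: "i \<ge> 1" "j \<ge> 1" and km: "\<bar>k\<bar> \<le> int d" "\<bar>m\<bar> \<le> int d'"
  shows "trig2 d d' (\<lambda>z. LINT u|unif2. fchar k (fst u) * fchar m (snd u) * F (z + dilate i j u))"
proof -
  have Fm [measurable]: "F \<in> borel_measurable borel" by (rule permeas_measurable[OF F])
  define g where "g = (\<lambda>z. LINT u|unif2. fchar k (fst u) * fchar m (snd u) * F (z + dilate i j u))"
  have Fp: "F (x + real n, y) = F (x, y)" "F (x, y + real n) = F (x, y)" for x y n
    using per_nat[where g = "\<lambda>x. F (x, y)", OF per2_D1[OF permeas_per2[OF F]], of x n]
      per_nat[where g = "\<lambda>y. F (x, y)", OF per2_D2[OF permeas_per2[OF F]], of y n]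
    by simp_all
  have shift: "g (z + dilate i j c) = fchar k (- fst c) * fchar m (- snd c) * g z" for z c
  proof -
    define H where "H = (\<lambda>u. fchar k (fst u - fst c) * fchar m (snd u - snd c) * F (z + dilate i j u))"
    have [measurable]: "H \<in> borel_measurable borel" unfolding H_def by measurable
    have "fchar k (x + 1 - a) = fchar k (x - a)" for k x a
      using fchar_periodic[of k "x - a"] by (simp add: algebra_simps del: fchar_periodic)
    moreover have "F (z + dilate i j (x + 1, y)) = F (z + dilate i j (x, y))" for x y
      using Fp(1)[of "fst z + real i * x" i "snd z + real j * y"]
      by (simp add: dilate_def plus_prod_def algebra_simps)
    moreover have "F (z + dilate i j (x, y + 1)) = F (z + dilate i j (x, y))" for x y
      using Fp(2)[of "fst z + real i * x" "snd z + real j * y" j]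
      by (simp add: dilate_def plus_prod_def algebra_simps)
    ultimately have H: "per2 H" by (simp add: per2_def H_def)
    have "g (z + dilate i j c) = (LINT u|unif2. H (u + c))"
      unfolding g_def H_def by (simp add: dilate_def plus_prod_def algebra_simps)
    also have "\<dots> = (LINT u|unif2. H u)" by (rule integral_unif2_shift) (use H in auto)
    also have "\<dots> = (LINT u|unif2. (fchar k (- fst c) * fchar m (- snd c)) * (fchar k (fst u) * fchar m (snd u) * F (z + dilate i j u)))"
      unfolding H_def diff_conv_add_uminus fchar_add by (simp add: ac_simps)
    also have "\<dots> = fchar k (- fst c) * fchar m (- snd c) * g z"
      unfolding g_def by (rule integral_mult_right_zero)
    finally show ?thesis .
  qed
  have g0: "g z = fchar k (- (fst z / real i)) * fchar m (- (snd z / real j)) * g 0" for z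
    using shift[of 0 "(fst z / real i, snd z / real j)"] ij by (simp add: dilate_def)
  have dvd: "int n dvd k" if "fchar k (- (1 / real n)) = 1" "n \<ge> 1" for n k
  proof -
    have "cos (2 * pi * of_int k * - (1 / real n)) = 1"
      using arg_cong[OF that(1), of Re] by (simp add: fchar_def)
    then obtain q :: int where "2 * pi * of_int k * - (1 / real n) = of_int q * 2 * pi"
      unfolding cos_one_2pi_int by blast
    then have "(2 * pi) * (of_int k * - (1 / real n)) = (2 * pi) * real_of_int q"
      by (simp only: ac_simps)
    then have "of_int k * - (1 / real n) = real_of_int q"
      by (subst (asm) mult_cancel_left) simp
    then have "real_of_int k = real_of_int (- q * int n)"
      using that(2) by (simp add: field_simps)
    then have "k = - q * int n" by (simp only: of_int_eq_iff)
    then show ?thesis by simp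
  qed
  show ?thesis
  proof (cases "g 0 = 0")
    case True
    then have "g z = 0" for z using g0[of z] by simp
    then have "g = (\<lambda>_. 0)" by (rule ext)
    then show ?thesis using trig2_const[of d d' 0] by (simp add: g_def)
  next
    case False
    have "g (1, 0) = g 0" "g (0, 1) = g 0"
      using Fp[of _ 1] Fp[of _ _ 1] unfolding g_def by (simp_all add: plus_prod_def add.commute[of 1])
    then have "fchar k (- (1 / real i)) = 1" "fchar m (- (1 / real j)) = 1"
      using g0[of "(1, 0)"] g0[of "(0, 1)"] False by simp_all
    then have "int i dvd k" "int j dvd m" using dvd ij by auto
    then obtain k' m' where k': "k = int i * k'" "m = int j * m'" by (auto elim!: dvdE)
    have c: "fchar (int n * q) (- (x / real n)) = fchar (- q) x" if "n \<ge> 1" for n q x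
      using that by (simp add: fchar_def mult.assoc)
    have "g = (\<lambda>z. g 0 * (fchar (- k') (fst z) * fchar (- m') (snd z)))"
    proof
      fix z
      show "g z = g 0 * (fchar (- k') (fst z) * fchar (- m') (snd z))"
        using g0[of z] unfolding k' c[OF ij(1)] c[OF ij(2)] by (simp only: ac_simps)
    qed
    moreover have le: "\<bar>q\<bar> \<le> \<bar>int n * q\<bar>" if "n \<ge> 1" for n q
      using that mult_right_mono[of 1 "int n" "\<bar>q\<bar>"] by (simp add: abs_mult)
    have "trig2 d d' (\<lambda>z. g 0 * (fchar (- k') (fst z) * fchar (- m') (snd z)))"
      using le[OF ij(1), of k'] le[OF ij(2), of m'] km by (intro trig2.scale trig2.fchar) (auto simp: k')
    ultimately show ?thesis by (simp add: g_def)
  qed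
qed

text \<open>With positive factors the substitution in u gives the norm of F for each z separately,
  in contrast to \<open>AE_integrable_dilate\<close>. The block avoids the index 0, so its
  properties hold at every point and not merely almost everywhere.\<close>

lemma integrable_dilate:
  assumes F: "permeas F" and fin: "(\<integral>\<^sup>+z. ennreal (cmod (F z)) \<partial>unif2) < \<infinity>" and ij: "i \<ge> 1" "j \<ge> 1"
  shows "integrable unif2 (\<lambda>u. F (z + dilate i j u))"
proof (rule integrableI_bounded)
  have Fm [measurable]: "F \<in> borel_measurable borel" by (rule permeas_measurable[OF F])
  have "(\<integral>\<^sup>+u. ennreal (cmod (F (z + dilate i j u))) \<partial>unif2) = (\<integral>\<^sup>+u. ennreal (cmod (F u)) \<partial>unif2)"
    using nn_integral_unif2_affine[of "\<lambda>z. ennreal (cmod (F z))" i j "fst z" "snd z"] ij permeas_per2[OF F]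
    by (simp add: per2_def dilate_def plus_prod_def)
  then show "(\<integral>\<^sup>+u. ennreal (norm (F (z + dilate i j u))) \<partial>unif2) < \<infinity>" using fin by simp
  show "(\<lambda>u. F (z + dilate i j u)) \<in> borel_measurable unif2" by measurable
qed

lemma trig2_block:
  assumes F: "permeas F" and fin: "(\<integral>\<^sup>+z. ennreal (cmod (F z)) \<partial>unif2) < \<infinity>"
    and A: "trig d A" and B: "trig d' B"
  shows "trig2 d d' (block l A B F)"
proof -
  have Fm [measurable]: "F \<in> borel_measurable borel" by (rule permeas_measurable[OF F])
  obtain a where a: "\<And>u. A u = (\<Sum>k\<in>{- int d..int d}. a k * fchar k u)" using trig_explicit[OF A] by blast
  obtain b where b: "\<And>u. B u = (\<Sum>k\<in>{- int d'..int d'}. b k * fchar k u)" using trig_explicit[OF B] by blast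
  have "(LINT u|unif2. A (fst u) * B (snd u) * F (z + dilate i j u)) =
      (\<Sum>k\<in>{- int d..int d}. \<Sum>m\<in>{- int d'..int d'}. (a k * b m) *
         (LINT u|unif2. fchar k (fst u) * fchar m (snd u) * F (z + dilate i j u)))" if "i \<ge> 1" "j \<ge> 1" for z i j
  proof -
    have i: "integrable unif2 (\<lambda>u. (a k * b m) * (fchar k (fst u) * fchar m (snd u) * F (z + dilate i j u)))"
      if "\<bar>k\<bar> \<le> int d" "\<bar>m\<bar> \<le> int d'" for k m
      by (intro integrable_mult_right integrable_kernel_mult[OF trig.fchar[OF that(1)] trig.fchar[OF that(2)]] integrable_dilate[OF F fin] \<open>i \<ge> 1\<close> \<open>j \<ge> 1\<close>)
    have "A (fst u) * B (snd u) * F (z + dilate i j u) =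
      (\<Sum>k\<in>{- int d..int d}. \<Sum>m\<in>{- int d'..int d'}. (a k * b m) * (fchar k (fst u) * fchar m (snd u) * F (z + dilate i j u)))" for u
    proof -
      have "A (fst u) * B (snd u) = (\<Sum>k\<in>{- int d..int d}. \<Sum>m\<in>{- int d'..int d'}. (a k * b m) * (fchar k (fst u) * fchar m (snd u)))"
        unfolding a b sum_product by (intro sum.cong refl) (simp only: ac_simps)
      then show ?thesis by (simp only: sum_distrib_right mult.assoc)
    qed
    then have "(LINT u|unif2. A (fst u) * B (snd u) * F (z + dilate i j u)) =
      (LINT u|unif2. (\<Sum>k\<in>{- int d..int d}. \<Sum>m\<in>{- int d'..int d'}. (a k * b m) * (fchar k (fst u) * fchar m (snd u) * F (z + dilate i j u))))"
      by simp
    also have "\<dots> = (\<Sum>k\<in>{- int d..int d}. LINT u|unif2. (\<Sum>m\<in>{- int d'..int d'}. (a k * b m) * (fchar k (fst u) * fchar m (snd u) * F (z + dilate i j u))))"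
      by (rule Bochner_Integration.integral_sum) (intro Bochner_Integration.integrable_sum i; auto)
    also have "\<dots> = (\<Sum>k\<in>{- int d..int d}. \<Sum>m\<in>{- int d'..int d'}. LINT u|unif2. (a k * b m) * (fchar k (fst u) * fchar m (snd u) * F (z + dilate i j u)))"
      by (intro sum.cong refl Bochner_Integration.integral_sum i) auto
    finally show ?thesis by simp
  qed
  then have "block l A B F = (\<lambda>z. \<Sum>i=1..l. \<Sum>j=1..l. (dcoef l i * dcoef l j) *
      (\<Sum>k\<in>{- int d..int d}. \<Sum>m\<in>{- int d'..int d'}. (a k * b m) *
         (LINT u|unif2. fchar k (fst u) * fchar m (snd u) * F (z + dilate i j u))))"
    by (auto simp: block_def fun_eq_iff intro!: sum.cong)
  moreover have "trig2 d d' \<dots>"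
    by (intro trig2_sum trig2.scale trig2_dilated_coefficient F) auto
  ultimately show ?thesis by simp
qed

lemma trig2_reproduce:
  assumes t: "trig2 d d' t" and V: "trig e V" "trig e' V'"
    and r: "\<And>k. \<bar>k\<bar> \<le> int d \<Longrightarrow> (LINT u|unif. V u * fchar k u) = 1"
    and r': "\<And>k. \<bar>k\<bar> \<le> int d' \<Longrightarrow> (LINT u|unif. V' u * fchar k u) = 1"
  shows "(LINT u|unif2. V (fst u) * V' (snd u) * t (z + u)) = t z"
  using t
proof (induction rule: trig2.induct)
  case (fchar k m)
  have "integrable unif2 (\<lambda>u. V (fst u) * V' (snd u) * (fchar k (fst u) * fchar m (snd u)))"
    by (intro integrable_kernel_mult[OF V] trig2_integrable[OF trig2.fchar[OF fchar]])
  then have i: "integrable unif2 (\<lambda>u. (V (fst u) * fchar k (fst u)) * (V' (snd u) * fchar m (snd u)))"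
    by (simp add: ac_simps)
  have "(LINT u|unif2. V (fst u) * V' (snd u) * (fchar k (fst (z + u)) * fchar m (snd (z + u)))) =
     (LINT u|unif2. (fchar k (fst z) * fchar m (snd z)) * ((V (fst u) * fchar k (fst u)) * (V' (snd u) * fchar m (snd u))))"
    by (simp add: fchar_add ac_simps)
  also have "\<dots> = (fchar k (fst z) * fchar m (snd z)) * ((LINT u|unif. V u * fchar k u) * (LINT u|unif. V' u * fchar m u))"
    by (subst integral_mult_right_zero, subst integral_unif2_product[OF i]) simp
  finally show ?case using r r' fchar by simp
next
  case (add g h)
  have i: "integrable unif2 (\<lambda>u. V (fst u) * V' (snd u) * f (z + u))" if f: "trig2 d d' f" for f
  proof (rule integrable_kernel_mult[OF V])
    obtain B where B: "\<And>z. cmod (f z) \<le> B" using trig2_bounded[OF f] by blast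
    have [measurable]: "f \<in> borel_measurable borel" by (rule trig2_measurable[OF f])
    show "integrable unif2 (\<lambda>u. f (z + u))" by (rule unif2.integrable_const_bound[where B = B]) (use B in auto)
  qed
  show ?case using add i[of g] i[of h] by (simp add: distrib_left)
next
  case (scale g c)
  have "(LINT u|unif2. V (fst u) * V' (snd u) * (c * g (z + u))) = (LINT u|unif2. c * (V (fst u) * V' (snd u) * g (z + u)))"
    by (simp add: ac_simps)
  then show ?case using scale by simp
qed

section \<open>Reproducing kernels and sampling inequalities\<close>

definition cV :: "nat \<Rightarrow> real" where
  "cV R = ((2 * real R + 1)\<^sup>2 + 1)\<^sup>2"

definition cT :: "real \<Rightarrow> nat \<Rightarrow> real" where
  "cT p R = (1 + cV R * 1600) powr p * cV R"

lemma cT_nonneg: "0 \<le> cT p R"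
  by (simp add: cT_def cV_def)

text \<open>The polynomial reproduces itself under the de la Vallee Poussin kernels, so Jensen's
  inequality bounds a point value by a local mean on the scale of the degree. Point evaluations are
  controlled by norms only through this lemma.\<close>

lemma trig2_point:
  assumes t: "trig2 (R * N1) (R * N2) t" and N: "N1 \<ge> 1" "N2 \<ge> 1" and p: "1 \<le> p"
  shows "ennreal (cmod (t z) powr p) \<le> ennreal (cT p R) *
    (\<integral>\<^sup>+u. ennreal (wker N1 (fst u) * wker N2 (snd u) * cmod (t (z + u)) powr p) \<partial>unif2)"
proof -
  have [measurable]: "t \<in> borel_measurable borel" by (rule trig2_measurable[OF t])
  obtain V1 where V1: "trig (2 * R * N1 + N1) V1" "decays 1 ((2 * real R + 1)\<^sup>2 + 1) N1 V1"
     "\<forall>k. \<bar>k\<bar> \<le> int (R * N1) \<longrightarrow> (LINT u|unif. V1 u * fchar k u) = 1"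
    using vallee_poussin_kernel[OF N(1), of R] by blast
  obtain V2 where V2: "trig (2 * R * N2 + N2) V2" "decays 1 ((2 * real R + 1)\<^sup>2 + 1) N2 V2"
     "\<forall>k. \<bar>k\<bar> \<le> int (R * N2) \<longrightarrow> (LINT u|unif. V2 u * fchar k u) = 1"
    using vallee_poussin_kernel[OF N(2), of R] by blast
  have [measurable]: "V1 \<in> borel_measurable borel" "V2 \<in> borel_measurable borel"
    using V1 V2 trig_measurable by auto
  have V: "cmod (V1 (fst u) * V2 (snd u)) \<le> cV R * (wker N1 (fst u) * wker N2 (snd u))"
    if u: "\<bar>fst u\<bar> \<le> 1/2 \<and> \<bar>snd u\<bar> \<le> 1/2" for u
  proof -
    define C where "C = (2 * real R + 1)\<^sup>2 + 1"
    have C0: "0 \<le> C" by (simp add: C_def)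
    have "cmod (V1 (fst u)) * 1 \<le> 16 ^ 0 * C * wker N1 (fst u)"
      unfolding C_def using V1(2) u N by (intro decays_le_wker) auto
    moreover have "cmod (V2 (snd u)) * 1 \<le> 16 ^ 0 * C * wker N2 (snd u)"
      unfolding C_def using V2(2) u N by (intro decays_le_wker) auto
    ultimately have "cmod (V1 (fst u)) * cmod (V2 (snd u)) \<le> (C * wker N1 (fst u)) * (C * wker N2 (snd u))"
      using C0 by (intro mult_mono) auto
    also have "\<dots> = cV R * (wker N1 (fst u) * wker N2 (snd u))"
    proof -
      have "cV R = C * C" by (simp only: cV_def C_def power2_eq_square)
      then show ?thesis by simp
    qed
    finally show ?thesis by (simp add: norm_mult)
  qed
  have c0: "0 \<le> cV R" by (simp add: cV_def)
  have 1: "(\<integral>\<^sup>+u. ennreal (cmod (V1 (fst u) * V2 (snd u))) \<partial>unif2) \<le> ennreal (cV R * 1600)"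
  proof -
    have "(\<integral>\<^sup>+u. ennreal (cmod (V1 (fst u) * V2 (snd u))) \<partial>unif2) \<le>
        (\<integral>\<^sup>+u. ennreal (cV R) * ennreal (wker N1 (fst u) * wker N2 (snd u)) \<partial>unif2)"
      by (intro nn_integral_mono_AE eventually_mono[OF AE_unif2])
        (unfold ennreal_mult'[OF c0, symmetric], intro ennreal_leI V)
    also have "\<dots> \<le> ennreal (cV R) * 1600"
      by (subst nn_integral_cmult) (auto intro!: mult_left_mono nn_integral_wker2 N)
    finally show ?thesis using c0 by (simp add: ennreal_mult)
  qed
  have "ennreal (cmod (t z) powr p) = ennreal (cmod (LINT u|unif2. V1 (fst u) * V2 (snd u) * t (z + u)) powr p)"
    using trig2_reproduce[OF t V1(1) V2(1)] V1(3) V2(3) by simp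
  also have "\<dots> \<le> ennreal ((1 + cV R * 1600) powr p) *
     (\<integral>\<^sup>+u. ennreal (cmod (V1 (fst u) * V2 (snd u)) * cmod (t (z + u)) powr p) \<partial>unif2)"
    by (rule norm_integral_powr_le[OF _ _ p _ 1]) (use c0 in auto)
  also have "(\<integral>\<^sup>+u. ennreal (cmod (V1 (fst u) * V2 (snd u)) * cmod (t (z + u)) powr p) \<partial>unif2) \<le>
     (\<integral>\<^sup>+u. ennreal (cV R) * ennreal (wker N1 (fst u) * wker N2 (snd u) * cmod (t (z + u)) powr p) \<partial>unif2)"
    by (intro nn_integral_mono_AE eventually_mono[OF AE_unif2])
       (unfold ennreal_mult'[OF c0, symmetric] mult.assoc[symmetric], intro ennreal_leI mult_right_mono,
         auto intro!: order_trans[OF V] simp: mult.assoc)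
  also have "\<dots> = ennreal (cV R) * (\<integral>\<^sup>+u. ennreal (wker N1 (fst u) * wker N2 (snd u) * cmod (t (z + u)) powr p) \<partial>unif2)"
    by (rule nn_integral_cmult) measurable
  finally show ?thesis
    using c0 by (simp add: cT_def ennreal_mult mult.assoc mult_left_mono)
qed

text \<open>The price for viewing a kernel of resolution N at a coarser resolution N'. It is needed
  when the polynomial is finer than what the nodes can resolve.\<close>

lemma wker_scale:
  assumes "1 \<le> N'" "N' \<le> N"
  shows "wker N u \<le> 20 * (real N / real N') * fejer N' u"
proof -
  have "(real N' * u)\<^sup>2 \<le> (real N * u)\<^sup>2"
    using assms unfolding power_mult_distrib by (intro mult_right_mono power_mono) auto
  then have "wker N u \<le> real N / (1 + (real N' * u)\<^sup>2)"
    unfolding wker_def by (intro divide_left_mono mult_pos_pos wker_pos) auto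
  also have "\<dots> = (real N / real N') * wker N' u"
    using assms by (simp add: wker_def)
  also have "\<dots> \<le> (real N / real N') * (20 * fejer N' u)"
    by (intro mult_left_mono wker_le_fejer assms) auto
  finally show ?thesis by (simp add: ac_simps)
qed

lemma fejer_per: "fejer N (u + 1) = fejer N u"
  using trig_per[OF trig_dirichlet[of N]] by (simp add: fejer_def per_def) (metis add.assoc add.commute)

text \<open>A Nikolskii inequality, obtained by bounding the kernels by their maxima. It makes the
  block series converge uniformly and thus yields the continuous representative.\<close>

lemma trig2_point_sup:
  assumes t: "trig2 (R * N1) (R * N2) t" and N: "N1 \<ge> 1" "N2 \<ge> 1" and p: "1 \<le> p"
  shows "ennreal (cmod (t z) powr p) \<le> ennreal (cT p R * (real N1 * real N2)) * Npow p t"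
proof -
  have [measurable]: "t \<in> borel_measurable borel" by (rule trig2_measurable[OF t])
  have w: "wker N u \<le> real N" for N u
    unfolding wker_def using wker_pos[of N u] by (simp add: pos_divide_le_eq algebra_simps)
  have "(\<integral>\<^sup>+u. ennreal (wker N1 (fst u) * wker N2 (snd u) * cmod (t (z + u)) powr p) \<partial>unif2) \<le>
      (\<integral>\<^sup>+u. ennreal (real N1 * real N2) * ennreal (cmod (t (u + z)) powr p) \<partial>unif2)"
    by (intro nn_integral_mono) (auto simp: ennreal_mult[symmetric] add.commute[of z] intro!: ennreal_leI mult_right_mono mult_mono w)
  also have "\<dots> = ennreal (real N1 * real N2) * Npow p t"
    using Npow_shift[OF trig2_permeas[OF t], of p z] by (subst nn_integral_cmult) (auto simp: Npow_def)
  finally show ?thesis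
    using trig2_point[OF assms, of z] cT_nonneg[of p R]
    by (simp add: ennreal_mult mult.assoc) (meson mult_left_mono order_trans zero_le)
qed

text \<open>A Marcinkiewicz-Zygmund inequality. The nodes enter only through sums of Fejer kernels
  at coarser scales N1', N2', and the ratios of the scales are the oversampling loss. The factor
  1600 is 20^2 from two uses of \<open>wker_scale\<close> times the 4 of the node condition.\<close>

lemma trig2_sample:
  fixes X :: "nat \<Rightarrow> real \<times> real"
  assumes t: "trig2 (R * N1) (R * N2) t" and N': "1 \<le> N1'" "N1' \<le> N1" "1 \<le> N2'" "N2' \<le> N2" and p: "1 \<le> p"
    and X: "\<And>y. (\<Sum>\<mu><b. fejer N1' (fst y - fst (X \<mu>)) * fejer N2' (snd y - snd (X \<mu>))) \<le> 4 * real b"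
  shows "(\<Sum>\<mu><b. ennreal (cmod (t (X \<mu>)) powr p)) \<le>
    ennreal (cT p R * 1600 * ((real N1 / real N1') * (real N2 / real N2')) * real b) * Npow p t"
proof -
  have tm [measurable]: "t \<in> borel_measurable borel" by (rule trig2_measurable[OF t])
  define q where "q = 400 * ((real N1 / real N1') * (real N2 / real N2'))"
  have q: "q \<ge> 0" by (simp add: q_def)
  have N: "N1 \<ge> 1" "N2 \<ge> 1" using N' by auto
  have "ennreal (cmod (t z) powr p) \<le> ennreal (cT p R * q) *
     (\<integral>\<^sup>+u. ennreal (fejer N1' (fst u - fst z) * fejer N2' (snd u - snd z) * cmod (t u) powr p) \<partial>unif2)" for z
  proof -
    define H where "H = (\<lambda>u. ennreal (fejer N1' (fst u - fst z) * fejer N2' (snd u - snd z) * cmod (t u) powr p))"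
    have [measurable]: "H \<in> borel_measurable borel" unfolding H_def by measurable
    have g: "fejer N (x + 1 - y) = fejer N (x - y)" for N x y
      using fejer_per[of N "x - y"] by (simp add: algebra_simps)
    have Hp: "per2 H" using permeas_per2[OF trig2_permeas[OF t]] by (simp add: per2_def H_def g)
    have "(\<integral>\<^sup>+u. ennreal (wker N1 (fst u) * wker N2 (snd u) * cmod (t (z + u)) powr p) \<partial>unif2) \<le>
      (\<integral>\<^sup>+u. ennreal q * H (u + z) \<partial>unif2)"
    proof (rule nn_integral_mono)
      fix u
      have "wker N1 (fst u) * wker N2 (snd u) \<le> (20 * (real N1 / real N1') * fejer N1' (fst u)) * (20 * (real N2 / real N2') * fejer N2' (snd u))"
        by (intro mult_mono wker_scale N') auto
      also have "\<dots> = q * (fejer N1' (fst u) * fejer N2' (snd u))"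
        by (simp add: q_def)
      finally have "wker N1 (fst u) * wker N2 (snd u) * cmod (t (z + u)) powr p \<le>
         q * (fejer N1' (fst u) * fejer N2' (snd u)) * cmod (t (z + u)) powr p"
        by (intro mult_right_mono) auto
      then show "ennreal (wker N1 (fst u) * wker N2 (snd u) * cmod (t (z + u)) powr p) \<le> ennreal q * H (u + z)"
        unfolding H_def ennreal_mult'[OF q, symmetric] by (intro ennreal_leI) (simp add: add.commute mult.assoc)
    qed
    also have "\<dots> = ennreal q * (\<integral>\<^sup>+u. H u \<partial>unif2)"
      by (subst nn_integral_cmult) (auto simp: nn_integral_unif2_shift[OF _ Hp])
    finally have i: "(\<integral>\<^sup>+u. ennreal (wker N1 (fst u) * wker N2 (snd u) * cmod (t (z + u)) powr p) \<partial>unif2) \<le> ennreal q * (\<integral>\<^sup>+u. H u \<partial>unif2)" .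
    have "ennreal (cmod (t z) powr p) \<le> ennreal (cT p R) * (\<integral>\<^sup>+u. ennreal (wker N1 (fst u) * wker N2 (snd u) * cmod (t (z + u)) powr p) \<partial>unif2)"
      by (rule trig2_point[OF t N p])
    also have "\<dots> \<le> ennreal (cT p R) * (ennreal q * (\<integral>\<^sup>+u. H u \<partial>unif2))"
      by (intro mult_left_mono i) auto
    also have "\<dots> = ennreal (cT p R * q) * (\<integral>\<^sup>+u. H u \<partial>unif2)"
      using q cT_nonneg by (simp add: ennreal_mult mult.assoc)
    finally show ?thesis unfolding H_def .
  qed
  then have "(\<Sum>\<mu><b. ennreal (cmod (t (X \<mu>)) powr p)) \<le> (\<Sum>\<mu><b. ennreal (cT p R * q) *
     (\<integral>\<^sup>+u. ennreal (fejer N1' (fst u - fst (X \<mu>)) * fejer N2' (snd u - snd (X \<mu>)) * cmod (t u) powr p) \<partial>unif2))"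
    by (intro sum_mono)
  also have "\<dots> = ennreal (cT p R * q) *
     (\<integral>\<^sup>+u. (\<Sum>\<mu><b. ennreal (fejer N1' (fst u - fst (X \<mu>)) * fejer N2' (snd u - snd (X \<mu>)) * cmod (t u) powr p)) \<partial>unif2)"
    by (subst nn_integral_sum) (auto simp: sum_distrib_left)
  also have "\<dots> \<le> ennreal (cT p R * q) * (\<integral>\<^sup>+u. ennreal (4 * real b) * ennreal (cmod (t u) powr p) \<partial>unif2)"
  proof (intro mult_left_mono nn_integral_mono)
    fix u
    have "(\<Sum>\<mu><b. ennreal (fejer N1' (fst u - fst (X \<mu>)) * fejer N2' (snd u - snd (X \<mu>)) * cmod (t u) powr p)) =
       ennreal ((\<Sum>\<mu><b. fejer N1' (fst u - fst (X \<mu>)) * fejer N2' (snd u - snd (X \<mu>))) * cmod (t u) powr p)"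
      by (subst sum_ennreal) (auto simp: sum_distrib_right)
    also have "\<dots> \<le> ennreal (4 * real b * cmod (t u) powr p)"
      by (intro ennreal_leI mult_right_mono X) auto
    finally show "(\<Sum>\<mu><b. ennreal (fejer N1' (fst u - fst (X \<mu>)) * fejer N2' (snd u - snd (X \<mu>)) * cmod (t u) powr p)) \<le>
      ennreal (4 * real b) * ennreal (cmod (t u) powr p)"
      by (simp add: ennreal_mult)
  qed auto
  also have "\<dots> = ennreal (cT p R * q) * (ennreal (4 * real b) * Npow p t)"
    unfolding Npow_def by (subst nn_integral_cmult) auto
  also have "\<dots> = ennreal (cT p R * q * (4 * real b)) * Npow p t"
    using q cT_nonneg by (simp add: ennreal_mult mult.assoc)
  also have "cT p R * q * (4 * real b) = cT p R * 1600 * ((real N1 / real N1') * (real N2 / real N2')) * real b"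
    by (simp add: q_def)
  finally show ?thesis .
qed

section \<open>Exactness of the Fibonacci rule\<close>

text \<open>Infinite descent: the form is odd unless both arguments are even, and halving both keeps
  the equation while decreasing |q| + |y|.\<close>

lemma fib_form_nonzero:
  fixes q y :: int
  assumes "q\<^sup>2 + q * y - y\<^sup>2 = 0"
  shows "q = 0 \<and> y = 0"
  using assms
proof (induction "nat (\<bar>q\<bar> + \<bar>y\<bar>)" arbitrary: q y rule: less_induct)
  case less
  show ?case
  proof (rule ccontr)
    assume nz: "\<not> (q = 0 \<and> y = 0)"
    have "even (q\<^sup>2 + q * y - y\<^sup>2)" using less.prems by simp
    then have "even q" "even y" by auto
    then obtain q' y' where e: "q = 2 * q'" "y = 2 * y'" by (auto elim!: evenE)
    have "4 * (q'\<^sup>2 + q' * y' - y'\<^sup>2) = 0"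
      using less.prems by (simp add: e power_mult_distrib algebra_simps)
    then have "q'\<^sup>2 + q' * y' - y'\<^sup>2 = 0" by simp
    moreover have "nat (\<bar>q'\<bar> + \<bar>y'\<bar>) < nat (\<bar>q\<bar> + \<bar>y\<bar>)" using nz by (auto simp: e)
    ultimately have "q' = 0 \<and> y' = 0" by (rule less.hyps[rotated])
    then show False using nz by (simp add: e)
  qed
qed

text \<open>
  Writing \<open>k + m b' = q b\<close> with \<open>b = fib (n + 1)\<close> and \<open>b' = fib n\<close>, Cassini's identity turns
  \<open>b\<^sup>2 (q\<^sup>2 + q m - m\<^sup>2)\<close> into \<open>k\<^sup>2 + k m (2 b' + b) \<plusminus> m\<^sup>2\<close>, and the integral form on the left is anisotropic.
\<close>

lemma fib_lattice:
  fixes k m :: int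
  assumes nz: "k \<noteq> 0 \<or> m \<noteq> 0" and dvd: "int (fib (Suc n)) dvd k + m * int (fib n)"
  shows "int (fib (Suc n)) \<le> 6 * (max 1 \<bar>k\<bar> * max 1 \<bar>m\<bar>)"
proof (rule ccontr)
  define b where "b = int (fib (Suc n))"
  define b' where "b' = int (fib n)"
  define P where "P = max 1 \<bar>k\<bar> * max 1 \<bar>m\<bar>"
  assume "\<not> int (fib (Suc n)) \<le> 6 * (max 1 \<bar>k\<bar> * max 1 \<bar>m\<bar>)"
  then have lt: "6 * P < b" by (simp add: P_def b_def)
  have b': "0 \<le> b'" "b' \<le> b" by (auto simp: b_def b'_def fib_mono)
  have b: "b > 0" using fib_neq_0_nat[of "Suc n"] by (simp add: b_def)
  obtain q where q: "k + m * b' = b * q" using dvd by (auto simp: b_def b'_def elim: dvdE)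
  define e where "e = b'\<^sup>2 + b * b' - b\<^sup>2"
  have e: "\<bar>e\<bar> = 1"
  proof -
    have "e = - ((-1) ^ n)"
      using fib_Cassini_int[of n] by (simp add: e_def b_def b'_def algebra_simps power2_eq_square)
    then show ?thesis by (simp add: power_abs)
  qed
  define Nf where "Nf = q\<^sup>2 + q * m - m\<^sup>2"
  have "Nf \<noteq> 0"
  proof
    assume "Nf = 0"
    then have "q = 0 \<and> m = 0" unfolding Nf_def by (rule fib_form_nonzero)
    then show False using nz q by simp
  qed
  then have N1: "1 \<le> \<bar>Nf\<bar>" by simp
  have "b\<^sup>2 * Nf = (b * q)\<^sup>2 + (b * q) * m * b - m\<^sup>2 * b\<^sup>2"
    by (simp add: Nf_def power2_eq_square algebra_simps)
  also have "\<dots> = k\<^sup>2 + k * m * (2 * b' + b) + m\<^sup>2 * e"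
    unfolding q[symmetric] e_def by (simp add: power2_eq_square algebra_simps)
  finally have "b\<^sup>2 * \<bar>Nf\<bar> = \<bar>k\<^sup>2 + k * m * (2 * b' + b) + m\<^sup>2 * e\<bar>"
    by (metis abs_mult abs_power2)
  also have "\<dots> \<le> k\<^sup>2 + \<bar>k * m\<bar> * (2 * b' + b) + m\<^sup>2"
  proof -
    have "\<bar>k * m * (2 * b' + b)\<bar> = \<bar>k * m\<bar> * (2 * b' + b)" using b b' by (simp add: abs_mult)
    moreover have "\<bar>m\<^sup>2 * e\<bar> = m\<^sup>2" using e by (simp add: abs_mult)
    moreover have "\<bar>k\<^sup>2\<bar> = k\<^sup>2" by simp
    ultimately show ?thesis by linarith
  qed
  finally have 1: "b\<^sup>2 * \<bar>Nf\<bar> \<le> k\<^sup>2 + \<bar>k * m\<bar> * (2 * b' + b) + m\<^sup>2" .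
  have P1: "1 \<le> P" "\<bar>k\<bar> \<le> P" "\<bar>m\<bar> \<le> P" "\<bar>k * m\<bar> \<le> P"
  proof -
    have "1 * 1 \<le> max 1 \<bar>k\<bar> * max 1 \<bar>m\<bar>" by (intro mult_mono) auto
    then show "1 \<le> P" by (simp add: P_def)
    have "\<bar>k\<bar> * 1 \<le> max 1 \<bar>k\<bar> * max 1 \<bar>m\<bar>" by (intro mult_mono) auto
    then show "\<bar>k\<bar> \<le> P" by (simp add: P_def)
    have "1 * \<bar>m\<bar> \<le> max 1 \<bar>k\<bar> * max 1 \<bar>m\<bar>" by (intro mult_mono) auto
    then show "\<bar>m\<bar> \<le> P" by (simp add: P_def)
    show "\<bar>k * m\<bar> \<le> P" unfolding P_def abs_mult by (intro mult_mono) auto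
  qed
  have "b\<^sup>2 \<le> b\<^sup>2 * \<bar>Nf\<bar>" using mult_left_mono[OF N1, of "b\<^sup>2"] by simp
  also note 1
  also have "k\<^sup>2 + \<bar>k * m\<bar> * (2 * b' + b) + m\<^sup>2 \<le> P\<^sup>2 + P * (3 * b) + P\<^sup>2"
  proof -
    have "k\<^sup>2 \<le> P\<^sup>2" "m\<^sup>2 \<le> P\<^sup>2" using P1 by (auto simp: abs_le_square_iff[symmetric])
    moreover have "\<bar>k * m\<bar> * (2 * b' + b) \<le> P * (3 * b)" using P1 b b' by (intro mult_mono) auto
    ultimately show ?thesis by linarith
  qed
  finally have 2: "b\<^sup>2 \<le> 2 * P\<^sup>2 + 3 * (P * b)" by simp
  \<comment> \<open>With 6P < b the term 3Pb is at most b^2/2 and 2P^2 is at most b^2/18, which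
    together stay below b^2; this is where the constant 6 is fixed.\<close>
  have "6 * P * P \<le> b * P" "6 * P * b \<le> b * b" using lt P1 b by (auto intro!: mult_right_mono)
  then have "6 * P\<^sup>2 \<le> P * b" "6 * (P * b) \<le> b\<^sup>2" by (auto simp: power2_eq_square ac_simps)
  moreover have "0 < P\<^sup>2" using P1 by simp
  ultimately show False using 2 by linarith
qed

section \<open>Character sums over the Fibonacci nodes\<close>

definition fib_node :: "nat \<Rightarrow> nat \<Rightarrow> real \<times> real" where
  "fib_node n \<mu> = (real \<mu> / real (fib_b n), frac (real \<mu> * (real (fib_b (n - 1)) / real (fib_b n))))"

lemma fib_b_pos: "0 < fib_b n"
  using fib_neq_0_nat[of "Suc n"] by (simp add: fib_b_def)

text \<open>Characters do not see the fractional part, so the sum is geometric in a b_n-th root of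
  unity, and it is full or zero according to whether that root is 1.\<close>

lemma sum_fib_node_fchar:
  assumes n: "n \<ge> 1"
  shows "(\<Sum>\<mu><fib_b n. fchar k (fst (fib_node n \<mu>)) * fchar m (snd (fib_node n \<mu>))) =
    (if int (fib_b n) dvd k + m * int (fib n) then of_nat (fib_b n) else 0)"
proof -
  define b where "b = fib_b n"
  have b: "b > 0" by (simp add: b_def fib_b_pos)
  define s where "s = k + m * int (fib n)"
  define z where "z = cis (2 * pi * (of_int s / of_nat b))"
  have zp: "z ^ j = cis (real j * (2 * pi * (of_int s / of_nat b)))" for j
    unfolding z_def by (rule Complex.DeMoivre)
  have fp: "per (fchar m)" by (simp add: per_def)
  \<comment> \<open>Fails for n = 0, where the truncated n - 1 makes the left side 1 but
    \<open>fib 0 = 0\<close>.\<close>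
  have fb: "fib_b (n - 1) = fib n" using n by (cases n) (auto simp: fib_b_def)
  have "fchar k (fst (fib_node n \<mu>)) * fchar m (snd (fib_node n \<mu>)) = z ^ \<mu>" for \<mu>
  proof -
    have "fchar k (fst (fib_node n \<mu>)) * fchar m (snd (fib_node n \<mu>)) =
       fchar k (real \<mu> / real b) * fchar m (real \<mu> * (real (fib n) / real b))"
      unfolding fib_node_def fb by (simp add: b_def per_frac[OF fp])
    also have "\<dots> = z ^ \<mu>"
      unfolding fchar_def zp cis_mult using b
      by (intro arg_cong[where f = cis]) (simp add: s_def field_simps)
    finally show ?thesis .
  qed
  then have sum: "(\<Sum>\<mu><fib_b n. fchar k (fst (fib_node n \<mu>)) * fchar m (snd (fib_node n \<mu>))) = (\<Sum>\<mu><b. z ^ \<mu>)"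
    by (simp add: b_def)
  show ?thesis
  proof (cases "int b dvd s")
    case True
    then obtain q where "s = int b * q" by (auto elim: dvdE)
    then have "z = 1" using b by (simp add: z_def)
    then show ?thesis using True by (simp add: sum b_def s_def)
  next
    case False
    have "z \<noteq> 1"
    proof
      assume "z = 1"
      then have "cos (2 * pi * (of_int s / of_nat b)) = 1"
        by (simp add: z_def complex_eq_iff)
      then obtain q :: int where "2 * pi * (of_int s / real b) = of_int q * 2 * pi"
        unfolding cos_one_2pi_int by auto
      then have "(2 * pi) * (of_int s / real b) = (2 * pi) * of_int q"
        by (simp only: ac_simps)
      then have "of_int s / real b = real_of_int q"
        by (subst (asm) mult_cancel_left) simp
      then have "real_of_int s = real_of_int (int b * q)" using b by (simp add: field_simps)
      then have "s = int b * q" by (simp only: of_int_eq_iff)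
      then show False using False by simp
    qed
    moreover have "z ^ b = 1"
    proof -
      have "z ^ b = cis (2 * pi * of_int s)"
        unfolding zp using b by (simp add: field_simps)
      then show ?thesis by simp
    qed
    ultimately have "(\<Sum>\<mu><b. z ^ \<mu>) = 0"
      using geometric_sum[of z b] by simp
    then show ?thesis using False by (simp add: sum b_def s_def)
  qed
qed

text \<open>By linearity only characters matter, and \<open>fib_lattice\<close> keeps nonzero
  aliasing frequencies out of the degree box. Degree zero is a separate alternative because
  constants are integrated exactly even when b_n is too small for the inequality.\<close>

lemma fib_exact:
  assumes n: "n \<ge> 1" and t: "trig2 d d' t"
    and d: "d = 0 \<and> d' = 0 \<or> 6 * (max 1 d * max 1 d') < fib_b n"
  shows "(\<Sum>\<mu><fib_b n. t (fib_node n \<mu>)) = of_nat (fib_b n) * (LINT u|unif2. t u)"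
  using t
proof (induction rule: trig2.induct)
  case (fchar k m)
  have "int (fib_b n) dvd k + m * int (fib n) \<longleftrightarrow> k = 0 \<and> m = 0"
  proof
    assume dvd: "int (fib_b n) dvd k + m * int (fib n)"
    show "k = 0 \<and> m = 0"
    proof (rule ccontr)
      assume "\<not> (k = 0 \<and> m = 0)"
      then have le: "int (fib_b n) \<le> 6 * (max 1 \<bar>k\<bar> * max 1 \<bar>m\<bar>)"
        using dvd unfolding fib_b_def by (intro fib_lattice) auto
      have "max 1 \<bar>k\<bar> * max 1 \<bar>m\<bar> \<le> int (max 1 d) * int (max 1 d')"
        using fchar by (intro mult_mono) auto
      with le have "int (fib_b n) \<le> int (6 * (max 1 d * max 1 d'))"
        by simp
      then have "fib_b n \<le> 6 * (max 1 d * max 1 d')" by (simp only: of_nat_le_iff)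
      then have "d = 0 \<and> d' = 0" using d by linarith
      then show False using fchar \<open>\<not> (k = 0 \<and> m = 0)\<close> by simp
    qed
  qed simp
  then show ?case
    unfolding sum_fib_node_fchar[OF n] integral_unif2_fchar by simp
next
  case (add g h)
  then show ?case by (simp add: sum.distrib trig2_integrable distrib_left)
next
  case (scale g c)
  then show ?case by (simp add: sum_distrib_left[symmetric])
qed

section \<open>Fejer sums at the nodes and the error of one polynomial\<close>

lemma trig_reflect:
  assumes "trig d g"
  shows "trig d (\<lambda>u. g (c - u)) \<and> (LINT u|unif. g (c - u)) = (LINT u|unif. g u)"
  using assms
proof (induction rule: trig.induct)
  case (fchar k)
  have e: "fchar k (c - u) = fchar k c * fchar (- k) u" for u
    by (simp add: fchar_def cis_mult algebra_simps)
  have "trig d (\<lambda>u. fchar k (c - u))"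
    unfolding e using fchar by (intro trig.scale trig.fchar) auto
  moreover have "(LINT u|unif. fchar k (c - u)) = (LINT u|unif. fchar k u)"
    unfolding e by (simp add: integral_unif_fchar)
  ultimately show ?case ..
next
  case (add g h)
  have i: "integrable unif f" if "trig d f" for f
    using trig_bounded[OF that] trig_measurable[OF that] by (auto intro: integrable_unif_bounded)
  have "integrable unif (\<lambda>u. f (c - u))" if f: "trig d (\<lambda>u. f (c - u))" for f by (rule i[OF f])
  then show ?case using add i[of g] i[of h] by (auto intro: trig.add)
next
  case (scale g a)
  then show ?case by (auto intro: trig.scale)
qed

lemma trig_fejer: "trig (2 * (N - 1)) (\<lambda>u. complex_of_real (fejer N u))"
proof -
  have "(\<lambda>u. complex_of_real (fejer N u)) = (\<lambda>u. (1 / of_nat N) *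
      (cnj (dirichlet N u) * dirichlet N u + cnj (dirichlet N (u + 1 / (2 * real N))) * dirichlet N (u + 1 / (2 * real N))))"
    by (simp add: fejer_def complex_norm_square mult.commute[of "cnj _"] del: of_real_power)
  moreover have "trig (2 * (N - 1)) \<dots>"
    by (intro trig.scale trig.add trig_mono[OF trig_mult[OF trig_cnj[OF trig_dirichlet] trig_dirichlet]]
        trig_mono[OF trig_mult[OF trig_cnj[OF trig_shift[OF trig_dirichlet]] trig_shift[OF trig_dirichlet]]]) auto
  ultimately show ?thesis by simp
qed

lemma integral_fejer:
  assumes "N \<ge> 1"
  shows "(LINT u|unif. complex_of_real (fejer N u)) = 2"
proof -
  have "(LINT u|unif. fejer N u) = 2"
    by (subst integral_eq_nn_integral) (auto simp: nn_integral_fejer[OF assms])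
  then show ?thesis by (simp add: integral_complex_of_real)
qed

text \<open>The pairs of Fejer kernels are themselves in the range of exactness; this replaces counting nodes in boxes.\<close>

lemma sum_fejer_fib_node:
  assumes n: "n \<ge> 1" and N: "N1 \<ge> 1" "N2 \<ge> 1" and d: "N1 = 1 \<and> N2 = 1 \<or> 24 * (N1 * N2) < fib_b n"
  shows "(\<Sum>\<mu><fib_b n. fejer N1 (fst y - fst (fib_node n \<mu>)) * fejer N2 (snd y - snd (fib_node n \<mu>))) = 4 * real (fib_b n)"
proof -
  let ?g1 = "\<lambda>u. complex_of_real (fejer N1 (fst y - u))" and ?g2 = "\<lambda>u. complex_of_real (fejer N2 (snd y - u))"
  have g1: "trig (2 * (N1 - 1)) ?g1" "(LINT u|unif. ?g1 u) = 2"
    using trig_reflect[OF trig_fejer[of N1], of "fst y"] integral_fejer[OF N(1)] by auto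
  have g2: "trig (2 * (N2 - 1)) ?g2" "(LINT u|unif. ?g2 u) = 2"
    using trig_reflect[OF trig_fejer[of N2], of "snd y"] integral_fejer[OF N(2)] by auto
  have t: "trig2 (2 * (N1 - 1)) (2 * (N2 - 1)) (\<lambda>z. ?g1 (fst z) * ?g2 (snd z))"
    by (rule trig2_product[OF g1(1) g2(1)])
  \<comment> \<open>A Fejer kernel has degree below 2N, so the threshold 6 of the exactness
    condition becomes 6 * 2 * 2 = 24.\<close>
  have "max 1 (2 * (N1 - 1)) * max 1 (2 * (N2 - 1)) \<le> (2 * N1) * (2 * N2)"
    using N by (intro mult_mono) auto
  then have d': "2 * (N1 - 1) = 0 \<and> 2 * (N2 - 1) = 0 \<or> 6 * (max 1 (2 * (N1 - 1)) * max 1 (2 * (N2 - 1))) < fib_b n"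
    using d by auto
  have "complex_of_real (\<Sum>\<mu><fib_b n. fejer N1 (fst y - fst (fib_node n \<mu>)) * fejer N2 (snd y - snd (fib_node n \<mu>))) =
     of_nat (fib_b n) * (LINT u|unif2. ?g1 (fst u) * ?g2 (snd u))"
    using fib_exact[OF n t d'] by simp
  also have "(LINT u|unif2. ?g1 (fst u) * ?g2 (snd u)) = 2 * 2"
    using integral_unif2_product[of ?g1 ?g2] trig2_integrable[OF t] g1(2) g2(2) by simp
  finally have "complex_of_real (\<Sum>\<mu><fib_b n. fejer N1 (fst y - fst (fib_node n \<mu>)) * fejer N2 (snd y - snd (fib_node n \<mu>))) =
    complex_of_real (4 * real (fib_b n))" by simp
  then show ?thesis by (simp only: of_real_eq_iff)
qed

definition fib_err :: "nat \<Rightarrow> (real \<times> real \<Rightarrow> complex) \<Rightarrow> complex" where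
  "fib_err n t = (1 / of_nat (fib_b n)) * (\<Sum>\<mu><fib_b n. t (fib_node n \<mu>)) - (LINT u|unif2. t u)"

lemma fib_err_exact:
  assumes "n \<ge> 1" "trig2 d d' t" "d = 0 \<and> d' = 0 \<or> 6 * (max 1 d * max 1 d') < fib_b n"
  shows "fib_err n t = 0"
  using fib_exact[OF assms] fib_b_pos[of n] by (simp add: fib_err_def)

definition cE :: "real \<Rightarrow> nat \<Rightarrow> real" where
  "cE p R = 4 powr p * (cT p R * 1600 + 1)"

text \<open>The rule and the integral are estimated separately; no cancellation between them is
  used, since at this level they are of comparable size. The loss 2^(a + b - m) measures by how much
  the polynomial exceeds the resolution m of the nodes.\<close>

lemma fib_err_bound:
  assumes n: "n \<ge> 1" and t: "trig2 (R * 2 ^ a) (R * 2 ^ b) t" and p: "1 \<le> p"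
    and m: "m \<le> a + b" "m = 0 \<or> 24 * 2 ^ m < fib_b n"
  shows "ennreal (cmod (fib_err n t) powr p) \<le> ennreal (cE p R * 2 ^ (a + b - m)) * Npow p t"
proof -
  define B where "B = fib_b n"
  have B: "B > 0" by (simp add: B_def fib_b_pos)
  have p0: "0 \<le> p" using p by simp
  have tm [measurable]: "t \<in> borel_measurable borel" by (rule trig2_measurable[OF t])
  \<comment> \<open>Distributes the resolution m over the two variables without exceeding a or b, so
    that the coarse Fejer kernels have total level exactly m and are summed exactly by the
    rule.\<close>
  define a' where "a' = min a m"
  define b' where "b' = m - a'"
  have ab: "a' \<le> a" "b' \<le> b" "a' + b' = m" using m(1) by (auto simp: a'_def b'_def)
  have d: "2 ^ a' = (1::nat) \<and> 2 ^ b' = (1::nat) \<or> 24 * (2 ^ a' * 2 ^ b') < fib_b n"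
    using m(2) ab by (auto simp: power_add[symmetric])
  have S: "(\<Sum>\<mu><B. ennreal (cmod (t (fib_node n \<mu>)) powr p)) \<le>
      ennreal (cT p R * 1600 * ((real (2 ^ a) / real (2 ^ a')) * (real (2 ^ b) / real (2 ^ b'))) * real B) * Npow p t"
    by (rule trig2_sample[OF t]) (use ab p sum_fejer_fib_node[OF n _ _ d] in \<open>auto simp: B_def power_increasing\<close>)
  have pw: "(real (2 ^ a) / real (2 ^ a')) * (real (2 ^ b) / real (2 ^ b')) = 2 ^ (a + b - m)"
  proof -
    have "(real (2 ^ a) / real (2 ^ a')) * (real (2 ^ b) / real (2 ^ b')) = 2 ^ (a + b) / 2 ^ m"
      by (simp add: power_add ab(3)[symmetric])
    also have "\<dots> = 2 ^ (a + b - m)" using m(1) by (simp add: power_diff)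
    finally show ?thesis .
  qed
  define s where "s = (\<Sum>\<mu><B. (1 / real B) * cmod (t (fib_node n \<mu>)))"
  have s0: "0 \<le> s" unfolding s_def by (intro sum_nonneg) auto
  have "ennreal (s powr p) \<le> ennreal ((1 + 1) powr p) *
      (\<integral>\<^sup>+\<mu>. ennreal ((1 / real B) * cmod (t (fib_node n \<mu>)) powr p) \<partial>count_space {..<B})"
  proof (rule nn_jensen)
    show "(\<integral>\<^sup>+x. ennreal (1 / real B) \<partial>count_space {..<B}) \<le> ennreal 1"
      using B by (simp add: nn_integral_count_space_finite ennreal_of_nat_eq_real_of_nat ennreal_mult[symmetric])
    show "ennreal s \<le> (\<integral>\<^sup>+x. ennreal ((1 / real B) * cmod (t (fib_node n x))) \<partial>count_space {..<B})"
      unfolding s_def by (subst nn_integral_count_space_finite) (auto simp: sum_ennreal)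
  qed (use p s0 in auto)
  also have "(\<integral>\<^sup>+\<mu>. ennreal ((1 / real B) * cmod (t (fib_node n \<mu>)) powr p) \<partial>count_space {..<B}) =
     ennreal (1 / real B) * (\<Sum>\<mu><B. ennreal (cmod (t (fib_node n \<mu>)) powr p))"
    by (subst nn_integral_count_space_finite) (simp_all add: sum_distrib_left ennreal_mult'[symmetric])
  also have "ennreal ((1 + 1) powr p) * \<dots> \<le> ennreal ((1 + 1) powr p) * (ennreal (1 / real B) *
     (ennreal (cT p R * 1600 * 2 ^ (a + b - m) * real B) * Npow p t))"
    using S unfolding pw by (intro mult_left_mono) auto
  also have "\<dots> = ennreal (2 powr p * (cT p R * 1600 * 2 ^ (a + b - m))) * Npow p t"
    using B cT_nonneg[of p R] by (simp add: mult.assoc[symmetric] ennreal_mult'[symmetric])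
  finally have s1: "ennreal (s powr p) \<le> ennreal (2 powr p * (cT p R * 1600 * 2 ^ (a + b - m))) * Npow p t" .
  have s2: "ennreal (cmod (LINT u|unif2. t u) powr p) \<le> ennreal (2 powr p * 2 ^ (a + b - m)) * Npow p t"
  proof -
    have "ennreal (cmod (LINT u|unif2. 1 * t u) powr p) \<le> ennreal ((1 + 1) powr p) *
       (\<integral>\<^sup>+u. ennreal (cmod 1 * cmod (t u) powr p) \<partial>unif2)"
      by (rule norm_integral_powr_le) (use p unif2.emeasure_space_1 in \<open>auto simp: space_pair_measure\<close>)
    also have "\<dots> = ennreal (2 powr p) * Npow p t" by (simp add: Npow_def)
    also have "\<dots> \<le> ennreal (2 powr p * 2 ^ (a + b - m)) * Npow p t"
      by (intro mult_right_mono ennreal_leI) auto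
    finally show ?thesis by simp
  qed
  have "cmod (fib_err n t) \<le> s + cmod (LINT u|unif2. t u)"
  proof -
    have "cmod (fib_err n t) \<le> cmod ((1 / of_nat B) * (\<Sum>\<mu><B. t (fib_node n \<mu>))) + cmod (LINT u|unif2. t u)"
      unfolding fib_err_def B_def[symmetric] by (rule norm_triangle_ineq4)
    also have "cmod ((1 / of_nat B) * (\<Sum>\<mu><B. t (fib_node n \<mu>))) \<le> s"
      unfolding s_def sum_distrib_left[symmetric] norm_mult
      by (intro mult_mono norm_sum) (auto simp: norm_divide)
    finally show ?thesis by simp
  qed
  then have "cmod (fib_err n t) powr p \<le> (s + cmod (LINT u|unif2. t u)) powr p"
    using p0 by (intro powr_mono2) auto
  also have "\<dots> \<le> 2 powr p * (s powr p + cmod (LINT u|unif2. t u) powr p)"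
    by (intro powr_add_le s0 p0) auto
  finally have "ennreal (cmod (fib_err n t) powr p) \<le> ennreal (2 powr p) * (ennreal (s powr p) + ennreal (cmod (LINT u|unif2. t u) powr p))"
    by (simp add: ennreal_mult[symmetric] ennreal_plus[symmetric] ennreal_leI del: ennreal_plus)
  also have "\<dots> \<le> ennreal (2 powr p) * (ennreal (2 powr p * (cT p R * 1600 * 2 ^ (a + b - m))) * Npow p t +
      ennreal (2 powr p * 2 ^ (a + b - m)) * Npow p t)"
    by (intro mult_left_mono add_mono s1 s2) auto
  also have "\<dots> = ennreal (2 powr p * (2 powr p * (cT p R * 1600 * 2 ^ (a + b - m)) + 2 powr p * 2 ^ (a + b - m))) * Npow p t"
    using cT_nonneg[of p R] by (simp add: ennreal_mult ennreal_plus distrib_right mult.assoc)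
  also have "2 powr p * (2 powr p * (cT p R * 1600 * 2 ^ (a + b - m)) + 2 powr p * 2 ^ (a + b - m)) = cE p R * 2 ^ (a + b - m)"
    using powr_mult[of 2 2 p] by (simp add: cE_def algebra_simps)
  finally show ?thesis .
qed

section \<open>The block decomposition\<close>

text \<open>One kernel per scale is fixed by choice; telescoping needs the same kernel in two
  consecutive differences.\<close>

definition jackson :: "nat \<Rightarrow> nat \<Rightarrow> real \<Rightarrow> complex" where
  "jackson r a = (SOME J. trig (2 * r * 2 ^ a) J \<and> decays r (3 * 8 ^ r) (2 ^ a) J \<and> (LINT u|unif. J u) = 1)"

definition jdiff :: "nat \<Rightarrow> nat \<Rightarrow> real \<Rightarrow> complex" where
  "jdiff r a = (if a = 0 then jackson r 0 else (\<lambda>u. jackson r a u + (-1) * jackson r (a - 1) u))"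

lemma jackson: "trig (2 * r * 2 ^ a) (jackson r a)" "decays r (3 * 8 ^ r) (2 ^ a) (jackson r a)" "(LINT u|unif. jackson r a u) = 1"
proof -
  have "\<exists>J. trig (2 * r * 2 ^ a) J \<and> decays r (3 * 8 ^ r) (2 ^ a) J \<and> (LINT u|unif. J u) = 1"
    using jackson_kernel[of "2 ^ a" r] by auto
  then have "trig (2 * r * 2 ^ a) (jackson r a) \<and> decays r (3 * 8 ^ r) (2 ^ a) (jackson r a) \<and> (LINT u|unif. jackson r a u) = 1"
    unfolding jackson_def by (rule someI_ex)
  then show "trig (2 * r * 2 ^ a) (jackson r a)" "decays r (3 * 8 ^ r) (2 ^ a) (jackson r a)" "(LINT u|unif. jackson r a u) = 1"
    by auto
qed

lemma trig_integrable: "trig d g \<Longrightarrow> integrable unif g"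
  using trig_bounded[of d g] trig_measurable[of d g] by (auto intro: integrable_unif_bounded)

lemma trig_jdiff: "trig (2 * r * 2 ^ a) (jdiff r a)"
proof (cases a)
  case 0
  then show ?thesis using jackson(1)[of r 0] by (simp add: jdiff_def)
next
  case (Suc b)
  have "trig (2 * r * 2 ^ a) (jackson r b)" by (rule trig_mono[OF jackson(1)]) (simp add: Suc)
  then have "trig (2 * r * 2 ^ a) (\<lambda>u. jackson r a u + (-1) * jackson r b u)"
    by (intro trig.add trig.scale jackson(1))
  then show ?thesis by (simp add: jdiff_def Suc)
qed

lemma integral_jdiff: "(LINT u|unif. jdiff r a u) = (if a = 0 then 1 else 0)"
  using trig_integrable[OF jackson(1)] by (auto simp: jdiff_def jackson)

text \<open>Twice the scale makes the decay weight at most 4 times as large; hence 4^r for the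
  coarser of the two kernels in \<open>jdiff\<close>, measured at the finer scale.\<close>

definition cK :: "nat \<Rightarrow> real" where
  "cK r = 3 * 8 ^ r * (1 + 4 ^ r)"

lemma decays_mono: "decays r C N A \<Longrightarrow> C \<le> C' \<Longrightarrow> decays r C' N A"
  unfolding decays_def by (meson mult_right_mono of_nat_0_le_iff order_trans)

lemma decays_jackson: "decays r (cK r) (2 ^ a) (jackson r a)"
  by (rule decays_mono[OF jackson(2)]) (simp add: cK_def)

lemma decays_jdiff: "decays r (cK r) (2 ^ a) (jdiff r a)"
proof (cases a)
  case 0
  then show ?thesis using decays_jackson[of r 0] by (simp add: jdiff_def)
next
  case (Suc b)
  show ?thesis
    unfolding decays_def
  proof (intro allI impI)
    fix u :: real assume u: "\<bar>u\<bar> \<le> 1/2"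
    let ?w = "1 + (real (2 ^ a) * u)\<^sup>2" and ?w' = "1 + (real (2 ^ b) * u)\<^sup>2"
    have 1: "cmod (jackson r a u) * ?w ^ r \<le> 3 * 8 ^ r * real (2 ^ a)"
      using jackson(2)[of r a] u by (auto simp: decays_def)
    have "?w \<le> 4 * ?w'" by (simp add: Suc power_mult_distrib)
    then have "?w ^ r \<le> (4 * ?w') ^ r" by (intro power_mono) auto
    then have "cmod (jackson r b u) * ?w ^ r \<le> cmod (jackson r b u) * (4 ^ r * ?w' ^ r)"
      unfolding power_mult_distrib[of 4] by (intro mult_left_mono) auto
    also have "\<dots> = 4 ^ r * (cmod (jackson r b u) * ?w' ^ r)" by simp
    also have "\<dots> \<le> 4 ^ r * (3 * 8 ^ r * real (2 ^ b))"
      using jackson(2)[of r b] u by (intro mult_left_mono) (auto simp: decays_def)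
    also have "\<dots> \<le> 4 ^ r * (3 * 8 ^ r * real (2 ^ a))" by (simp add: Suc)
    finally have 2: "cmod (jackson r b u) * ?w ^ r \<le> 4 ^ r * (3 * 8 ^ r * real (2 ^ a))" .
    have "cmod (jdiff r a u) * ?w ^ r \<le> (cmod (jackson r a u) + cmod (jackson r b u)) * ?w ^ r"
      unfolding jdiff_def by (intro mult_right_mono) (auto simp: Suc norm_triangle_ineq4)
    also have "\<dots> \<le> 3 * 8 ^ r * real (2 ^ a) + 4 ^ r * (3 * 8 ^ r * real (2 ^ a))"
      using 1 2 by (simp add: distrib_right)
    also have "\<dots> = cK r * real (2 ^ a)" by (simp add: cK_def algebra_simps)
    finally show "cmod (jdiff r a u) * ?w ^ r \<le> cK r * real (2 ^ a)" .
  qed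
qed

lemma sum_jdiff: "(\<Sum>a\<le>S. jdiff r a u) = jackson r S u"
  by (induction S) (auto simp: jdiff_def)

lemma sum_level_pairs:
  fixes f :: "nat \<times> nat \<Rightarrow> 'a :: comm_monoid_add"
  assumes "finite I"
  shows "(\<Sum>x | fst x + snd x \<in> I. f x) = (\<Sum>M\<in>I. \<Sum>a\<le>M. f (a, M - a))"
proof -
  have "(\<Sum>M\<in>I. \<Sum>a\<le>M. f (a, M - a)) = (\<Sum>(M, a)\<in>(SIGMA M:I. {..M}). f (a, M - a))"
    using assms by (intro sum.Sigma) auto
  also have "\<dots> = (\<Sum>x | fst x + snd x \<in> I. f x)"
    by (rule sum.reindex_bij_witness[where i = "\<lambda>x. (fst x + snd x, fst x)" and j = "\<lambda>x. (snd x, fst x - snd x)"]) auto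
  finally show ?thesis by simp
qed

lemma finite_level_pairs: "finite I \<Longrightarrow> finite {x :: nat \<times> nat. fst x + snd x \<in> I}"
proof -
  assume "finite I"
  then have "finite ((\<lambda>(M, a). (a, M - a)) ` (SIGMA M:I. {..M}))" by simp
  moreover have "{x :: nat \<times> nat. fst x + snd x \<in> I} \<subseteq> (\<lambda>(M, a). (a, M - a)) ` (SIGMA M:I. {..M})"
  proof
    fix x :: "nat \<times> nat" assume "x \<in> {x. fst x + snd x \<in> I}"
    then show "x \<in> (\<lambda>(M, a). (a, M - a)) ` (SIGMA M:I. {..M})"
      by (intro image_eqI[where x = "(fst x + snd x, fst x)"]) auto
  qed
  ultimately show ?thesis by (rule finite_subset[rotated])
qed

lemma powr_inverse_le:
  assumes p: "1 \<le> p" and x: "0 \<le> x" and c: "0 \<le> c" and y: "0 \<le> y"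
    and le: "ennreal (x powr p) \<le> ennreal (c * y powr p)"
  shows "x \<le> c powr (1 / p) * y"
proof -
  have "x powr p \<le> c * y powr p" using le c by (simp add: ennreal_le_iff)
  then have "(x powr p) powr (1 / p) \<le> (c * y powr p) powr (1 / p)"
    using p by (intro powr_mono2) auto
  then show ?thesis using p x c y by (simp add: powr_mult powr_powr)
qed

section \<open>Sizes of the blocks and of the levels\<close>

definition cB :: "real \<Rightarrow> nat \<Rightarrow> real" where
  "cB p q = 2 powr p * (3 * (4 powr p * cJ p q (cK (Suc q))) + 1)"

lemma cK_nonneg: "0 \<le> cK r"
  by (simp add: cK_def)

lemma cJ_nonneg: "0 \<le> C \<Longrightarrow> 0 \<le> cJ p q C"
  by (simp add: cJ_def)

text \<open>Isolates what the error estimate takes from the function: bounds \<open>y12\<close>,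
  \<open>y1\<close>, \<open>y2\<close> for its moduli at dyadic steps and the decay of their level
  sums, with \<tau> as the exponent of the logarithm. The final constant \<open>cF\<close> depends
  on p, q, \<alpha> and K alone, so it is the same for all functions of the unit ball.\<close>

locale sampled_function =
  fixes p :: real and l q :: nat and F :: "real \<times> real \<Rightarrow> complex"
    and y12 :: "nat \<Rightarrow> nat \<Rightarrow> real" and y1 y2 :: "nat \<Rightarrow> real" and \<alpha> \<tau> K :: real
  assumes p: "1 \<le> p" and q: "kappa p l \<le> 4 ^ q" and F: "permeas F" and NF: "Npow p F \<le> 1"
    and y0: "\<And>a b. 0 \<le> y12 a b" "\<And>a. 0 \<le> y1 a" "\<And>b. 0 \<le> y2 b"
    and H12: "\<And>a b h k. \<bar>h\<bar> < 1 / (2 * 2 ^ a) \<Longrightarrow> \<bar>k\<bar> < 1 / (2 * 2 ^ b) \<Longrightarrow>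
      Npow p (ldiff l (h, 0) (ldiff l (0, k) F)) \<le> ennreal (y12 a b powr p)"
    and H1: "\<And>a h. \<bar>h\<bar> < 1 / (2 * 2 ^ a) \<Longrightarrow> Npow p (ldiff l (h, 0) F) \<le> ennreal (y1 a powr p)"
    and H2: "\<And>b k. \<bar>k\<bar> < 1 / (2 * 2 ^ b) \<Longrightarrow> Npow p (ldiff l (0, k) F) \<le> ennreal (y2 b powr p)"
    and \<alpha>: "1 / p < \<alpha>" and \<tau>: "0 \<le> \<tau>" "\<tau> \<le> 1" and K: "1 \<le> K"
    and Y1: "\<And>a. y1 a \<le> K * 2 powr (- \<alpha> * real a)" and Y2: "\<And>b. y2 b \<le> K * 2 powr (- \<alpha> * real b)"
    and Y12: "\<And>M. (\<Sum>a\<le>M. y12 a (M - a)) \<le> K * 2 powr (- \<alpha> * real M) * real (M + 1) powr \<tau>"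
begin

abbreviation "R \<equiv> 2 * Suc q"

definition blk :: "nat \<Rightarrow> nat \<Rightarrow> real \<times> real \<Rightarrow> complex" where
  "blk a b = block l (jdiff (Suc q) a) (jdiff (Suc q) b) F"

text \<open>The first-variable modulus enters at b = 0 and the second-variable modulus at a = 0,
  since \<open>jdiff\<close> has nonzero mean only at index 0. The 1 at the corner accounts for the
  norm of F itself.\<close>

definition yy :: "nat \<Rightarrow> nat \<Rightarrow> real" where
  "yy a b = y12 a b + (if b = 0 then y1 a else 0) + (if a = 0 then y2 b else 0) + (if a = 0 \<and> b = 0 then 1 else 0)"

lemma yy_nonneg: "0 \<le> yy a b"
  using y0 by (simp add: yy_def)

lemma F_measurable [measurable]: "F \<in> borel_measurable borel"
  by (rule permeas_measurable[OF F])

lemma NF_fin: "Npow p F < \<infinity>"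
  using NF by (auto intro: le_less_trans)

lemma F_integrable: "(\<integral>\<^sup>+z. ennreal (cmod (F z)) \<partial>unif2) < \<infinity>"
proof -
  have "(\<integral>\<^sup>+z. ennreal (cmod (F z)) \<partial>unif2) \<le> 1 + Npow p F" by (rule nn_integral_le_Npow[OF F_measurable p])
  also have "\<dots> < \<infinity>" using NF_fin by simp
  finally show ?thesis .
qed

lemma trig2_blk: "trig2 (R * 2 ^ a) (R * 2 ^ b) (blk a b)"
  unfolding blk_def by (rule trig2_block[OF F F_integrable trig_jdiff trig_jdiff])

lemma blk_measurable [measurable]: "blk a b \<in> borel_measurable borel"
  by (rule trig2_measurable[OF trig2_blk])

lemma Npow_blk: "Npow p (blk a b) \<le> ennreal (cB p q * yy a b powr p)"
proof -
  define c where "c = 4 powr p * cJ p q (cK (Suc q))"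
  have c: "0 \<le> c" by (simp add: c_def cJ_nonneg cK_nonneg)
  have cBc: "cB p q = 2 powr p * (3 * c + 1)" by (simp only: cB_def c_def)
  have p0: "0 \<le> p" using p by simp
  let ?w1 = "if b = 0 then y1 a else 0" and ?w2 = "if a = 0 then y2 b else 0"
  have "Npow p (\<lambda>z. blk a b z - (LINT u|unif. jdiff (Suc q) a u) * (LINT u|unif. jdiff (Suc q) b u) * F z) \<le>
    ennreal (4 powr p * cJ p q (cK (Suc q)) * (y12 a b powr p + (if (LINT u|unif. jdiff (Suc q) b u) = 0 then 0 else y1 a powr p)
      + (if (LINT u|unif. jdiff (Suc q) a u) = 0 then 0 else y2 b powr p)))"
    unfolding blk_def
    by (rule jackson_estimate[OF F p NF_fin q _ _ trig_jdiff decays_jdiff trig_jdiff decays_jdiff]) (use H12 H1 H2 in auto)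
  also have "4 powr p * cJ p q (cK (Suc q)) * (y12 a b powr p + (if (LINT u|unif. jdiff (Suc q) b u) = 0 then 0 else y1 a powr p)
      + (if (LINT u|unif. jdiff (Suc q) a u) = 0 then 0 else y2 b powr p)) \<le> c * (3 * yy a b powr p)"
  proof -
    have "y12 a b powr p \<le> yy a b powr p" "?w1 powr p \<le> yy a b powr p" "?w2 powr p \<le> yy a b powr p"
      using y0 p0 by (auto simp: yy_def intro!: powr_mono2)
    moreover define Z where "Z = yy a b powr p"
    moreover have "0 \<le> Z" by (simp add: Z_def)
    ultimately have "y12 a b powr p + (if (LINT u|unif. jdiff (Suc q) b u) = 0 then 0 else y1 a powr p)
      + (if (LINT u|unif. jdiff (Suc q) a u) = 0 then 0 else y2 b powr p) \<le> 3 * yy a b powr p"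
      unfolding integral_jdiff Z_def[symmetric] by (auto split: if_splits)
    then show ?thesis unfolding c_def[symmetric] by (intro mult_left_mono c)
  qed
  finally have 1: "Npow p (\<lambda>z. blk a b z - (LINT u|unif. jdiff (Suc q) a u) * (LINT u|unif. jdiff (Suc q) b u) * F z) \<le>
    ennreal (c * (3 * yy a b powr p))" by (simp add: ennreal_leI)
  show ?thesis
  proof (cases "a = 0 \<and> b = 0")
    case False
    then have "Npow p (blk a b) \<le> ennreal (c * (3 * yy a b powr p))" using 1 by (auto simp: integral_jdiff)
    also have "\<dots> \<le> ennreal (cB p q * yy a b powr p)"
    proof (intro ennreal_leI)
      have "1 * (c * 3) \<le> 2 powr p * (3 * c + 1)"
        using c p0 by (intro mult_mono ge_one_powr_ge_zero) auto
      then have "c * 3 * yy a b powr p \<le> cB p q * yy a b powr p"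
        unfolding cBc by (intro mult_right_mono) auto
      then show "c * (3 * yy a b powr p) \<le> cB p q * yy a b powr p" by (simp add: mult.assoc)
    qed
    finally show ?thesis .
  next
    case True
    \<comment> \<open>At the corner the Jackson estimate controls the block minus F, so F has to be
      added back; its norm is at most 1 and is covered by the extra 1 in \<open>yy\<close>.\<close>
    have "yy a b \<ge> 1" using True y0 by (simp add: yy_def)
    then have y1: "1 \<le> yy a b powr p" using p0 by (rule ge_one_powr_ge_zero)
    have 2: "Npow p (\<lambda>z. blk a b z - F z) \<le> ennreal (c * (3 * yy a b powr p))" using 1 True by (simp add: integral_jdiff)
    have "Npow p (blk a b) = Npow p (\<lambda>z. (blk a b z - F z) + F z)" by simp
    also have "\<dots> \<le> ennreal (2 powr p) * (Npow p (\<lambda>z. blk a b z - F z) + Npow p F)"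
      by (intro Npow_add p0) measurable
    also have "\<dots> \<le> ennreal (2 powr p) * (ennreal (c * (3 * yy a b powr p)) + ennreal (yy a b powr p))"
    proof (intro mult_left_mono add_mono 2)
      have "1 \<le> ennreal (yy a b powr p)" using y1 by simp
      with NF show "Npow p F \<le> ennreal (yy a b powr p)" by (rule order_trans)
    qed auto
    also have "\<dots> = ennreal (cB p q * yy a b powr p)"
      using c by (simp add: ennreal_plus[symmetric] ennreal_mult[symmetric] cBc algebra_simps del: ennreal_plus)
    finally show ?thesis .
  qed
qed

lemma cB_nonneg: "0 \<le> cB p q"
  by (simp add: cB_def cJ_nonneg cK_nonneg)

definition cS :: real where "cS = (cT p R * cB p q) powr (1 / p)"
definition cD :: real where "cD = (cE p R * cB p q) powr (1 / p)"

lemma blk_sup: "cmod (blk a b z) \<le> cS * 2 powr (real (a + b) / p) * yy a b"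
proof -
  have "ennreal (cmod (blk a b z) powr p) \<le> ennreal (cT p R * (real (2 ^ a) * real (2 ^ b))) * Npow p (blk a b)"
    by (rule trig2_point_sup[OF trig2_blk _ _ p]) auto
  also have "\<dots> \<le> ennreal (cT p R * (real (2 ^ a) * real (2 ^ b))) * ennreal (cB p q * yy a b powr p)"
    by (intro mult_left_mono Npow_blk) auto
  also have "\<dots> = ennreal (cT p R * cB p q * 2 ^ (a + b) * yy a b powr p)"
    using cT_nonneg[of p R] cB_nonneg by (simp add: ennreal_mult[symmetric] power_add ac_simps)
  finally have "cmod (blk a b z) \<le> (cT p R * cB p q * 2 ^ (a + b)) powr (1 / p) * yy a b"
    using p yy_nonneg cT_nonneg cB_nonneg by (intro powr_inverse_le) auto
  also have "(cT p R * cB p q * 2 ^ (a + b)) powr (1 / p) = cS * 2 powr (real (a + b) / p)"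
    using cT_nonneg[of p R] cB_nonneg by (simp add: powr_mult cS_def powr_realpow[symmetric] powr_powr)
  finally show ?thesis .
qed

lemma blk_fib_err:
  assumes n: "n \<ge> 1" and m: "m \<le> a + b" "m = 0 \<or> 24 * 2 ^ m < fib_b n"
  shows "cmod (fib_err n (blk a b)) \<le> cD * 2 powr (real (a + b - m) / p) * yy a b"
proof -
  have c0: "0 \<le> cE p R" using cT_nonneg[of p R] by (simp add: cE_def)
  have "ennreal (cmod (fib_err n (blk a b)) powr p) \<le> ennreal (cE p R * 2 ^ (a + b - m)) * Npow p (blk a b)"
    by (rule fib_err_bound[OF n trig2_blk p m])
  also have "\<dots> \<le> ennreal (cE p R * 2 ^ (a + b - m)) * ennreal (cB p q * yy a b powr p)"
    by (intro mult_left_mono Npow_blk) auto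
  also have "\<dots> = ennreal (cE p R * cB p q * 2 ^ (a + b - m) * yy a b powr p)"
    using c0 cB_nonneg by (simp add: ennreal_mult[symmetric] ac_simps)
  finally have "cmod (fib_err n (blk a b)) \<le> (cE p R * cB p q * 2 ^ (a + b - m)) powr (1 / p) * yy a b"
    using p yy_nonneg c0 cB_nonneg by (intro powr_inverse_le) auto
  also have "(cE p R * cB p q * 2 ^ (a + b - m)) powr (1 / p) = cD * 2 powr (real (a + b - m) / p)"
    using c0 cB_nonneg by (simp add: powr_mult cD_def powr_realpow[symmetric] powr_powr)
  finally show ?thesis .
qed

text \<open>The one-variable terms occur once on each level and the 1 only on level 0, so they are
  absorbed into the bound for \<open>y12\<close> because K and the power of M + 1 are at least
  1.\<close>

lemma level_sum: "(\<Sum>a\<le>M. yy a (M - a)) \<le> 4 * K * 2 powr (- \<alpha> * real M) * real (M + 1) powr \<tau>"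
proof -
  define E where "E = 2 powr (- \<alpha> * real M)"
  define T where "T = real (M + 1) powr \<tau>"
  have E: "E > 0" by (simp add: E_def)
  have T: "1 \<le> T" unfolding T_def using \<tau> by (intro ge_one_powr_ge_zero) auto
  have KE: "K * E \<le> K * E * T" using mult_left_mono[OF T, of "K * E"] K E by simp
  have "(\<Sum>a\<le>M. yy a (M - a)) = (\<Sum>a\<le>M. y12 a (M - a)) + (\<Sum>a\<le>M. if a = M then y1 a else 0)
     + (\<Sum>a\<le>M. if a = 0 then y2 M else 0) + (\<Sum>a\<le>M. if a = 0 then (if M = 0 then 1 else 0) else 0)"
    unfolding sum.distrib[symmetric] yy_def by (intro sum.cong refl) auto
  also have "\<dots> = (\<Sum>a\<le>M. y12 a (M - a)) + y1 M + y2 M + (if M = 0 then 1 else 0)"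
    by simp
  also have "\<dots> \<le> K * E * T + K * E + K * E + K * E"
  proof (intro add_mono)
    show "(if M = 0 then 1 else 0) \<le> K * E" using K E by (auto simp: E_def)
  qed (use Y12[of M] Y1[of M] Y2[of M] in \<open>auto simp: E_def T_def\<close>)
  also have "\<dots> \<le> 4 * (K * E * T)" using KE by linarith
  finally show ?thesis by (simp add: E_def T_def)
qed

text \<open>Net factor per level: the loss 2^(1/p) of point evaluation against the gain
  2^(-\<alpha>). That it is below 1 is exactly \<alpha> > 1/p.\<close>

definition \<rho> :: real where "\<rho> = 2 powr (1 / p - \<alpha>)"

lemma \<rho>: "0 < \<rho>" "\<rho> < 1"
  using \<alpha> by (auto simp: \<rho>_def powr_less_one)

lemma summable_rho: "summable (\<lambda>k. real (k + 1) * \<rho> ^ k)"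
  using geometric_deriv_sums[of \<rho>] \<rho> by (simp add: sums_iff)

text \<open>Weierstrass majorant of a level. The power \<tau> is replaced by 1, which is harmless
  since here only summability counts.\<close>

definition bnd :: "nat \<Rightarrow> real" where
  "bnd M = cS * (4 * K) * (real (M + 1) * \<rho> ^ M)"

lemma rho_level: "2 powr (real M / p) * 2 powr (- \<alpha> * real M) = \<rho> ^ M"
proof -
  have "2 powr (real M / p) * 2 powr (- \<alpha> * real M) = 2 powr ((1 / p - \<alpha>) * real M)"
    unfolding powr_add[symmetric] by (simp add: algebra_simps)
  also have "\<dots> = \<rho> ^ M" unfolding \<rho>_def by (simp add: powr_powr[symmetric] powr_realpow)
  finally show ?thesis .
qed

lemma log_exp_le: "real (k + 1) powr \<tau> \<le> real (k + 1)"
  using powr_mono[of \<tau> 1 "real (k + 1)"] \<tau> by simp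

lemma cS_nonneg: "0 \<le> cS" and cD_nonneg: "0 \<le> cD"
  by (simp_all add: cS_def cD_def)

lemma level_sup: "(\<Sum>a\<le>M. cmod (blk a (M - a) z)) \<le> bnd M"
proof -
  have "(\<Sum>a\<le>M. cmod (blk a (M - a) z)) \<le> (\<Sum>a\<le>M. cS * 2 powr (real M / p) * yy a (M - a))"
  proof (rule sum_mono)
    fix a assume "a \<in> {..M}"
    then show "cmod (blk a (M - a) z) \<le> cS * 2 powr (real M / p) * yy a (M - a)"
      using blk_sup[of a "M - a" z] by simp
  qed
  also have "\<dots> = cS * 2 powr (real M / p) * (\<Sum>a\<le>M. yy a (M - a))"
    by (simp add: sum_distrib_left)
  also have "\<dots> \<le> cS * 2 powr (real M / p) * (4 * K * 2 powr (- \<alpha> * real M) * real (M + 1))"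
  proof (rule mult_left_mono)
    have "4 * K * 2 powr (- \<alpha> * real M) * real (M + 1) powr \<tau> \<le> 4 * K * 2 powr (- \<alpha> * real M) * real (M + 1)"
      using K by (intro mult_left_mono log_exp_le) auto
    then show "(\<Sum>a\<le>M. yy a (M - a)) \<le> 4 * K * 2 powr (- \<alpha> * real M) * real (M + 1)"
      using level_sum[of M] by linarith
  qed (simp add: cS_nonneg)
  also have "\<dots> = cS * (4 * K) * (real (M + 1) * (2 powr (real M / p) * 2 powr (- \<alpha> * real M)))"
    by (simp only: ac_simps)
  also have "\<dots> = bnd M" unfolding rho_level bnd_def ..
  finally show ?thesis .
qed

lemma summable_bnd: "summable bnd"
  unfolding bnd_def[abs_def] by (intro summable_mult summable_rho)

lemma bnd_nonneg: "0 \<le> bnd M"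
  using K cS_nonneg \<rho> by (simp add: bnd_def)

section \<open>The continuous sum of all blocks\<close>

definition lev :: "nat \<Rightarrow> real \<times> real \<Rightarrow> complex" where
  "lev M z = (\<Sum>a\<le>M. blk a (M - a) z)"

definition g :: "real \<times> real \<Rightarrow> complex" where
  "g z = (\<Sum>M. lev M z)"

lemma lev_le: "cmod (lev M z) \<le> bnd M"
  unfolding lev_def using level_sup[of M z] norm_sum[of "\<lambda>a. blk a (M - a) z" "{..M}"] by linarith

lemma lev_measurable [measurable]: "lev M \<in> borel_measurable borel"
  unfolding lev_def[abs_def] by measurable

lemma uniform_g: "uniform_limit UNIV (\<lambda>N z. \<Sum>M<N. lev M z) g sequentially"
  unfolding g_def[abs_def] by (rule Weierstrass_m_test[OF lev_le summable_bnd])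

lemma g_continuous: "continuous_on UNIV g"
proof (rule uniform_limit_theorem[OF _ uniform_g])
  show "\<forall>\<^sub>F N in sequentially. continuous_on UNIV (\<lambda>z. \<Sum>M<N. lev M z)"
    unfolding lev_def by (intro always_eventually allI continuous_intros trig2_continuous[OF trig2_blk])
qed simp

lemma g_per2: "per2 g"
  using permeas_per2[OF trig2_permeas[OF trig2_blk]] by (simp add: per2_def g_def lev_def)

lemma g_measurable [measurable]: "g \<in> borel_measurable borel"
  by (rule borel_measurable_continuous_onI[OF g_continuous])

lemma g_sums: "(\<lambda>M. lev M z) sums g z"
  unfolding g_def by (intro summable_sums summable_comparison_test'[OF summable_bnd]) (auto intro: lev_le)

end

section \<open>Identification of the sum with the original function\<close>

lemma sum_swap_pairs:
  fixes G :: "_ \<Rightarrow> _ \<Rightarrow> _ \<Rightarrow> _ \<Rightarrow> 'a :: comm_monoid_add"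
  shows "(\<Sum>i\<in>X. \<Sum>j\<in>Y. \<Sum>a\<in>I. \<Sum>b\<in>J. G i j a b) = (\<Sum>a\<in>I. \<Sum>b\<in>J. \<Sum>i\<in>X. \<Sum>j\<in>Y. G i j a b)"
proof -
  have "(\<Sum>i\<in>X. \<Sum>j\<in>Y. \<Sum>a\<in>I. \<Sum>b\<in>J. G i j a b) = (\<Sum>i\<in>X. \<Sum>a\<in>I. \<Sum>b\<in>J. \<Sum>j\<in>Y. G i j a b)"
    by (intro sum.cong refl) (subst sum.swap, intro sum.cong refl sum.swap)
  also have "\<dots> = (\<Sum>a\<in>I. \<Sum>b\<in>J. \<Sum>i\<in>X. \<Sum>j\<in>Y. G i j a b)"
    by (subst sum.swap, intro sum.cong refl sum.swap)
  finally show ?thesis .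
qed

lemma block_sum:
  assumes F: "permeas F" and fin: "(\<integral>\<^sup>+z. ennreal (cmod (F z)) \<partial>unif2) < \<infinity>"
    and A: "\<And>a. a \<in> I \<Longrightarrow> trig (d a) (A a)" and B: "\<And>b. b \<in> J \<Longrightarrow> trig (e b) (B b)"
  shows "block l (\<lambda>u. \<Sum>a\<in>I. A a u) (\<lambda>u. \<Sum>b\<in>J. B b u) F z = (\<Sum>a\<in>I. \<Sum>b\<in>J. block l (A a) (B b) F z)"
proof -
  have i: "integrable unif2 (\<lambda>u. A a (fst u) * B b (snd u) * F (z + dilate i j u))"
    if "a \<in> I" "b \<in> J" "i \<in> {1..l}" "j \<in> {1..l}" for a b i j
    using that by (intro integrable_kernel_mult[OF A B] integrable_dilate[OF F fin]) auto
  have "(LINT u|unif2. (\<Sum>a\<in>I. A a (fst u)) * (\<Sum>b\<in>J. B b (snd u)) * F (z + dilate i j u)) =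
     (\<Sum>a\<in>I. \<Sum>b\<in>J. LINT u|unif2. A a (fst u) * B b (snd u) * F (z + dilate i j u))"
    if "i \<in> {1..l}" "j \<in> {1..l}" for i j
  proof -
    have "(LINT u|unif2. (\<Sum>a\<in>I. A a (fst u)) * (\<Sum>b\<in>J. B b (snd u)) * F (z + dilate i j u)) =
      (LINT u|unif2. (\<Sum>a\<in>I. (\<Sum>b\<in>J. A a (fst u) * B b (snd u) * F (z + dilate i j u))))"
      by (simp only: sum_product) (simp only: sum_distrib_right)
    also have "\<dots> = (\<Sum>a\<in>I. LINT u|unif2. (\<Sum>b\<in>J. A a (fst u) * B b (snd u) * F (z + dilate i j u)))"
      by (rule Bochner_Integration.integral_sum) (intro Bochner_Integration.integrable_sum i that)
    also have "\<dots> = (\<Sum>a\<in>I. \<Sum>b\<in>J. LINT u|unif2. A a (fst u) * B b (snd u) * F (z + dilate i j u))"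
      by (intro sum.cong refl Bochner_Integration.integral_sum i that)
    finally show ?thesis .
  qed
  then have "block l (\<lambda>u. \<Sum>a\<in>I. A a u) (\<lambda>u. \<Sum>b\<in>J. B b u) F z =
     (\<Sum>i=1..l. \<Sum>j=1..l. \<Sum>a\<in>I. \<Sum>b\<in>J. dcoef l i * dcoef l j *
        (LINT u|unif2. A a (fst u) * B b (snd u) * F (z + dilate i j u)))"
    unfolding block_def by (intro sum.cong refl) (simp add: sum_distrib_left)
  also have "\<dots> = (\<Sum>a\<in>I. \<Sum>b\<in>J. block l (A a) (B b) F z)"
    unfolding block_def by (rule sum_swap_pairs)
  finally show ?thesis .
qed

lemma Npow_const_le:
  assumes "\<And>z. cmod (G z) \<le> c" "0 \<le> p"
  shows "Npow p G \<le> ennreal (c powr p)"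
proof -
  have "Npow p G \<le> (\<integral>\<^sup>+z. ennreal (c powr p) \<partial>unif2)"
    unfolding Npow_def using assms by (intro nn_integral_mono ennreal_leI powr_mono2) auto
  also have "\<dots> = ennreal (c powr p)"
    using unif2.emeasure_space_1 by (simp add: space_pair_measure)
  finally show ?thesis .
qed

lemma Npow_eq_0:
  assumes [measurable]: "G \<in> borel_measurable borel" and "Npow p G = 0"
  shows "AE z in unif2. G z = 0"
proof -
  have "AE z in unif2. ennreal (cmod (G z) powr p) = 0"
    using assms(2) unfolding Npow_def by (subst (asm) nn_integral_0_iff_AE) auto
  then show ?thesis by eventually_elim (auto simp: ennreal_eq_0_iff powr_def split: if_splits)
qed

lemma fib_err_sum:
  assumes "\<And>i. i \<in> I \<Longrightarrow> integrable unif2 (f i)"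
  shows "fib_err n (\<lambda>z. \<Sum>i\<in>I. f i z) = (\<Sum>i\<in>I. fib_err n (f i))"
proof -
  have "(LINT u|unif2. (\<Sum>i\<in>I. f i u)) = (\<Sum>i\<in>I. LINT u|unif2. f i u)"
    using assms by (rule Bochner_Integration.integral_sum)
  then show ?thesis
    unfolding fib_err_def by (subst sum.swap) (simp add: sum_subtractf sum_distrib_left)
qed

context sampled_function
begin

text \<open>Partial sums over squares instead of levels: only these telescope to a single Jackson
  operator in each variable, whose distance to F is known. The level sums defining \<open>g\<close>
  have the uniform bounds.\<close>

definition sq :: "nat \<Rightarrow> real \<times> real \<Rightarrow> complex" where
  "sq S z = (\<Sum>a\<le>S. \<Sum>b\<le>S. blk a b z)"

lemma sq_measurable [measurable]: "sq S \<in> borel_measurable borel"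
  unfolding sq_def[abs_def] by measurable

lemma sq_eq_block: "sq S = block l (jackson (Suc q) S) (jackson (Suc q) S) F"
proof
  fix z
  show "sq S z = block l (jackson (Suc q) S) (jackson (Suc q) S) F z"
  proof -
    have "block l (\<lambda>u. \<Sum>a\<le>S. jdiff (Suc q) a u) (\<lambda>u. \<Sum>b\<le>S. jdiff (Suc q) b u) F z =
        (\<Sum>a\<le>S. \<Sum>b\<le>S. block l (jdiff (Suc q) a) (jdiff (Suc q) b) F z)"
      by (rule block_sum[OF F F_integrable]) (rule trig_jdiff)+
    then show ?thesis by (simp add: sum_jdiff sq_def blk_def)
  qed
qed

text \<open>A common majorant for all three moduli at scale S; the factor 2 covers 2S + 1 \<le> 2 (S
  + 1).\<close>

definition eps :: "nat \<Rightarrow> real" where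
  "eps S = 2 * K * (real (S + 1) * (2 powr (- \<alpha>)) ^ S)"

lemma \<alpha>_pos: "0 < \<alpha>"
  using \<alpha> p by (smt (verit) divide_nonneg_nonneg)

lemma eps_tendsto: "eps \<longlonglongrightarrow> 0"
proof -
  have "summable (\<lambda>S. real (S + 1) * (2 powr (- \<alpha>)) ^ S)"
    using geometric_deriv_sums[of "2 powr (- \<alpha>)"] \<alpha>_pos by (simp add: sums_iff powr_less_one)
  then have "(\<lambda>S. real (S + 1) * (2 powr (- \<alpha>)) ^ S) \<longlonglongrightarrow> 0"
    by (rule summable_LIMSEQ_zero)
  then show ?thesis unfolding eps_def[abs_def] by (rule tendsto_mult_right_zero)
qed

lemma eps_nonneg: "0 \<le> eps S"
  using K by (simp add: eps_def)

lemma Npow_sq: "Npow p (\<lambda>z. sq S z - F z) \<le> ennreal (4 powr p * cJ p q (cK (Suc q)) * (3 * eps S powr p))"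
proof -
  have p0: "0 \<le> p" using p by simp
  have eS: "eps S = K * 2 powr (- \<alpha> * real S) * (2 * real (S + 1))"
  proof -
    have "(2 powr (- \<alpha>)) ^ S = 2 powr (- \<alpha> * real S)"
      by (subst powr_realpow[symmetric]) (auto simp: powr_powr)
    then show ?thesis by (simp add: eps_def)
  qed
  have "K * 2 powr (- \<alpha> * real S) * 1 \<le> eps S"
    unfolding eS using K by (intro mult_left_mono) auto
  then have e: "K * 2 powr (- \<alpha> * real S) \<le> eps S" by simp
  \<comment> \<open>The diagonal value is one term of level 2S, for which alone a bound is assumed;
    half of the decay 2^(-2 \<alpha> S) is given away.\<close>
  have "y12 S S \<le> (\<Sum>a\<le>2 * S. y12 a (2 * S - a))"
    using member_le_sum[of S "{..2 * S}" "\<lambda>a. y12 a (2 * S - a)"] y0 by (simp add: mult_2)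
  also have "\<dots> \<le> K * 2 powr (- \<alpha> * real (2 * S)) * real (2 * S + 1) powr \<tau>" by (rule Y12)
  also have "\<dots> \<le> K * 2 powr (- \<alpha> * real S) * real (2 * S + 1)"
  proof (intro mult_mono log_exp_le)
    have "- \<alpha> * real (2 * S) \<le> - \<alpha> * real S" using \<alpha>_pos by simp
    then show "2 powr (- \<alpha> * real (2 * S)) \<le> 2 powr (- \<alpha> * real S)" by (intro powr_mono) auto
  qed (use K in auto)
  also have "\<dots> \<le> eps S" unfolding eS using K by (intro mult_left_mono) auto
  finally have a: "y12 S S powr p \<le> eps S powr p" using y0 p0 by (intro powr_mono2) auto
  have b: "y1 S powr p \<le> eps S powr p" using Y1[of S] e y0 p0 by (intro powr_mono2) auto
  have c: "y2 S powr p \<le> eps S powr p" using Y2[of S] e y0 p0 by (intro powr_mono2) auto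
  have "Npow p (\<lambda>z. block l (jackson (Suc q) S) (jackson (Suc q) S) F z - (LINT u|unif. jackson (Suc q) S u) * (LINT u|unif. jackson (Suc q) S u) * F z) \<le>
    ennreal (4 powr p * cJ p q (cK (Suc q)) * (y12 S S powr p + (if (LINT u|unif. jackson (Suc q) S u) = 0 then 0 else y1 S powr p)
      + (if (LINT u|unif. jackson (Suc q) S u) = 0 then 0 else y2 S powr p)))"
    by (rule jackson_estimate[OF F p NF_fin q _ _ jackson(1) decays_jackson jackson(1) decays_jackson]) (use H12 H1 H2 in auto)
  also have "\<dots> \<le> ennreal (4 powr p * cJ p q (cK (Suc q)) * (3 * eps S powr p))"
    using a b c by (intro ennreal_leI mult_left_mono) (auto simp: jackson cJ_nonneg cK_nonneg)
  finally show ?thesis by (simp add: jackson sq_eq_block)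
qed

definition tail_bound :: "nat \<Rightarrow> real" where
  "tail_bound S = suminf bnd - (\<Sum>M<Suc S. bnd M)"

lemma tail_bound_tendsto: "tail_bound \<longlonglongrightarrow> 0"
proof -
  have "(\<lambda>S. \<Sum>M<Suc S. bnd M) \<longlonglongrightarrow> suminf bnd"
    by (rule LIMSEQ_Suc[OF summable_LIMSEQ[OF summable_bnd]])
  from tendsto_diff[OF tendsto_const this, of "suminf bnd"] show ?thesis
    by (simp add: tail_bound_def[abs_def])
qed

lemma g_minus_sq: "cmod (g z - sq S z) \<le> tail_bound S"
proof -
  have fin: "cmod ((\<Sum>M<N. lev M z) - sq S z) \<le> tail_bound S" if N: "N > 2 * S" for N
  proof -
    define f where "f = (\<lambda>x. blk (fst x) (snd x) z)"
    let ?T = "{x. fst x + snd x \<in> {..<N}}" and ?Q = "{..S} \<times> {..S}" and ?L = "{x. fst x + snd x \<in> {Suc S..<N}}"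
    have T: "(\<Sum>M<N. lev M z) = (\<Sum>x\<in>?T. f x)"
      by (subst sum_level_pairs) (auto simp: lev_def f_def)
    have Q: "sq S z = (\<Sum>x\<in>?Q. f x)"
      by (simp add: sq_def f_def sum.cartesian_product case_prod_beta')
    have finT: "finite ?T" by (rule finite_level_pairs) simp
    \<comment> \<open>The square of side S contains all levels up to S and is contained in the
      levels up to 2S. The difference therefore consists of blocks of levels above S, which the tail
      of \<open>bnd\<close> controls.\<close>
    have QT: "?Q \<subseteq> ?T" using N by auto
    have "(\<Sum>M<N. lev M z) - sq S z = (\<Sum>x\<in>?T - ?Q. f x)"
      unfolding T Q by (rule sum_diff[OF finT QT, symmetric])
    also have "cmod \<dots> \<le> (\<Sum>x\<in>?T - ?Q. cmod (f x))" by (rule norm_sum)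
    also have "\<dots> \<le> (\<Sum>x\<in>?L. cmod (f x))"
      by (rule sum_mono2[OF finite_level_pairs]) auto
    also have "\<dots> = (\<Sum>M\<in>{Suc S..<N}. \<Sum>a\<le>M. cmod (blk a (M - a) z))"
      by (subst sum_level_pairs) (auto simp: f_def)
    also have "\<dots> \<le> (\<Sum>M\<in>{Suc S..<N}. bnd M)" by (intro sum_mono level_sup)
    also have "\<dots> = (\<Sum>M<N. bnd M) - (\<Sum>M<Suc S. bnd M)"
    proof -
      have "sum bnd ({..<Suc S} \<union> {Suc S..<N}) = sum bnd {..<Suc S} + sum bnd {Suc S..<N}"
        by (rule sum.union_disjoint) auto
      moreover have "{..<Suc S} \<union> {Suc S..<N} = {..<N}" using N by auto
      ultimately have "sum bnd {..<N} = sum bnd {..<Suc S} + sum bnd {Suc S..<N}" by (simp only:)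
      then show ?thesis by linarith
    qed
    also have "\<dots> \<le> tail_bound S"
      unfolding tail_bound_def using sum_le_suminf[OF summable_bnd, of "{..<N}"] bnd_nonneg by simp
    finally show ?thesis .
  qed
  have "(\<lambda>N. cmod ((\<Sum>M<N. lev M z) - sq S z)) \<longlonglongrightarrow> cmod (g z - sq S z)"
    using g_sums[of z] unfolding sums_def by (intro tendsto_intros)
  then show ?thesis
    by (rule LIMSEQ_le_const2) (use fin in \<open>auto intro!: exI[of _ "Suc (2 * S)"]\<close>)
qed

text \<open>The square sums tend to g uniformly and to F in p-th mean, so the two limits agree
  almost everywhere.\<close>

lemma g_eq_F: "AE z in unif2. g z = F z"
proof -
  have p0: "0 \<le> p" using p by simp
  define c where "c = 4 powr p * cJ p q (cK (Suc q))"
  have c: "0 \<le> c" by (simp add: c_def cJ_nonneg cK_nonneg)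
  define r where "r = (\<lambda>S. 2 powr p * (tail_bound S powr p + c * (3 * eps S powr p)))"
  have tail0: "0 \<le> tail_bound S" for S using g_minus_sq[of 0 S] norm_ge_zero order_trans by blast
  have le: "Npow p (\<lambda>z. g z - F z) \<le> ennreal (r S)" for S
  proof -
    have "Npow p (\<lambda>z. g z - F z) = Npow p (\<lambda>z. (g z - sq S z) + (sq S z - F z))" by simp
    also have "\<dots> \<le> ennreal (2 powr p) * (Npow p (\<lambda>z. g z - sq S z) + Npow p (\<lambda>z. sq S z - F z))"
      by (intro Npow_add p0) measurable
    also have "\<dots> \<le> ennreal (2 powr p) * (ennreal (tail_bound S powr p) + ennreal (c * (3 * eps S powr p)))"
      using Npow_sq[of S] by (intro mult_left_mono add_mono Npow_const_le g_minus_sq p0) (auto simp: c_def)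
    also have "\<dots> = ennreal (r S)"
      using c by (simp add: r_def ennreal_plus[symmetric] ennreal_mult[symmetric] del: ennreal_plus)
    finally show ?thesis .
  qed
  have A: "(\<lambda>S. tail_bound S powr p) \<longlonglongrightarrow> 0 powr p"
    using p tail0 by (intro tendsto_powr' tail_bound_tendsto tendsto_const) auto
  have B: "(\<lambda>S. eps S powr p) \<longlonglongrightarrow> 0 powr p"
    using p eps_nonneg by (intro tendsto_powr' eps_tendsto tendsto_const) auto
  have "r \<longlonglongrightarrow> 2 powr p * (0 powr p + c * (3 * 0 powr p))"
    unfolding r_def by (intro tendsto_add tendsto_mult tendsto_const A B)
  then have "r \<longlonglongrightarrow> 0" using p by simp
  then have "(\<lambda>S. ennreal (r S)) \<longlonglongrightarrow> 0" using tendsto_ennrealI by fastforce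
  then have "Npow p (\<lambda>z. g z - F z) \<le> 0"
    by (rule LIMSEQ_le_const) (use le in auto)
  then have "AE z in unif2. g z - F z = 0"
    by (intro Npow_eq_0[where p = p]) auto
  then show ?thesis by simp
qed

section \<open>Error of the rule summed over all levels\<close>

lemma fib_err_limit: "(\<lambda>N. fib_err n (\<lambda>z. \<Sum>M<N. lev M z)) \<longlonglongrightarrow> fib_err n g"
proof -
  have "(\<lambda>N. LINT u|unif2. (\<Sum>M<N. lev M u)) \<longlonglongrightarrow> (LINT u|unif2. g u)"
  proof (rule integral_dominated_convergence[where w = "\<lambda>_. suminf bnd"])
    show "AE u in unif2. cmod (\<Sum>M<N. lev M u) \<le> suminf bnd" for N
    proof (rule AE_I2)
      fix u
      have "cmod (\<Sum>M<N. lev M u) \<le> (\<Sum>M<N. bnd M)"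
        by (intro order_trans[OF norm_sum] sum_mono lev_le)
      also have "\<dots> \<le> suminf bnd" using bnd_nonneg by (intro sum_le_suminf summable_bnd) auto
      finally show "cmod (\<Sum>M<N. lev M u) \<le> suminf bnd" .
    qed
  qed (use g_sums in \<open>auto simp: sums_def\<close>)
  then show ?thesis
    unfolding fib_err_def using g_sums by (intro tendsto_intros) (auto simp: sums_def)
qed

definition cQ :: real where "cQ = (\<Sum>k. real (k + 1) * \<rho> ^ k)"

text \<open>On level m + k the sampling loss is only 2^(k/p), counted from the resolution m of the
  nodes and not from 0. The factors belonging to m come out, and the rest is a summable sequence in
  k.\<close>

lemma level_fib_err:
  assumes n: "n \<ge> 1" and m: "m = 0 \<or> 24 * 2 ^ m < fib_b n"
    and ex: "\<And>a b. a + b < m \<Longrightarrow> fib_err n (blk a b) = 0"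
  shows "(\<Sum>a\<le>M. cmod (fib_err n (blk a (M - a)))) \<le>
     (if M < m then 0 else cD * (4 * K) * 2 powr (- \<alpha> * real m) * real (m + 1) powr \<tau> * (real (M - m + 1) * \<rho> ^ (M - m)))"
proof (cases "M < m")
  case True
  then show ?thesis using ex by simp
next
  case False
  define k where "k = M - m"
  have M: "M = m + k" using False by (simp add: k_def)
  have "(\<Sum>a\<le>M. cmod (fib_err n (blk a (M - a)))) \<le> (\<Sum>a\<le>M. cD * 2 powr (real k / p) * yy a (M - a))"
  proof (rule sum_mono)
    fix a assume "a \<in> {..M}"
    then show "cmod (fib_err n (blk a (M - a))) \<le> cD * 2 powr (real k / p) * yy a (M - a)"
      using blk_fib_err[OF n _ m, of a "M - a"] M by simp
  qed
  also have "\<dots> = cD * 2 powr (real k / p) * (\<Sum>a\<le>M. yy a (M - a))"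
    by (simp add: sum_distrib_left)
  also have "\<dots> \<le> cD * 2 powr (real k / p) * (4 * K * 2 powr (- \<alpha> * real M) * real (M + 1) powr \<tau>)"
    by (intro mult_left_mono level_sum) (simp add: cD_nonneg)
  also have "\<dots> \<le> cD * 2 powr (real k / p) * (4 * K * (2 powr (- \<alpha> * real m) * 2 powr (- \<alpha> * real k)) * (real (m + 1) powr \<tau> * real (k + 1)))"
  proof -
    \<comment> \<open>M + 1 \<le> (m + 1) (k + 1) separates the logarithmic factor of the critical
      level from a polynomial factor in k that the geometric decay absorbs.\<close>
    have "real (M + 1) powr \<tau> \<le> (real (m + 1) * real (k + 1)) powr \<tau>"
      using \<tau> by (intro powr_mono2) (auto simp: M algebra_simps)
    also have "\<dots> = real (m + 1) powr \<tau> * real (k + 1) powr \<tau>" by (rule powr_mult)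
    also have "\<dots> \<le> real (m + 1) powr \<tau> * real (k + 1)" by (intro mult_left_mono log_exp_le) auto
    finally have 1: "real (M + 1) powr \<tau> \<le> real (m + 1) powr \<tau> * real (k + 1)" .
    have 2: "2 powr (- \<alpha> * real M) = 2 powr (- \<alpha> * real m) * 2 powr (- \<alpha> * real k)"
      unfolding powr_add[symmetric] by (simp add: M algebra_simps)
    show ?thesis unfolding 2 using K cD_nonneg by (intro mult_left_mono 1) auto
  qed
  also have "\<dots> = cD * (4 * K) * 2 powr (- \<alpha> * real m) * real (m + 1) powr \<tau> * (real (k + 1) * (2 powr (real k / p) * 2 powr (- \<alpha> * real k)))"
    by (simp only: ac_simps)
  finally show ?thesis using False unfolding rho_level k_def by simp
qed

lemma fib_err_g:
  assumes n: "n \<ge> 1" and m: "m = 0 \<or> 24 * 2 ^ m < fib_b n"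
    and ex: "\<And>a b. a + b < m \<Longrightarrow> fib_err n (blk a b) = 0"
  shows "cmod (fib_err n g) \<le> cD * (4 * K) * 2 powr (- \<alpha> * real m) * real (m + 1) powr \<tau> * cQ"
proof -
  define c where "c = cD * (4 * K) * 2 powr (- \<alpha> * real m) * real (m + 1) powr \<tau>"
  have c: "0 \<le> c" using cD_nonneg K by (simp add: c_def)
  have "cmod (fib_err n (\<lambda>z. \<Sum>M<N. lev M z)) \<le> c * cQ" for N
  proof -
    have ib: "integrable unif2 (blk a b)" for a b by (rule trig2_integrable[OF trig2_blk])
    have il: "integrable unif2 (lev M)" for M
      unfolding lev_def by (intro Bochner_Integration.integrable_sum ib)
    have lv: "fib_err n (lev M) = (\<Sum>a\<le>M. fib_err n (blk a (M - a)))" for M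
      unfolding lev_def by (rule fib_err_sum) (rule ib)
    have "cmod (fib_err n (\<lambda>z. \<Sum>M<N. lev M z)) = cmod (\<Sum>M<N. fib_err n (lev M))"
      using il by (subst fib_err_sum) auto
    also have "\<dots> \<le> (\<Sum>M<N. \<Sum>a\<le>M. cmod (fib_err n (blk a (M - a))))"
      unfolding lv by (intro order_trans[OF norm_sum] sum_mono norm_sum)
    also have "\<dots> \<le> (\<Sum>M<N. if M < m then 0 else c * (real (M - m + 1) * \<rho> ^ (M - m)))"
      unfolding c_def by (intro sum_mono level_fib_err[OF n m ex])
    also have "\<dots> = (\<Sum>M\<in>{m..<N}. c * (real (M - m + 1) * \<rho> ^ (M - m)))"
      by (rule sum.mono_neutral_cong_right) auto
    also have "\<dots> = (\<Sum>k<N - m. c * (real (k + 1) * \<rho> ^ k))"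
      by (rule sum.reindex_bij_witness[where i = "\<lambda>k. k + m" and j = "\<lambda>M. M - m"]) auto
    also have "\<dots> = c * (\<Sum>k<N - m. real (k + 1) * \<rho> ^ k)"
      by (simp add: sum_distrib_left)
    also have "\<dots> \<le> c * cQ"
      unfolding cQ_def using \<rho> by (intro mult_left_mono sum_le_suminf summable_rho c) auto
    finally show ?thesis .
  qed
  then have "cmod (fib_err n g) \<le> c * cQ"
    by (intro LIMSEQ_le_const2[OF tendsto_norm[OF fib_err_limit]]) auto
  then show ?thesis by (simp add: c_def)
qed

text \<open>A gap in levels between the critical level m and log2 of b_n, used in the form 24 R^2 <
  2^cc. It serves both for exactness on the lower blocks, which needs 6 R^2, and for the node
  condition, which needs 24.\<close>

definition cc :: nat where "cc = 24 * R\<^sup>2"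

definition cF :: real where
  "cF = cD * (4 * K) * cQ * 2 powr (\<alpha> * real (cc + 1)) * 4 + 1"

lemma fib_err_final:
  assumes n: "n \<ge> 2"
  shows "cmod (fib_err n g) \<le> cF * real (fib_b n) powr (- \<alpha>) * ln (real (fib_b n)) powr \<tau>"
proof -
  define b where "b = fib_b n"
  have b2: "b \<ge> 2" using fib_mono[of 3 "Suc n"] n by (simp add: b_def fib_b_def eval_nat_numeral)
  obtain M0 where M0: "2 ^ M0 \<le> b" "b < 2 ^ (M0 + 1)"
    using ex_power_ivl1[of 2 b] b2 by auto
  \<comment> \<open>Truncated subtraction: for small b_n this is m = 0, no block is claimed to be
    exact, and the constant factor in the next bounds compensates.\<close>
  define m where "m = M0 - cc"
  have cc: "24 * R\<^sup>2 < 2 ^ cc" unfolding cc_def by (rule less_exp)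
  have R1: "1 \<le> R\<^sup>2" by (simp add: power2_eq_square)
  have permeas: "2 ^ cc * 2 ^ m \<le> b" if "m > 0"
    using that M0 by (simp add: m_def power_add[symmetric])
  have m: "m = 0 \<or> 24 * 2 ^ m < fib_b n"
  proof (cases "m = 0")
    case False
    have "24 * 1 \<le> 24 * R\<^sup>2" by (intro mult_left_mono R1) auto
    with cc have "24 < (2::nat) ^ cc" by linarith
    then have "24 * 2 ^ m < 2 ^ cc * (2 ^ m :: nat)" by (intro mult_strict_right_mono) auto
    then show ?thesis using permeas False unfolding b_def by linarith
  qed simp
  have ex: "fib_err n (blk a e) = 0" if "a + e < m" for a e
  proof (rule fib_err_exact[OF _ trig2_blk])
    have mx: "max 1 (R * 2 ^ i) = R * 2 ^ i" for i
    proof (rule max_absorb2)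
      have "1 * 1 \<le> R * 2 ^ i" by (intro mult_mono) auto
      then show "1 \<le> R * 2 ^ i" by simp
    qed
    have "6 * (max 1 (R * 2 ^ a) * max 1 (R * 2 ^ e)) = 6 * R\<^sup>2 * 2 ^ (a + e)"
      unfolding mx power_add power2_eq_square by (simp only: ac_simps)
    also have "\<dots> \<le> 6 * R\<^sup>2 * 2 ^ m" using that by (intro mult_left_mono power_increasing) auto
    also have "\<dots> < 2 ^ cc * 2 ^ m" using cc R1 by (intro mult_strict_right_mono) auto
    also have "\<dots> \<le> fib_b n" using permeas that by (simp add: b_def)
    finally show "R * 2 ^ a = 0 \<and> R * 2 ^ e = 0 \<or> 6 * (max 1 (R * 2 ^ a) * max 1 (R * 2 ^ e)) < fib_b n" ..
  qed (use n in simp)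
  have 1: "cmod (fib_err n g) \<le> cD * (4 * K) * 2 powr (- \<alpha> * real m) * real (m + 1) powr \<tau> * cQ"
    by (rule fib_err_g[OF _ m ex]) (use n in simp)
  have 2: "2 powr (- \<alpha> * real m) \<le> 2 powr (\<alpha> * real (cc + 1)) * real b powr (- \<alpha>)"
  proof -
    \<comment> \<open>Valid also when the subtraction is truncated. Together with b < 2^(M0 + 1) it
      accounts for cc + 1 in the constant.\<close>
    have "real M0 \<le> real m + real cc" by (simp add: m_def)
    then have "\<alpha> * real M0 \<le> \<alpha> * (real m + real cc)" using \<alpha>_pos by (intro mult_left_mono) auto
    then have "2 powr (- \<alpha> * real m) \<le> 2 powr (\<alpha> * real (cc + 1) + - \<alpha> * real (M0 + 1))"
      by (intro powr_mono) (auto simp: algebra_simps)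
    also have "\<dots> = 2 powr (\<alpha> * real (cc + 1)) * (2 ^ (M0 + 1)) powr (- \<alpha>)"
      by (simp only: powr_add[of 2 "\<alpha> * real (cc + 1)"] powr_realpow[symmetric] powr_powr zero_less_numeral mult.commute)
    also have "\<dots> \<le> 2 powr (\<alpha> * real (cc + 1)) * real b powr (- \<alpha>)"
    proof (intro mult_left_mono powr_mono2')
      have "real b < real (2 ^ (M0 + 1))" using M0(2) by (simp only: of_nat_less_iff)
      then show "real b \<le> 2 ^ (M0 + 1)" by simp
    qed (use \<alpha>_pos b2 in auto)
    finally show ?thesis .
  qed
  have 3: "real (m + 1) powr \<tau> \<le> 4 * ln (real b) powr \<tau>"
  proof -
    have "real (2 ^ M0) \<le> real b" using M0(1) by (simp only: of_nat_le_iff)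
    then have "ln (2 ^ M0) \<le> ln (real b)" using b2 by (subst ln_le_cancel_iff) auto
    then have a: "real M0 * ln 2 \<le> ln (real b)" by (simp add: ln_realpow)
    have l2: "1/2 \<le> ln (2::real)" using exp_bound_half[of "1/2 :: real"] by (subst ln_ge_iff) auto
    have "real M0 * (1/2) \<le> real M0 * ln 2" by (intro mult_left_mono l2) auto
    moreover have "ln 2 \<le> ln (real b)" using b2 by (subst ln_le_cancel_iff) auto
    moreover have "real (m + 1) \<le> real M0 + 1" by (simp add: m_def)
    \<comment> \<open>ln 2 \<ge> 1/2 gives M0 \<le> 2 ln b, and b \<ge> 2 gives 1 \<le> 2 ln b. Here
      n \<ge> 2 matters: for b_n = 1 the logarithm would vanish.\<close>
    ultimately have "real (m + 1) \<le> 4 * ln (real b)" using a l2 by linarith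
    then have "real (m + 1) powr \<tau> \<le> (4 * ln (real b)) powr \<tau>" using \<tau> by (intro powr_mono2) auto
    also have "\<dots> = 4 powr \<tau> * ln (real b) powr \<tau>" by (rule powr_mult)
    also have "\<dots> \<le> 4 * ln (real b) powr \<tau>"
      using powr_mono[of \<tau> 1 4] \<tau> by (intro mult_right_mono) auto
    finally show ?thesis .
  qed
  have cQ: "0 \<le> cQ" unfolding cQ_def using \<rho> by (intro suminf_nonneg summable_rho) auto
  have D0: "0 \<le> cD * (4 * K)" using cD_nonneg K by simp
  have "cD * (4 * K) * 2 powr (- \<alpha> * real m) * real (m + 1) powr \<tau> * cQ \<le>
    cD * (4 * K) * (2 powr (\<alpha> * real (cc + 1)) * real b powr (- \<alpha>)) * (4 * ln (real b) powr \<tau>) * cQ"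
    by (intro mult_mono mult_left_mono mult_right_mono 2 3 D0 cQ mult_nonneg_nonneg) auto
  also have "\<dots> = (cF - 1) * (real b powr (- \<alpha>) * ln (real b) powr \<tau>)"
    unfolding cF_def by (simp add: ac_simps)
  also have "\<dots> \<le> cF * (real b powr (- \<alpha>) * ln (real b) powr \<tau>)"
    by (intro mult_right_mono) auto
  finally show ?thesis using 1 by (simp add: b_def mult.assoc)
qed

end

section \<open>Transfer to the torus\<close>

definition vec2 :: "real \<times> real \<Rightarrow> real ^ 2" where
  "vec2 z = vector [fst z, snd z]"

lemma vec2_nth [simp]: "vec2 z $ 1 = fst z" "vec2 z $ 2 = snd z"
  by (simp_all add: vec2_def)

lemma vec2_eq: "vec2 (x $ 1, x $ 2) = x"
  by (simp add: vec_eq_iff forall_2)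

lemma UNIV_2_eq: "(UNIV :: 2 set) = {1, 2}"
  using exhaust_2 by auto

lemma measurable_vec2 [measurable]: "vec2 \<in> borel_measurable borel"
proof (intro borel_measurable_continuous_onI)
  have "vec2 = (\<lambda>z. \<chi> i. if i = 1 then fst z else snd z)"
    by (auto simp: fun_eq_iff vec_eq_iff forall_2)
  moreover have "continuous_on UNIV (\<lambda>z :: real \<times> real. \<chi> i :: 2. if i = 1 then fst z else snd z)"
  proof (intro continuous_on_vec_lambda)
    fix i :: 2
    show "continuous_on UNIV (\<lambda>z :: real \<times> real. if i = 1 then fst z else snd z)"
      by (cases "i = 1") (auto intro!: continuous_intros)
  qed
  ultimately show "continuous_on UNIV vec2" by (simp only:)
qed

lemma measurable_vec_pair [measurable]: "(\<lambda>x :: real ^ 2. (x $ 1, x $ 2)) \<in> borel_measurable borel"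
  by measurable

text \<open>Lebesgue measure on vectors is determined by its values on boxes, and boxes correspond
  to rectangles under \<open>vec2\<close>.\<close>

lemma lborel_vec2: "(lborel :: (real ^ 2) measure) = distr lborel borel vec2"
proof (rule lborel_eqI)
  fix l u :: "real ^ 2" assume lu: "\<And>b. b \<in> Basis \<Longrightarrow> l \<bullet> b \<le> u \<bullet> b"
  have le: "l $ i \<le> u $ i" for i
    using lu[of "axis i 1"] by (simp add: inner_axis)
  have B: "(\<Prod>b\<in>Basis. (u - l) \<bullet> b) = (u $ 1 - l $ 1) * (u $ 2 - l $ 2)"
  proof -
    have "(Basis :: (real ^ 2) set) = {axis 1 1, axis 2 1}"
      by (auto simp: Basis_vec_def UNIV_2_eq)
    then have "(\<Prod>b\<in>Basis. (u - l) \<bullet> b) = (\<Prod>b\<in>{axis 1 1, axis 2 1}. (u - l) \<bullet> b)"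
      by (simp only:)
    moreover have "axis 1 (1::real) \<noteq> (axis 2 1 :: real ^ 2)" by (simp add: axis_eq_axis)
    ultimately show ?thesis by (simp add: inner_axis)
  qed
  have "vec2 -` box l u = {l $ 1<..<u $ 1} \<times> {l $ 2<..<u $ 2}"
    by (auto simp: mem_box_cart forall_2)
  then have "emeasure (distr lborel borel vec2) (box l u) = emeasure lborel ({l $ 1<..<u $ 1} \<times> {l $ 2<..<u $ 2})"
    by (subst emeasure_distr) auto
  also have "\<dots> = emeasure (lborel :: real measure) {l $ 1<..<u $ 1} * emeasure (lborel :: real measure) {l $ 2<..<u $ 2}"
    by (subst lborel_prod[symmetric], subst lborel.emeasure_pair_measure_Times) auto
  also have "\<dots> = ennreal (\<Prod>b\<in>Basis. (u - l) \<bullet> b)"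
    unfolding B using le by (simp add: ennreal_mult)
  finally show "emeasure (distr lborel borel vec2) (box l u) = ennreal (\<Prod>b\<in>Basis. (u - l) \<bullet> b)" .
qed simp

text \<open>The sides are described only by acting as period cells, so that one proof serves both
  the closed unit square and all half-open integer cells.\<close>

lemma nn_integral_cell_pair:
  fixes H :: "real \<times> real \<Rightarrow> ennreal"
  assumes [measurable]: "H \<in> borel_measurable borel" "I \<in> sets borel" "J \<in> sets borel" and H: "per2 H"
    and I: "\<And>g :: real \<Rightarrow> ennreal. g \<in> borel_measurable borel \<Longrightarrow> per g \<Longrightarrow>
       (\<integral>\<^sup>+x. g x * indicator I x \<partial>lborel) = (\<integral>\<^sup>+x. g x \<partial>unif)"
    and J: "\<And>g :: real \<Rightarrow> ennreal. g \<in> borel_measurable borel \<Longrightarrow> per g \<Longrightarrow>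
       (\<integral>\<^sup>+x. g x * indicator J x \<partial>lborel) = (\<integral>\<^sup>+x. g x \<partial>unif)"
  shows "(\<integral>\<^sup>+z. H z * indicator (I \<times> J) z \<partial>lborel) = (\<integral>\<^sup>+z. H z \<partial>unif2)"
proof -
  have IJ [measurable]: "I \<times> J \<in> sets (borel :: (real \<times> real) measure)"
    by (subst borel_prod[symmetric]) measurable
  have "(\<integral>\<^sup>+z. H z * indicator (I \<times> J) z \<partial>lborel) =
      (\<integral>\<^sup>+x. \<integral>\<^sup>+y. H (x, y) * indicator (I \<times> J) (x, y) \<partial>lborel \<partial>lborel)"
    by (subst lborel_prod[symmetric], subst lborel.nn_integral_fst[symmetric])
       (auto simp: lborel_prod)
  also have "\<dots> = (\<integral>\<^sup>+x. (\<integral>\<^sup>+y. H (x, y) * indicator J y \<partial>lborel) * indicator I x \<partial>lborel)"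
    by (intro nn_integral_cong) (auto simp: indicator_def split: if_splits)
  also have "\<dots> = (\<integral>\<^sup>+x. (\<integral>\<^sup>+y. H (x, y) \<partial>unif) * indicator I x \<partial>lborel)"
    by (intro nn_integral_cong arg_cong2[where f = "(*)"] refl J per2_D2 H) measurable
  also have "\<dots> = (\<integral>\<^sup>+x. (\<integral>\<^sup>+y. H (x, y) \<partial>unif) \<partial>unif)"
    by (rule I) (use H in \<open>auto simp: per_def per2_def\<close>)
  also have "\<dots> = (\<integral>\<^sup>+z. H z \<partial>unif2)"
    by (rule unif.nn_integral_fst) measurable
  finally show ?thesis .
qed

lemma nn_integral_Ico_period:
  fixes g :: "real \<Rightarrow> ennreal"
  assumes "g \<in> borel_measurable borel" "per g"
  shows "(\<integral>\<^sup>+x. g x * indicator {a..<a+1} x \<partial>lborel) = (\<integral>\<^sup>+x. g x \<partial>unif)"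
  using nn_integral_period[OF assms] nn_integral_unif_unit[OF assms] by simp

lemma nn_integral_Icc_unit:
  fixes g :: "real \<Rightarrow> ennreal"
  assumes [measurable]: "g \<in> borel_measurable borel" and p: "per g"
  shows "(\<integral>\<^sup>+x. g x * indicator {0..1} x \<partial>lborel) = (\<integral>\<^sup>+x. g x \<partial>unif)"
proof -
  have "AE x in lborel. x \<noteq> (1::real)"
    by (rule AE_lborel_singleton)
  then have "AE x in lborel. g x * indicator {0..1} x = g x * indicator {0..<1} x"
    by eventually_elim (auto simp: indicator_def)
  then show ?thesis
    using nn_integral_Ico_period[OF assms, of 0] by (simp add: nn_integral_cong_AE)
qed

lemma torus_periodic_per2: "torus_periodic f \<Longrightarrow> per2 (\<lambda>z. f (vec2 z))"
proof -
  have "vec2 (x + 1, y) = vec2 (x, y) + axis 1 1" "vec2 (x, y + 1) = vec2 (x, y) + axis 2 1" for x y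
    by (simp_all add: vec_eq_iff forall_2 axis_def)
  then show "torus_periodic f \<Longrightarrow> per2 (\<lambda>z. f (vec2 z))"
    by (simp add: torus_periodic_def per2_def)
qed

lemma nn_integral_unit_cell:
  fixes H :: "real ^ 2 \<Rightarrow> ennreal"
  assumes [measurable]: "H \<in> borel_measurable borel" and H: "torus_periodic H"
  shows "(\<integral>\<^sup>+x. H x \<partial>unit_cell) = (\<integral>\<^sup>+z. H (vec2 z) \<partial>unif2)"
proof -
  have "(\<integral>\<^sup>+x. H x \<partial>unit_cell) = (\<integral>\<^sup>+x. H x * indicator (cbox 0 1) x \<partial>lborel)"
    by (rule nn_integral_restrict_space) simp
  also have "\<dots> = (\<integral>\<^sup>+z. H (vec2 z) * indicator (cbox 0 1) (vec2 z) \<partial>lborel)"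
    by (subst lborel_vec2, subst nn_integral_distr) auto
  also have "\<dots> = (\<integral>\<^sup>+z. H (vec2 z) * indicator ({0..1} \<times> {0..1}) z \<partial>lborel)"
    by (intro nn_integral_cong arg_cong2[where f = "(*)"] refl)
       (auto simp: indicator_def mem_box_cart forall_2)
  also have "\<dots> = (\<integral>\<^sup>+z. H (vec2 z) \<partial>unif2)"
    by (intro nn_integral_cell_pair nn_integral_Icc_unit torus_periodic_per2 H) auto
  finally show ?thesis .
qed

text \<open>Both measures have the same image under reduction modulo 1, and a periodic function
  factors through that reduction; this again avoids redoing the cell argument for Bochner
  integrals.\<close>

lemma integral_unit_cell:
  fixes f :: "real ^ 2 \<Rightarrow> complex"
  assumes [measurable]: "f \<in> borel_measurable borel" and f: "torus_periodic f"
  shows "(LINT x|unit_cell. f x) = (LINT z|unif2. f (vec2 z))"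
proof -
  define \<phi> where "\<phi> = (\<lambda>x :: real ^ 2. frac2 (x $ 1, x $ 2))"
  have \<phi>b [measurable]: "\<phi> \<in> borel_measurable borel" unfolding \<phi>_def by measurable
  have \<phi>u [measurable]: "\<phi> \<in> borel_measurable unit_cell"
    by (rule measurable_restrict_space1) simp
  have eq: "distr unit_cell borel \<phi> = distr unif2 borel frac2"
  proof (rule measure_eqI)
    fix A assume "A \<in> sets (distr unit_cell borel \<phi>)"
    then have [measurable]: "A \<in> sets borel" by simp
    have "emeasure (distr unit_cell borel \<phi>) A = (\<integral>\<^sup>+x. indicator A x \<partial>distr unit_cell borel \<phi>)"
      by (subst nn_integral_indicator) auto
    also have "\<dots> = (\<integral>\<^sup>+x. indicator A (\<phi> x) \<partial>unit_cell)"
      by (rule nn_integral_distr) auto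
    also have "\<dots> = (\<integral>\<^sup>+z. indicator A (\<phi> (vec2 z)) \<partial>unif2)"
    proof (rule nn_integral_unit_cell)
      have "frac ((x + axis i 1) $ j) = frac (x $ j)" for x :: "real ^ 2" and i j
        by (auto simp: axis_def frac_1_eq)
      then show "torus_periodic (\<lambda>x. indicator A (\<phi> x) :: ennreal)"
        unfolding torus_periodic_def \<phi>_def frac2_def by simp
    qed measurable
    also have "\<dots> = (\<integral>\<^sup>+z. indicator A (frac2 z) \<partial>unif2)"
      by (simp add: \<phi>_def)
    also have "\<dots> = (\<integral>\<^sup>+x. indicator A x \<partial>distr unif2 borel frac2)"
      by (rule nn_integral_distr[symmetric]) auto
    also have "\<dots> = emeasure (distr unif2 borel frac2) A"
      by (subst nn_integral_indicator) auto
    finally show "emeasure (distr unit_cell borel \<phi>) A = emeasure (distr unif2 borel frac2) A" .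
  qed simp
  have fe: "f x = f (vec2 (\<phi> x))" for x
    using per2_frac2[where g = "\<lambda>z. f (vec2 z)", OF torus_periodic_per2[OF f], of "(x $ 1, x $ 2)"]
    by (simp add: \<phi>_def vec2_eq)
  have "(LINT x|unit_cell. f x) = (LINT x|unit_cell. f (vec2 (\<phi> x)))"
    using fe by metis
  also have "\<dots> = (LINT z|distr unit_cell borel \<phi>. f (vec2 z))"
    by (rule integral_distr[symmetric]) auto
  also have "\<dots> = (LINT z|unif2. f (vec2 z))"
    unfolding eq by (rule integral_unif2_frac2) (auto intro: torus_periodic_per2 f)
  finally show ?thesis .
qed

text \<open>The exceptional set is periodic and null in one cell, and countably many integer cells
  cover the plane.\<close>

lemma AE_lborel_periodic:
  fixes g F :: "real \<times> real \<Rightarrow> complex"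
  assumes [measurable]: "g \<in> borel_measurable borel" "F \<in> borel_measurable borel"
    and p: "per2 g" "per2 F" and ae: "AE z in unif2. g z = F z"
  shows "AE z in lborel. g z = F z"
proof -
  have D [measurable]: "{z. g z \<noteq> F z} \<in> sets borel" by measurable
  define H where "H = (indicator {z. g z \<noteq> F z} :: real \<times> real \<Rightarrow> ennreal)"
  have [measurable]: "H \<in> borel_measurable borel" unfolding H_def by measurable
  have Hp: "per2 H" using p by (simp add: per2_def H_def indicator_def)
  have H0: "(\<integral>\<^sup>+z. H z \<partial>unif2) = 0"
    using ae by (subst nn_integral_0_iff_AE) (auto simp: H_def indicator_def)
  have cell: "AE z in lborel. z \<in> {of_int k..<of_int k + 1} \<times> {of_int m..<of_int m + 1} \<longrightarrow> g z = F z" for k m :: int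
  proof -
    let ?C = "{of_int k..<of_int k + 1} \<times> {of_int m..<of_int m + (1::real)} :: (real \<times> real) set"
    have [measurable]: "?C \<in> sets borel"
      by (subst borel_prod[symmetric]) measurable
    have "(\<integral>\<^sup>+z. H z * indicator ?C z \<partial>lborel) = 0"
      unfolding H0[symmetric] by (intro nn_integral_cell_pair nn_integral_Ico_period Hp) auto
    then have "AE z in lborel. H z * indicator ?C z = 0"
      by (subst (asm) nn_integral_0_iff_AE) auto
    then show ?thesis
      by eventually_elim (auto simp: H_def indicator_def split: if_splits)
  qed
  have "AE z in lborel. \<forall>k m :: int. z \<in> {of_int k..<of_int k + 1} \<times> {of_int m..<of_int m + 1} \<longrightarrow> g z = F z"
    unfolding AE_all_countable using cell by blast
  then show ?thesis
  proof eventually_elim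
    case (elim z)
    have "z \<in> {of_int \<lfloor>fst z\<rfloor>..<of_int \<lfloor>fst z\<rfloor> + 1} \<times> {of_int \<lfloor>snd z\<rfloor>..<of_int \<lfloor>snd z\<rfloor> + 1}"
      by (auto simp: mem_Times_iff)
    then show ?case using elim by blast
  qed
qed

section \<open>Norms and differences of functions on the torus in coordinates\<close>

lemma Lp_norm_Npow:
  fixes f :: "real ^ 2 \<Rightarrow> complex"
  assumes [measurable]: "f \<in> borel_measurable borel" and f: "torus_periodic f" and p: "p \<noteq> \<infinity>"
  shows "Lp_norm p f = ennreal_powr (Npow (enn2real p) (\<lambda>z. f (vec2 z))) (1 / enn2real p)"
proof -
  have "(\<integral>\<^sup>+x. ennreal (cmod (f x) powr enn2real p) \<partial>unit_cell) = Npow (enn2real p) (\<lambda>z. f (vec2 z))"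
    unfolding Npow_def by (rule nn_integral_unit_cell) (use f in \<open>auto simp: torus_periodic_def\<close>)
  then show ?thesis using p by (simp add: Lp_norm_def)
qed

lemma ennreal_powr_le_D:
  assumes "ennreal_powr X (1 / p) \<le> ennreal y" "0 \<le> y" "0 < p"
  shows "X \<le> ennreal (y powr p)"
proof (cases X)
  case (real x)
  then have "x powr (1 / p) \<le> y" using assms by (simp add: ennreal_powr_def)
  then have "(x powr (1 / p)) powr p \<le> y powr p" using assms by (intro powr_mono2) auto
  then show ?thesis using real assms by (simp add: powr_powr ennreal_leI)
next
  case top
  then show ?thesis using assms by (simp add: ennreal_powr_def top_unique)
qed

lemma Lp_norm_le_D:
  fixes f :: "real ^ 2 \<Rightarrow> complex"
  assumes "f \<in> borel_measurable borel" "torus_periodic f" "p \<noteq> \<infinity>" "1 \<le> enn2real p"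
    and "Lp_norm p f \<le> ennreal y" "0 \<le> y"
  shows "Npow (enn2real p) (\<lambda>z. f (vec2 z)) \<le> ennreal (y powr enn2real p)"
  using assms by (intro ennreal_powr_le_D) (auto simp: Lp_norm_Npow[symmetric])

lemma partial_diff_props:
  fixes f :: "real ^ 2 \<Rightarrow> complex"
  assumes [measurable]: "f \<in> borel_measurable borel" and f: "torus_periodic f"
  shows "partial_diff l i s f \<in> borel_measurable borel" "torus_periodic (partial_diff l i s f)"
proof -
  show "partial_diff l i s f \<in> borel_measurable borel"
    unfolding partial_diff_def[abs_def] by measurable
  have "f (x + axis j 1 + v) = f (x + v)" for x j v
    using f by (metis add.assoc add.commute torus_periodic_def)
  then show "torus_periodic (partial_diff l i s f)"
    by (simp add: torus_periodic_def partial_diff_def)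
qed

lemma partial_diff_vec2:
  "(\<lambda>z. partial_diff l 1 s f (vec2 z)) = ldiff l (s, 0) (\<lambda>z. f (vec2 z))"
  "(\<lambda>z. partial_diff l 2 s f (vec2 z)) = ldiff l (0, s) (\<lambda>z. f (vec2 z))"
proof -
  have "vec2 (z + real j *\<^sub>R (s, 0)) = vec2 z + axis 1 (real j * s)" "vec2 (z + real j *\<^sub>R (0, s)) = vec2 z + axis 2 (real j * s)" for z j s
    by (simp_all add: vec_eq_iff forall_2 axis_def)
  then show "(\<lambda>z. partial_diff l 1 s f (vec2 z)) = ldiff l (s, 0) (\<lambda>z. f (vec2 z))"
    "(\<lambda>z. partial_diff l 2 s f (vec2 z)) = ldiff l (0, s) (\<lambda>z. f (vec2 z))"
    by (simp_all add: fun_eq_iff partial_diff_def ldiff_def atMost_atLeast0)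
qed

lemma mixed_diff_1: "mixed_diff l {1} h f = partial_diff l 1 (h $ 1) (f :: real ^ 2 \<Rightarrow> complex)"
  using mixed_diff_insert[of 1 "{}" l h f] by (simp add: mixed_diff_empty)

lemma mixed_diff_2: "mixed_diff l {2} h f = partial_diff l 2 (h $ 2) (f :: real ^ 2 \<Rightarrow> complex)"
  using mixed_diff_insert[of 2 "{}" l h f] by (simp add: mixed_diff_empty)

lemma mixed_diff_UNIV:
  "mixed_diff l UNIV h f = partial_diff l 1 (h $ 1) (partial_diff l 2 (h $ 2) (f :: real ^ 2 \<Rightarrow> complex))"
  using mixed_diff_insert[of 1 "{2}" l h f] by (simp add: mixed_diff_2 UNIV_2_eq)

section \<open>Dyadic form of the Besov norm\<close>

lemma ennreal_powr_mono: "X \<le> Y \<Longrightarrow> 0 \<le> a \<Longrightarrow> ennreal_powr X a \<le> ennreal_powr Y a"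
  unfolding ennreal_powr_def
  by (cases X; cases Y) (auto simp: top_unique intro!: ennreal_leI powr_mono2)

lemma mixed_modulus_mono:
  assumes "\<And>i. i \<in> e \<Longrightarrow> s $ i \<le> t $ i"
  shows "mixed_modulus l e p f s \<le> mixed_modulus l e p f t"
  unfolding mixed_modulus_def by (rule SUP_subset_mono) (use assms in force)+

lemma Lp_norm_le_modulus:
  assumes "\<And>i. i \<in> e \<Longrightarrow> \<bar>h $ i\<bar> < t $ i"
  shows "Lp_norm p (mixed_diff l e h f) \<le> mixed_modulus l e p f t"
  unfolding mixed_modulus_def by (rule SUP_upper) (use assms in auto)

text \<open>The exponents are shifted by one so that the cell above the point \<open>dyad n\<close> stays in the unit cube also for \<open>n = 0\<close>.\<close>

definition dyad :: "('d \<Rightarrow> nat) \<Rightarrow> real ^ 'd::finite" where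
  "dyad n = (\<chi> i. 1 / (2 * 2 ^ n i))"

text \<open>Coordinates outside e run through the whole unit interval, because the seminorm
  integrates over the full cube. Open boxes make cells with different indices on e disjoint.\<close>

definition dcell :: "'d set \<Rightarrow> ('d \<Rightarrow> nat) \<Rightarrow> (real ^ 'd::finite) set" where
  "dcell e n = box (\<chi> i. if i \<in> e then 1 / (2 * 2 ^ n i) else 0) (\<chi> i. if i \<in> e then 1 / 2 ^ n i else 1)"

lemma mem_dcell: "t \<in> dcell e n \<longleftrightarrow>
   (\<forall>i\<in>e. 1 / (2 * 2 ^ n i) < t $ i \<and> t $ i < 1 / 2 ^ n i) \<and> (\<forall>i. i \<notin> e \<longrightarrow> 0 < t $ i \<and> t $ i < 1)"
  by (auto simp: dcell_def mem_box_cart split: if_splits)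

lemma dcell_subset: "dcell e n \<subseteq> cbox 0 (1 :: real ^ 'd::finite)"
proof
  fix t :: "real ^ 'd" assume t: "t \<in> dcell e n"
  have "0 \<le> t $ i \<and> t $ i \<le> 1" for i
  proof (cases "i \<in> e")
    case True
    then have "1 / (2 * 2 ^ n i) < t $ i" "t $ i < 1 / 2 ^ n i" using t by (auto simp: mem_dcell)
    moreover have "0 < 1 / (2 * 2 ^ n i :: real)" "1 / (2 ^ n i :: real) \<le> 1" by auto
    ultimately show ?thesis by linarith
  qed (use t in \<open>auto simp: mem_dcell intro: less_imp_le\<close>)
  then show "t \<in> cbox 0 1" by (simp add: mem_box_cart)
qed

lemma dyadic_interval_unique:
  fixes t :: real
  assumes "1 / (2 * 2 ^ a) < t" "t < 1 / 2 ^ a" "1 / (2 * 2 ^ b) < t" "t < 1 / 2 ^ b"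
  shows "a = b"
proof -
  have "\<not> a < b" if "1 / (2 * 2 ^ a) < t" "t < 1 / 2 ^ b" for a b :: nat
  proof
    assume "a < b"
    then have "2 * 2 ^ a \<le> (2 :: real) ^ b" using power_increasing[of "Suc a" b "2::real"] by simp
    then have "1 / 2 ^ b \<le> 1 / (2 * 2 ^ a :: real)" by (intro divide_left_mono) auto
    with that show False by linarith
  qed
  from this[of a b] this[of b a] assms show ?thesis by linarith
qed

lemma emeasure_dcell: "emeasure lborel (dcell e n) = ennreal (\<Prod>i\<in>e. 1 / (2 * 2 ^ n i))"
proof -
  let ?l = "(\<chi> i. if i \<in> e then 1 / (2 * 2 ^ n i) else 0) :: real ^ 'a"
  let ?u = "(\<chi> i. if i \<in> e then 1 / 2 ^ n i else 1) :: real ^ 'a"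
  have "?l $ i \<le> ?u $ i" for i by (auto intro!: divide_left_mono)
  then have le: "\<And>b. b \<in> Basis \<Longrightarrow> ?l \<bullet> b \<le> ?u \<bullet> b"
    by (auto simp: Basis_vec_def inner_axis)
  have "emeasure lborel (dcell e n) = ennreal (\<Prod>b\<in>Basis. (?u - ?l) \<bullet> b)"
    unfolding dcell_def by (rule emeasure_lborel_box[OF le])
  also have "(\<Prod>b\<in>Basis. (?u - ?l) \<bullet> b) = (\<Prod>i\<in>UNIV. (?u - ?l) $ i)"
  proof -
    have "(Basis :: (real ^ 'a) set) = (\<lambda>i. axis i 1) ` UNIV" by (auto simp: Basis_vec_def)
    then have "(\<Prod>b\<in>Basis. (?u - ?l) \<bullet> b) = (\<Prod>b\<in>(\<lambda>i. axis i 1) ` UNIV. (?u - ?l) \<bullet> b)" by (simp only:)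
    also have "\<dots> = (\<Prod>i\<in>UNIV. (?u - ?l) \<bullet> axis i 1)"
      by (subst prod.reindex) (auto simp: inj_on_def axis_eq_axis)
    finally show ?thesis by (simp add: inner_axis)
  qed
  also have "\<dots> = (\<Prod>i\<in>UNIV. if i \<in> e then 1 / (2 * 2 ^ n i) else 1)"
    by (intro prod.cong refl) (auto simp: field_simps)
  also have "\<dots> = (\<Prod>i\<in>e. 1 / (2 * 2 ^ n i))"
    by (subst prod.inter_filter[symmetric]) auto
  finally show ?thesis .
qed

text \<open>On a cell, t lies above \<open>dyad (n k)\<close> and below twice that point in the
  coordinates of e. The modulus is monotone and the weights are decreasing in t, so the integrand is
  bounded below by the dyadic term times the inverse cell size. Injectivity on e keeps the cells
  disjoint.\<close>

lemma besov_dyadic_sum: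
  fixes n :: "'k \<Rightarrow> 'd::finite \<Rightarrow> nat"
  assumes B: "besov_seminorm l \<alpha> p \<theta> e f \<le> 1" and \<theta>: "0 < \<theta>" "\<theta> \<noteq> \<infinity>" and \<alpha>: "0 < \<alpha>"
    and A: "finite A" and inj: "\<And>k k'. k \<in> A \<Longrightarrow> k' \<in> A \<Longrightarrow> (\<And>i. i \<in> e \<Longrightarrow> n k i = n k' i) \<Longrightarrow> k = k'"
  shows "(\<Sum>k\<in>A. ennreal_powr (ennreal (\<Prod>i\<in>e. 2 powr (\<alpha> * real (n k i))) * mixed_modulus l e p f (dyad (n k))) (enn2real \<theta>))
     \<le> 2 ^ card e"
proof -
  define r where "r = enn2real \<theta>"
  have r: "0 < r" using \<theta> unfolding r_def by (simp add: enn2real_positive_iff top.not_eq_extremum)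
  define I where "I = (\<lambda>t. ennreal_powr (ennreal (\<Prod>i\<in>e. t $ i powr (- \<alpha>)) * mixed_modulus l e p f t) r
                * ennreal (\<Prod>i\<in>e. inverse (t $ i)))"
  define S where "S = (\<lambda>k. ennreal_powr (ennreal (\<Prod>i\<in>e. 2 powr (\<alpha> * real (n k i))) * mixed_modulus l e p f (dyad (n k))) r)"
  define c where "c = (\<lambda>k. S k * ennreal (\<Prod>i\<in>e. 2 ^ n k i))"
  have "ennreal_powr (\<integral>\<^sup>+t. I t \<partial>unit_cell) (1 / r) \<le> 1"
    using B \<theta> unfolding besov_seminorm_def I_def r_def by simp
  then have I1: "(\<integral>\<^sup>+t. I t \<partial>unit_cell) \<le> 1"
    using ennreal_powr_le_D[of "\<integral>\<^sup>+t. I t \<partial>unit_cell" r 1] r by simp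
  have lower: "c k \<le> I t" if t: "t \<in> dcell e (n k)" for k t
    unfolding c_def I_def S_def
  proof (intro mult_mono ennreal_powr_mono ennreal_leI prod_mono conjI mixed_modulus_mono)
    fix i assume i: "i \<in> e"
    have ti: "1 / (2 * 2 ^ n k i) < t $ i" "t $ i < 1 / 2 ^ n k i" using t i by (auto simp: mem_dcell)
    have "0 < 1 / (2 * 2 ^ n k i :: real)" by simp
    with ti have t0: "0 < t $ i" by linarith
    have "2 powr (\<alpha> * real (n k i)) = (1 / 2 ^ n k i) powr (- \<alpha>)"
      by (simp add: powr_divide powr_realpow[symmetric] powr_powr powr_minus_divide mult.commute)
    also have "\<dots> \<le> t $ i powr (- \<alpha>)" using ti t0 \<alpha> by (intro powr_mono2') auto
    finally show "2 powr (\<alpha> * real (n k i)) \<le> t $ i powr (- \<alpha>)" .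
    have "inverse (1 / 2 ^ n k i) \<le> inverse (t $ i)" using ti t0 by (intro le_imp_inverse_le) auto
    then show "2 ^ n k i \<le> inverse (t $ i)" by simp
    show "dyad (n k) $ i \<le> t $ i" using ti by (simp add: dyad_def)
  qed (use r in \<open>auto simp: prod_nonneg\<close>)
  have disj: "k = k'" if "k \<in> A" "k' \<in> A" "t \<in> dcell e (n k)" "t \<in> dcell e (n k')" for k k' t
  proof (rule inj[OF that(1,2)])
    fix i assume "i \<in> e"
    then show "n k i = n k' i" using that(3,4) dyadic_interval_unique[of "n k i" "t $ i" "n k' i"] by (auto simp: mem_dcell)
  qed
  have m [measurable]: "dcell e (n k) \<in> sets unit_cell" for k
    using dcell_subset[of e "n k"] by (auto simp: sets_restrict_space_iff dcell_def)
  \<comment> \<open>The weight 1/t cancels the size of the cell up to a factor 1/2 per coordinate,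
    independently of the scale.\<close>
  have "S k * ennreal ((1/2) ^ card e) = c k * emeasure unit_cell (dcell e (n k))" for k
  proof -
    have "emeasure unit_cell (dcell e (n k)) = ennreal (\<Prod>i\<in>e. 1 / (2 * 2 ^ n k i))"
      using dcell_subset[of e "n k"] by (subst emeasure_restrict_space) (auto simp: emeasure_dcell)
    then have "c k * emeasure unit_cell (dcell e (n k)) = S k * ennreal ((\<Prod>i\<in>e. 2 ^ n k i) * (\<Prod>i\<in>e. 1 / (2 * 2 ^ n k i)))"
      unfolding c_def by (simp add: ennreal_mult prod_nonneg mult.assoc)
    also have "(\<Prod>i\<in>e. 2 ^ n k i) * (\<Prod>i\<in>e. 1 / (2 * 2 ^ n k i)) = (1/2 :: real) ^ card e"
      unfolding prod.distrib[symmetric] by simp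
    finally show ?thesis ..
  qed
  then have "(\<Sum>k\<in>A. S k * ennreal ((1/2) ^ card e)) = (\<Sum>k\<in>A. \<integral>\<^sup>+t. c k * indicator (dcell e (n k)) t \<partial>unit_cell)"
    by (simp add: nn_integral_cmult_indicator)
  also have "\<dots> = (\<integral>\<^sup>+t. (\<Sum>k\<in>A. c k * indicator (dcell e (n k)) t) \<partial>unit_cell)"
    by (rule nn_integral_sum[symmetric]) measurable
  also have "\<dots> \<le> (\<integral>\<^sup>+t. I t \<partial>unit_cell)"
  proof (rule nn_integral_mono)
    fix t
    show "(\<Sum>k\<in>A. c k * indicator (dcell e (n k)) t) \<le> I t"
    proof (cases "\<exists>k\<in>A. t \<in> dcell e (n k)")
      case True
      then obtain k where k: "k \<in> A" "t \<in> dcell e (n k)" by blast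
      have "(\<Sum>k\<in>A. c k * indicator (dcell e (n k)) t) = (\<Sum>k'\<in>{k}. c k' * indicator (dcell e (n k')) t)"
        using k disj by (intro sum.mono_neutral_right A) (auto simp: indicator_def)
      also have "\<dots> \<le> I t" using lower k by simp
      finally show ?thesis .
    qed (auto simp: indicator_def)
  qed
  also have "\<dots> \<le> 1" by (rule I1)
  finally have "(\<Sum>k\<in>A. S k) * ennreal ((1/2) ^ card e) \<le> 1" by (simp add: sum_distrib_right)
  then have "(\<Sum>k\<in>A. S k) * ennreal ((1/2) ^ card e) * ennreal (2 ^ card e) \<le> 1 * ennreal (2 ^ card e)"
    by (rule mult_right_mono) auto
  moreover have "ennreal ((1/2) ^ card e) * ennreal (2 ^ card e) = 1"
    by (simp add: ennreal_mult[symmetric] power_mult_distrib[symmetric])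
  moreover have "ennreal (2 ^ card e) = 2 ^ card e" by (simp flip: ennreal_power)
  ultimately show ?thesis unfolding S_def r_def by (simp add: mult.assoc)
qed

text \<open>Evaluation of the supremum at t = \<open>dyad n\<close>; the half in \<open>dyad\<close>
  only increases the weight.\<close>

lemma besov_dyadic_sup:
  assumes B: "besov_seminorm l \<alpha> p \<infinity> e f \<le> 1" and \<alpha>: "0 < \<alpha>"
  shows "ennreal (\<Prod>i\<in>e. 2 powr (\<alpha> * real (n i))) * mixed_modulus l e p f (dyad n) \<le> 1"
proof -
  have c: "dyad n \<in> cbox 0 1"
  proof -
    have "(1::real) \<le> 2 * 2 ^ k" for k :: nat using one_le_power[of "2::real" k] by linarith
    then show ?thesis by (simp add: mem_box_cart dyad_def)
  qed
  have "ennreal (\<Prod>i\<in>e. 2 powr (\<alpha> * real (n i))) * mixed_modulus l e p f (dyad n) \<le>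
     ennreal (\<Prod>i\<in>e. dyad n $ i powr (- \<alpha>)) * mixed_modulus l e p f (dyad n)"
  proof (intro mult_right_mono ennreal_leI prod_mono conjI)
    fix i
    have "2 powr (\<alpha> * real (n i)) = (1 / 2 ^ n i) powr (- \<alpha>)"
      by (simp add: powr_divide powr_realpow[symmetric] powr_powr powr_minus_divide mult.commute)
    also have "\<dots> \<le> dyad n $ i powr (- \<alpha>)" using \<alpha> by (intro powr_mono2') (auto simp: dyad_def field_simps)
    finally show "2 powr (\<alpha> * real (n i)) \<le> dyad n $ i powr (- \<alpha>)" .
  qed auto
  also have "\<dots> \<le> besov_seminorm l \<alpha> p \<infinity> e f"
    unfolding besov_seminorm_def by (simp, rule SUP_upper[OF c])
  finally show ?thesis using B by (rule order_trans)
qed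

section \<open>From the Besov norm to sums over one level\<close>

definition cL :: "ennreal \<Rightarrow> real" where
  "cL \<theta> = 5 + 4 powr (1 / enn2real \<theta>)"

definition log_exp :: "ennreal \<Rightarrow> real" where
  "log_exp \<theta> = max (1 - enn2real (1 / \<theta>)) 0"

lemma enn2real_inverse:
  assumes "0 < \<theta>" "\<theta> \<noteq> \<infinity>"
  shows "0 < enn2real \<theta>" "enn2real (1 / \<theta>) = 1 / enn2real \<theta>"
proof -
  show p: "0 < enn2real \<theta>" using assms by (simp add: enn2real_positive_iff top.not_eq_extremum)
  have "1 / \<theta> = 1 / ennreal (enn2real \<theta>)" using assms by (simp add: top.not_eq_extremum)
  also have "\<dots> = ennreal (1 / enn2real \<theta>)" using p by (simp add: divide_ennreal flip: ennreal_1)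
  finally show "enn2real (1 / \<theta>) = 1 / enn2real \<theta>" using p by simp
qed

lemma log_exp_bounds: "0 \<le> log_exp \<theta>" "log_exp \<theta> \<le> 1"
  by (auto simp: log_exp_def)

text \<open>For \<open>r \<ge> 1\<close> the bound \<open>y \<le> 1 + y powr r\<close>, applied to rescaled terms, replaces Hoelder's inequality.\<close>

lemma ltheta_sum:
  fixes x :: "'k \<Rightarrow> real"
  assumes r: "0 < r" and A: "finite A" "A \<noteq> {}" and x: "\<And>k. k \<in> A \<Longrightarrow> 0 \<le> x k"
    and S: "(\<Sum>k\<in>A. x k powr r) \<le> 4"
  shows "(\<Sum>k\<in>A. x k) \<le> (5 + 4 powr (1 / r)) * real (card A) powr max (1 - 1 / r) 0"
proof (cases "r \<ge> 1")
  case True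
  define N where "N = real (card A)"
  have N: "N \<ge> 1" using A by (simp add: N_def Suc_le_eq card_gt_0_iff)
  have "x k \<le> N powr (- (1 / r)) * (1 + N * x k powr r)" if "k \<in> A" for k
  proof -
    define y where "y = N powr (1 / r) * x k"
    have y0: "0 \<le> y" using x[OF that] by (simp add: y_def)
    have "y \<le> 1 + y powr r"
    proof (cases "y \<le> 1")
      case False
      then show ?thesis using powr_mono[OF True, of y] by simp
    qed (auto intro: add_increasing2)
    also have "y powr r = N * x k powr r"
      using N r x[OF that] by (simp add: y_def powr_mult powr_powr)
    finally have "N powr (- (1 / r)) * y \<le> N powr (- (1 / r)) * (1 + N * x k powr r)"
      by (intro mult_left_mono) auto
    moreover have "N powr (- (1 / r)) * y = x k"
      using N by (simp add: y_def mult.assoc[symmetric] powr_add[symmetric])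
    ultimately show ?thesis by simp
  qed
  then have "(\<Sum>k\<in>A. x k) \<le> (\<Sum>k\<in>A. N powr (- (1 / r)) * (1 + N * x k powr r))"
    by (intro sum_mono)
  also have "\<dots> = N powr (- (1 / r)) * (N + N * (\<Sum>k\<in>A. x k powr r))"
    by (simp add: sum_distrib_left[symmetric] sum.distrib N_def)
  also have "\<dots> \<le> N powr (- (1 / r)) * (N + N * 4)"
    using N by (intro mult_left_mono add_left_mono S) auto
  also have "\<dots> = 5 * N powr (1 - 1 / r)"
    using N by (simp add: powr_diff powr_minus_divide)
  also have "\<dots> \<le> (5 + 4 powr (1 / r)) * N powr (1 - 1 / r)"
    by (intro mult_right_mono) auto
  also have "1 - 1 / r = max (1 - 1 / r) 0" using True by simp
  finally show ?thesis unfolding N_def .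
next
  case False
  \<comment> \<open>For r < 1 no power of the cardinality is lost: after division by c, chosen with
    c^r = 4, every term is at most 1 and hence at most its r-th power.\<close>
  define c :: real where "c = 4 powr (1 / r)"
  have c: "c > 0" by (simp add: c_def)
  have cr: "c powr r = 4" using r by (simp add: c_def powr_powr)
  have "x k \<le> c * (x k powr r / 4)" if k: "k \<in> A" for k
  proof -
    define v where "v = x k / c"
    have v0: "0 \<le> v" using x[OF k] c by (simp add: v_def)
    have vr: "v powr r = x k powr r / 4" using x[OF k] c by (simp add: v_def powr_divide cr)
    have "x k powr r \<le> (\<Sum>k\<in>A. x k powr r)" using k A by (intro member_le_sum) auto
    then have "v powr r \<le> 1" using S vr by simp
    then have v1: "v \<le> 1"
      using gr_one_powr[of v r] r by fastforce
    have "v \<le> v powr r"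
    proof (cases "v = 0")
      case False
      then have "v powr 1 \<le> v powr r" using v0 v1 \<open>\<not> r \<ge> 1\<close> by (intro powr_mono') auto
      then show ?thesis using v0 by simp
    qed simp
    then have "c * v \<le> c * (x k powr r / 4)" using c vr by simp
    then show ?thesis using c by (simp add: v_def)
  qed
  then have "(\<Sum>k\<in>A. x k) \<le> (\<Sum>k\<in>A. c * (x k powr r / 4))" by (intro sum_mono)
  also have "\<dots> = c * ((\<Sum>k\<in>A. x k powr r) / 4)" by (simp add: sum_distrib_left sum_divide_distrib)
  also have "\<dots> \<le> c * 1" using S c by (intro mult_left_mono) auto
  also have "\<dots> \<le> (5 + c) * real (card A) powr max (1 - 1 / r) 0"
  proof -
    have "max (1 - 1 / r) 0 = 0" using False r by simp
    then show ?thesis using A by (simp add: card_gt_0_iff)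
  qed
  finally show ?thesis by (simp add: c_def)
qed

text \<open>Finiteness is part of the conclusion because \<open>enn2real\<close> sends infinity to
  0, and the bound on the real sum alone would say nothing then. The 4 behind \<open>cL\<close> is
  2^card e for at most two variables.\<close>

lemma besov_level_bound:
  fixes n :: "'k \<Rightarrow> 'd::finite \<Rightarrow> nat"
  assumes B: "besov_seminorm l \<alpha> p \<theta> e f \<le> 1" and \<theta>: "0 < \<theta>" and \<alpha>: "0 < \<alpha>" and e: "card e \<le> 2"
    and A: "finite A" "A \<noteq> {}"
    and inj: "\<And>k k'. k \<in> A \<Longrightarrow> k' \<in> A \<Longrightarrow> (\<And>i. i \<in> e \<Longrightarrow> n k i = n k' i) \<Longrightarrow> k = k'"
  defines "X \<equiv> (\<lambda>k. ennreal (\<Prod>i\<in>e. 2 powr (\<alpha> * real (n k i))) * mixed_modulus l e p f (dyad (n k)))"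
  shows "(\<forall>k\<in>A. X k < \<infinity>) \<and> (\<Sum>k\<in>A. enn2real (X k)) \<le> cL \<theta> * real (card A) powr log_exp \<theta>"
proof (cases "\<theta> = \<infinity>")
  case True
  have X1: "X k \<le> 1" for k
    unfolding X_def using besov_dyadic_sup[of l \<alpha> p e f "n k"] B \<alpha> by (simp add: True)
  have "enn2real (X k) \<le> 1" for k
    using enn2real_mono[OF X1, of k] by simp
  then have "(\<Sum>k\<in>A. enn2real (X k)) \<le> (\<Sum>k\<in>A. 1)" by (intro sum_mono)
  \<comment> \<open>For infinite \<theta> the exponent \<open>log_exp\<close> is 1, since 1/\<theta>
    = 0; counting the terms is then already the claim.\<close>
  also have "\<dots> \<le> cL \<theta> * real (card A) powr log_exp \<theta>" by (simp add: cL_def log_exp_def True)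
  finally have "(\<Sum>k\<in>A. enn2real (X k)) \<le> cL \<theta> * real (card A) powr log_exp \<theta>" .
  moreover have "X k < \<infinity>" for k by (rule le_less_trans[OF X1]) simp
  ultimately show ?thesis by blast
next
  case False
  define r where "r = enn2real \<theta>"
  have r: "0 < r" "enn2real (1 / \<theta>) = 1 / r" using enn2real_inverse[OF \<theta> False] by (simp_all add: r_def)
  have "(\<Sum>k\<in>A. ennreal_powr (X k) r) \<le> 2 ^ card e"
    unfolding X_def r_def by (rule besov_dyadic_sum[OF B \<theta> False \<alpha> A(1) inj])
  also have "\<dots> \<le> (2 :: ennreal) ^ 2" using e by (intro power_increasing) auto
  finally have S: "(\<Sum>k\<in>A. ennreal_powr (X k) r) \<le> 4" by simp
  have fin: "X k < \<infinity>" if "k \<in> A" for k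
  proof -
    have "ennreal_powr (X k) r \<le> (\<Sum>k\<in>A. ennreal_powr (X k) r)"
      using that A by (intro member_le_sum) auto
    with S have "ennreal_powr (X k) r \<le> 4" by (rule order_trans[rotated])
    then show ?thesis by (auto simp: ennreal_powr_def top.not_eq_extremum[symmetric] top_unique split: if_splits)
  qed
  have "(\<Sum>k\<in>A. ennreal_powr (X k) r) = (\<Sum>k\<in>A. ennreal (enn2real (X k) powr r))"
    using fin by (intro sum.cong refl) (force simp: ennreal_powr_def)
  also have "\<dots> = ennreal (\<Sum>k\<in>A. enn2real (X k) powr r)"
    by (rule sum_ennreal) auto
  finally have "ennreal (\<Sum>k\<in>A. enn2real (X k) powr r) \<le> ennreal 4" using S by simp
  then have "(\<Sum>k\<in>A. enn2real (X k) powr r) \<le> 4" by (subst (asm) ennreal_le_iff) auto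
  then have "(\<Sum>k\<in>A. enn2real (X k)) \<le> (5 + 4 powr (1 / r)) * real (card A) powr max (1 - 1 / r) 0"
    by (intro ltheta_sum r A) auto
  then show ?thesis using fin by (simp add: cL_def log_exp_def r r_def[symmetric])
qed

lemma modulus_of_X:
  assumes "ennreal c * m < \<infinity>" "0 < c"
  shows "m = ennreal (enn2real (ennreal c * m) / c)"
proof (cases m)
  case (real y)
  then show ?thesis using assms by (simp add: ennreal_mult[symmetric])
next
  case top
  then show ?thesis using assms by (simp add: ennreal_mult_top)
qed

definition level_index :: "nat \<Rightarrow> nat \<Rightarrow> 2 \<Rightarrow> nat" where
  "level_index a b i = (if i = 1 then a else b)"

lemma dyad_level_index: "dyad (level_index a b) $ 1 = 1 / (2 * 2 ^ a)" "dyad (level_index a b) $ 2 = 1 / (2 * 2 ^ b)"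
  by (simp_all add: dyad_def level_index_def)

lemma besov_seminorm_le_1:
  assumes "besov_norm l \<alpha> p \<theta> f \<le> 1"
  shows "besov_seminorm l \<alpha> p \<theta> e f \<le> 1"
proof -
  have "besov_seminorm l \<alpha> p \<theta> e f \<le> besov_norm l \<alpha> p \<theta> f"
    unfolding besov_norm_def by (rule member_le_sum) auto
  with assms show ?thesis by (rule order_trans[rotated])
qed

text \<open>Provides the dyadic data from the four seminorms: the full set yields \<open>y12\<close>
  with the logarithmic loss of a level of M + 1 indices, singletons yield \<open>y1\<close> and
  \<open>y2\<close>, and the empty set yields the norm bound.\<close>

lemma sampled_function_besov:
  fixes f :: "real ^ 2 \<Rightarrow> complex"
  assumes f: "f \<in> besov_unit_ball l \<alpha> P \<theta>" and P: "1 \<le> P" "P \<noteq> \<infinity>" and \<theta>: "0 < \<theta>" and \<alpha>: "enn2real (1 / P) < \<alpha>"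
    and q: "kappa (enn2real P) l \<le> 4 ^ q"
  shows "\<exists>y12 y1 y2. sampled_function (enn2real P) l q (\<lambda>z. f (vec2 z)) y12 y1 y2 \<alpha> (log_exp \<theta>) (cL \<theta>)"
proof -
  define p where "p = enn2real P"
  define F where "F = (\<lambda>z. f (vec2 z))"
  have P0: "0 < P" by (rule less_le_trans[OF _ P(1)]) simp
  have p1: "1 \<le> p" using enn2real_mono[OF P(1)] P(2) by (simp add: p_def top.not_eq_extremum)
  have \<alpha>p: "1 / p < \<alpha>" using \<alpha> enn2real_inverse[OF P0 P(2)] by (simp add: p_def)
  have \<alpha>0: "0 < \<alpha>" using \<alpha>p p1 by (smt (verit) divide_nonneg_nonneg)
  have fm [measurable]: "f \<in> borel_measurable borel" and fp: "torus_periodic f"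
    using f by (auto simp: besov_unit_ball_def besov_space_def Lp_torus_def)
  have sn: "besov_seminorm l \<alpha> P \<theta> e f \<le> 1" for e
    using f by (intro besov_seminorm_le_1) (simp add: besov_unit_ball_def)
  have NPD: "Npow p (\<lambda>z. h (vec2 z)) \<le> ennreal (y powr p)"
    if "h \<in> borel_measurable borel" "torus_periodic h" "Lp_norm P h \<le> ennreal y" "0 \<le> y" for h :: "real ^ 2 \<Rightarrow> complex" and y
    unfolding p_def using that P(2) p1 by (intro Lp_norm_le_D) (auto simp: p_def)
  have K5: "5 \<le> cL \<theta>" by (simp add: cL_def)
  define m where "m = (\<lambda>e a b. mixed_modulus l e P f (dyad (level_index a b)))"
  define X where "X = (\<lambda>e a b. ennreal (\<Prod>i\<in>e. 2 powr (\<alpha> * real (level_index a b i))) * m e a b)"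
  \<comment> \<open>A one-element index set has cardinality 1, so there is no logarithmic factor for
    individual moduli.\<close>
  have single: "X e a b < \<infinity> \<and> enn2real (X e a b) \<le> cL \<theta>" for e a b
  proof -
    have "card e \<le> card (UNIV :: 2 set)" by (rule card_mono) auto
    then have "card e \<le> 2" by simp
    from besov_level_bound[OF sn \<theta> \<alpha>0 this, of "{()}" "\<lambda>_. level_index a b"]
    show ?thesis by (simp add: X_def m_def)
  qed
  define y12 where "y12 = (\<lambda>a b. enn2real (m UNIV a b))"
  \<comment> \<open>The second index is a dummy: the modulus over {1} does not look at the second
    coordinate.\<close>
  define y1 where "y1 = (\<lambda>a. enn2real (m {1} a 0))"
  define y2 where "y2 = (\<lambda>b. enn2real (m {2} 0 b))"
  have pos: "0 < (\<Prod>i\<in>e. 2 powr (\<alpha> * real (level_index a b i)))" for e a b by (intro prod_pos) simp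
  have mX: "m e a b = ennreal (enn2real (X e a b) / (\<Prod>i\<in>e. 2 powr (\<alpha> * real (level_index a b i))))" for e a b
    unfolding X_def by (rule modulus_of_X) (use single[of e a b] pos[where e = e and a = a and b = b] in \<open>auto simp: X_def\<close>)
  have mfin: "m e a b < \<infinity>" for e a b by (subst mX) simp
  have mr: "m e a b = ennreal (enn2real (m e a b))" for e a b using mfin[of e a b] by simp
  have mv: "enn2real (m e a b) = enn2real (X e a b) / (\<Prod>i\<in>e. 2 powr (\<alpha> * real (level_index a b i)))" for e a b
    by (subst mX) (use pos[where e = e and a = a and b = b] in \<open>simp add: prod_nonneg\<close>)
  have "sampled_function p l q F y12 y1 y2 \<alpha> (log_exp \<theta>) (cL \<theta>)"
  proof
    show "1 \<le> p" "kappa p l \<le> 4 ^ q" "1 / p < \<alpha>" by (fact p1, fact q[folded p_def], fact \<alpha>p)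
    show "permeas F" unfolding F_def permeas_def using torus_periodic_per2[OF fp] by auto
    show "0 \<le> log_exp \<theta>" "log_exp \<theta> \<le> 1" "1 \<le> cL \<theta>" using log_exp_bounds K5 by auto
    show "0 \<le> y12 a b" "0 \<le> y1 a" "0 \<le> y2 b" for a b by (simp_all add: y12_def y1_def y2_def)
    show "Npow p F \<le> 1"
    proof -
      have "besov_seminorm l \<alpha> P \<theta> {} f \<le> 1" by (rule sn)
      have mm: "mixed_modulus l {} P f t = Lp_norm P f" for t by (simp add: mixed_modulus_def mixed_diff_empty)
      have "Lp_norm P f \<le> 1"
      proof (cases "\<theta> = \<infinity>")
        case True
        then show ?thesis using besov_dyadic_sup[of l \<alpha> P "{}" f "\<lambda>_. 0"] sn[of "{}"] \<alpha>0 by (simp add: mm)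
      next
        case False
        \<comment> \<open>For e = {} the sum has one term without weights and the bound is 2^0, so
          the \<theta>-th power cancels exactly.\<close>
        have "ennreal_powr (Lp_norm P f) (enn2real \<theta>) \<le> 1"
          using besov_dyadic_sum[OF sn \<theta> False \<alpha>0, of "{()}" "{}" "\<lambda>_ _. 0"] by (simp add: mm)
        then have "ennreal_powr (Lp_norm P f) (1 / (1 / enn2real \<theta>)) \<le> ennreal 1" by simp
        then show ?thesis using ennreal_powr_le_D[of "Lp_norm P f" "1 / enn2real \<theta>" 1] enn2real_inverse[OF \<theta> False] by simp
      qed
      then show ?thesis using NPD[OF fm fp, of 1] by (simp add: F_def)
    qed
    show "Npow p (ldiff l (h, 0) (ldiff l (0, k) F)) \<le> ennreal (y12 a b powr p)"
      if "\<bar>h\<bar> < 1 / (2 * 2 ^ a)" "\<bar>k\<bar> < 1 / (2 * 2 ^ b)" for a b h k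
    proof -
      have "Lp_norm P (mixed_diff l UNIV (vec2 (h, k)) f) \<le> m UNIV a b"
        unfolding m_def
      proof (rule Lp_norm_le_modulus)
        fix i :: 2
        show "\<bar>vec2 (h, k) $ i\<bar> < dyad (level_index a b) $ i"
          using that exhaust_2[of i] by (auto simp: dyad_level_index)
      qed
      also have "\<dots> = ennreal (y12 a b)" unfolding y12_def by (rule mr)
      finally have "Lp_norm P (partial_diff l 1 h (partial_diff l 2 k f)) \<le> ennreal (y12 a b)"
        by (simp add: mixed_diff_UNIV)
      then have "Npow p (\<lambda>z. partial_diff l 1 h (partial_diff l 2 k f) (vec2 z)) \<le> ennreal (y12 a b powr p)"
        by (intro NPD partial_diff_props fm fp) (simp_all add: y12_def)
      then show ?thesis by (simp add: partial_diff_vec2 F_def)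
    qed
    show "Npow p (ldiff l (h, 0) F) \<le> ennreal (y1 a powr p)" if "\<bar>h\<bar> < 1 / (2 * 2 ^ a)" for a h
    proof -
      have "Lp_norm P (mixed_diff l {1} (vec2 (h, 0)) f) \<le> m {1} a 0"
        unfolding m_def by (rule Lp_norm_le_modulus) (use that in \<open>auto simp: dyad_level_index\<close>)
      also have "\<dots> = ennreal (y1 a)" unfolding y1_def by (rule mr)
      finally have "Lp_norm P (partial_diff l 1 h f) \<le> ennreal (y1 a)" by (simp add: mixed_diff_1)
      then have "Npow p (\<lambda>z. partial_diff l 1 h f (vec2 z)) \<le> ennreal (y1 a powr p)"
        by (intro NPD partial_diff_props fm fp) (simp_all add: y1_def)
      then show ?thesis by (simp add: partial_diff_vec2 F_def)
    qed
    show "Npow p (ldiff l (0, k) F) \<le> ennreal (y2 b powr p)" if "\<bar>k\<bar> < 1 / (2 * 2 ^ b)" for b k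
    proof -
      have "Lp_norm P (mixed_diff l {2} (vec2 (0, k)) f) \<le> m {2} 0 b"
        unfolding m_def by (rule Lp_norm_le_modulus) (use that in \<open>auto simp: dyad_level_index\<close>)
      also have "\<dots> = ennreal (y2 b)" unfolding y2_def by (rule mr)
      finally have "Lp_norm P (partial_diff l 2 k f) \<le> ennreal (y2 b)" by (simp add: mixed_diff_2)
      then have "Npow p (\<lambda>z. partial_diff l 2 k f (vec2 z)) \<le> ennreal (y2 b powr p)"
        by (intro NPD partial_diff_props fm fp) (simp_all add: y2_def)
      then show ?thesis by (simp add: partial_diff_vec2 F_def)
    qed
    show "y1 a \<le> cL \<theta> * 2 powr (- \<alpha> * real a)" for a
      unfolding y1_def mv using single[of "{1}" a 0]
      by (simp add: level_index_def powr_minus_divide divide_right_mono)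
    show "y2 b \<le> cL \<theta> * 2 powr (- \<alpha> * real b)" for b
      unfolding y2_def mv using single[of "{2}" 0 b]
      by (simp add: level_index_def powr_minus_divide divide_right_mono)
    show "(\<Sum>a\<le>M. y12 a (M - a)) \<le> cL \<theta> * 2 powr (- \<alpha> * real M) * real (M + 1) powr log_exp \<theta>" for M
    proof -
      have pr: "(\<Prod>i\<in>UNIV. 2 powr (\<alpha> * real (level_index a (M - a) i))) = 2 powr (\<alpha> * real M)" if "a \<le> M" for a
        using that by (simp add: UNIV_2_eq level_index_def powr_add[symmetric] distrib_left[symmetric] of_nat_diff)
      have "(\<Sum>a\<le>M. y12 a (M - a)) = (\<Sum>a\<le>M. enn2real (X UNIV a (M - a)) * 2 powr (- \<alpha> * real M))"
        unfolding y12_def mv by (intro sum.cong refl) (simp add: pr powr_minus_divide)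
      also have "\<dots> = (\<Sum>a\<le>M. enn2real (X UNIV a (M - a))) * 2 powr (- \<alpha> * real M)"
        by (simp only: sum_distrib_right)
      also have "(\<Sum>a\<le>M. enn2real (X UNIV a (M - a))) \<le> cL \<theta> * real (card {..M}) powr log_exp \<theta>"
      proof -
        show ?thesis
          unfolding X_def m_def
        proof (rule besov_level_bound[OF sn \<theta> \<alpha>0, THEN conjunct2])
          show "a = a'" if "\<And>i. i \<in> UNIV \<Longrightarrow> level_index a (M - a) i = level_index a' (M - a') i" for a a'
            using that[of 1] by (simp add: level_index_def)
        qed simp_all
      qed
      finally show ?thesis by (simp add: mult_right_mono mult.assoc mult.commute[of "2 powr _"])
    qed
  qed
  then show ?thesis unfolding p_def F_def by blast
qed

text \<open>The block sum is continuous and agrees with f almost everywhere, so by uniqueness it is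
  \<open>continuous_rep f\<close>. The existence of that representative is thereby shown, and the
  point values in the rule are those of g, for which the error bound was derived.\<close>

lemma besov_cubature_bound:
  fixes f :: "real ^ 2 \<Rightarrow> complex"
  assumes f: "f \<in> besov_unit_ball l \<alpha> P \<theta>" and P: "1 \<le> P" "P \<noteq> \<infinity>" and \<theta>: "0 < \<theta>" and \<alpha>: "enn2real (1 / P) < \<alpha>"
    and q: "kappa (enn2real P) l \<le> 4 ^ q" and n: "n \<ge> 2"
  shows "cmod (fib_cubature n (continuous_rep f) - torus_integral f) \<le>
     sampled_function.cF (enn2real P) q \<alpha> (cL \<theta>) * real (fib_b n) powr (- \<alpha>) * ln (real (fib_b n)) powr log_exp \<theta>"
proof -
  obtain y12 y1 y2 where S: "sampled_function (enn2real P) l q (\<lambda>z. f (vec2 z)) y12 y1 y2 \<alpha> (log_exp \<theta>) (cL \<theta>)"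
    using sampled_function_besov[OF assms(1-6)] by blast
  interpret S: sampled_function "enn2real P" l q "\<lambda>z. f (vec2 z)" y12 y1 y2 \<alpha> "log_exp \<theta>" "cL \<theta>" by (rule S)
  have fm [measurable]: "f \<in> borel_measurable borel" and fp: "torus_periodic f"
    using f by (auto simp: besov_unit_ball_def besov_space_def Lp_torus_def)
  define G where "G = (\<lambda>x :: real ^ 2. S.g (x $ 1, x $ 2))"
  have "continuous_on UNIV G"
    unfolding G_def
    by (rule continuous_on_compose2[OF S.g_continuous]) (auto intro!: continuous_intros)
  moreover have "AE x in lborel. G x = f x"
  proof -
    have [measurable]: "G \<in> borel_measurable borel" unfolding G_def by measurable
    have "AE z in lborel. S.g z = f (vec2 z)"
      by (rule AE_lborel_periodic[OF _ _ S.g_per2 torus_periodic_per2[OF fp] S.g_eq_F]) measurable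
    then have "AE z in lborel. G (vec2 z) = f (vec2 z)" by (simp add: G_def)
    then have "AE x in distr lborel borel vec2. G x = f x"
      by (subst AE_distr_iff) auto
    then show ?thesis by (simp only: lborel_vec2[symmetric])
  qed
  ultimately have rep: "continuous_rep f = G"
    by (intro continuous_rep_eqI) (simp add: is_continuous_rep_def)
  have "fib_cubature n G = (1 / of_nat (fib_b n)) * (\<Sum>\<mu><fib_b n. S.g (fib_node n \<mu>))"
    by (simp add: fib_cubature_def G_def fib_node_def)
  moreover have "torus_integral f = (LINT z|unif2. S.g z)"
  proof -
    have "torus_integral f = (LINT z|unif2. f (vec2 z))"
      unfolding torus_integral_def by (rule integral_unit_cell[OF fm fp])
    also have "\<dots> = (LINT z|unif2. S.g z)"
      using S.g_eq_F by (intro integral_cong_AE) auto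
    finally show ?thesis .
  qed
  ultimately have "fib_cubature n (continuous_rep f) - torus_integral f = fib_err n S.g"
    by (simp add: rep fib_err_def)
  then show ?thesis using S.fib_err_final[OF n] by simp
qed

lemma fib_cubature_finite_p:
  assumes P: "1 \<le> P" "P \<noteq> \<infinity>" and \<theta>: "0 < \<theta>" and \<alpha>: "enn2real (1 / P) < \<alpha>"
  shows "\<exists>c>0. \<forall>n\<ge>2.
    (SUP f \<in> besov_unit_ball l \<alpha> P \<theta>.
        ennreal (cmod (fib_cubature n (continuous_rep f) - torus_integral f)))
      \<le> ennreal (c * real (fib_b n) powr (- \<alpha>) * ln (real (fib_b n)) powr log_exp \<theta>)"
proof -
  \<comment> \<open>The decay exponent is fixed from P and l before any function or n is considered,
    which makes the constant uniform.\<close>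
  obtain q where q: "kappa (enn2real P) l \<le> 4 ^ q"
    using real_arch_pow[of 4 "kappa (enn2real P) l"] by (auto intro: less_imp_le)
  define c where "c = max 1 (sampled_function.cF (enn2real P) q \<alpha> (cL \<theta>))"
  have "(SUP f \<in> besov_unit_ball l \<alpha> P \<theta>. ennreal (cmod (fib_cubature n (continuous_rep f) - torus_integral f)))
      \<le> ennreal (c * real (fib_b n) powr (- \<alpha>) * ln (real (fib_b n)) powr log_exp \<theta>)" if n: "n \<ge> 2" for n
  proof (rule SUP_least)
    fix f :: "real ^ 2 \<Rightarrow> complex" assume f: "f \<in> besov_unit_ball l \<alpha> P \<theta>"
    have "cmod (fib_cubature n (continuous_rep f) - torus_integral f) \<le>
      sampled_function.cF (enn2real P) q \<alpha> (cL \<theta>) * real (fib_b n) powr (- \<alpha>) * ln (real (fib_b n)) powr log_exp \<theta>"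
      by (rule besov_cubature_bound[OF f P \<theta> \<alpha> q n])
    also have "\<dots> \<le> c * real (fib_b n) powr (- \<alpha>) * ln (real (fib_b n)) powr log_exp \<theta>"
      by (intro mult_right_mono) (auto simp: c_def)
    finally show "ennreal (cmod (fib_cubature n (continuous_rep f) - torus_integral f)) \<le>
      ennreal (c * real (fib_b n) powr (- \<alpha>) * ln (real (fib_b n)) powr log_exp \<theta>)"
      by (rule ennreal_leI)
  qed
  moreover have "c > 0" by (simp add: c_def)
  ultimately show ?thesis by blast
qed

section \<open>Reduction of infinite p to finite p\<close>

lemma Lp_norm_le_top:
  assumes q: "q \<noteq> \<infinity>" "0 < q"
  shows "Lp_norm q g \<le> Lp_norm \<infinity> g"
proof -
  define r where "r = enn2real q"
  have r: "0 < r" using enn2real_inverse q by (simp add: r_def)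
  define s where "s = esssup unit_cell (\<lambda>x. ennreal (cmod (g x)))"
  have Ls: "Lp_norm \<infinity> g = s" by (simp add: Lp_norm_def s_def)
  show ?thesis
  proof (cases s)
    case (real t)
    have "AE x in unit_cell. ennreal (cmod (g x)) \<le> s"
      unfolding s_def by (rule esssup_AE)
    then have "AE x in unit_cell. ennreal (cmod (g x) powr r) \<le> ennreal (t powr r)"
      by (rule eventually_mono) (use r real in \<open>auto intro!: ennreal_leI powr_mono2\<close>)
    then have "(\<integral>\<^sup>+x. ennreal (cmod (g x) powr r) \<partial>unit_cell) \<le> (\<integral>\<^sup>+x. ennreal (t powr r) \<partial>(unit_cell :: (real ^ 'a) measure))"
      by (rule nn_integral_mono_AE)
    also have "\<dots> = ennreal (t powr r)"
    proof -
      have "emeasure (unit_cell :: (real ^ 'a) measure) (cbox 0 1) = 1"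
      proof -
        have "\<forall>b\<in>Basis. (1 :: real ^ 'a) \<bullet> b = 1" by (auto simp: Basis_vec_def inner_axis)
        then show ?thesis by (subst emeasure_restrict_space) (auto simp: emeasure_lborel_cbox_eq)
      qed
      then show ?thesis by (simp add: space_restrict_space)
    qed
    finally have "Lp_norm q g \<le> ennreal_powr (ennreal (t powr r)) (1 / r)"
      using q r unfolding Lp_norm_def r_def[symmetric] by (simp add: ennreal_powr_mono)
    also have "\<dots> = ennreal t" using r real by (simp add: ennreal_powr_def powr_powr)
    finally show ?thesis unfolding Ls real .
  next
    case top
    then show ?thesis unfolding Ls by simp
  qed
qed

text \<open>The cell has measure 1, so the embedding has norm at most 1 and preserves unit balls
  with the same \<alpha> and \<theta>.\<close>

lemma besov_unit_ball_top_subset: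
  assumes q: "q \<noteq> \<infinity>" "0 < q" and \<theta>: "0 < \<theta>"
  shows "besov_unit_ball l \<alpha> \<infinity> \<theta> \<subseteq> (besov_unit_ball l \<alpha> q \<theta> :: (real ^ 'd::finite \<Rightarrow> complex) set)"
proof
  fix f :: "real ^ 'd \<Rightarrow> complex" assume f: "f \<in> besov_unit_ball l \<alpha> \<infinity> \<theta>"
  have mm: "mixed_modulus l e q f t \<le> mixed_modulus l e \<infinity> f t" for e t
    unfolding mixed_modulus_def by (intro SUP_mono') (rule Lp_norm_le_top[OF q])
  have "besov_seminorm l \<alpha> q \<theta> e f \<le> besov_seminorm l \<alpha> \<infinity> \<theta> e f" for e
    unfolding besov_seminorm_def
    by (auto intro!: SUP_mono' mult_left_mono mult_right_mono mm mm[unfolded infinity_ennreal_def] ennreal_powr_mono nn_integral_mono)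
  then have "besov_norm l \<alpha> q \<theta> f \<le> besov_norm l \<alpha> \<infinity> \<theta> f"
    unfolding besov_norm_def by (intro sum_mono)
  then show "f \<in> besov_unit_ball l \<alpha> q \<theta>"
    using f Lp_norm_le_top[OF q, of f]
    by (auto simp: besov_unit_ball_def besov_space_def Lp_torus_def intro: le_less_trans order_trans)
qed

theorem theorem3p1:
  fixes p \<theta> :: ennreal and \<alpha> :: real and l :: nat
  assumes "1 \<le> p" and "0 < \<theta>" and "\<alpha> > enn2real (1 / p)" and "real l > \<alpha>"
  shows "\<exists>c>0. \<forall>n\<ge>2.
    (SUP f \<in> besov_unit_ball l \<alpha> p \<theta>.
        ennreal (cmod (fib_cubature n (continuous_rep f) - torus_integral f)))
      \<le> ennreal (c * real (fib_b n) powr (- \<alpha>)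
                    * ln (real (fib_b n)) powr max (1 - enn2real (1 / \<theta>)) 0)"
proof (cases "p = \<infinity>")
  case False
  then show ?thesis
    using fib_cubature_finite_p[OF assms(1) False assms(2,3), of l] by (simp add: log_exp_def)
next
  case True
  have \<alpha>: "0 < \<alpha>" using assms(3) True by simp
  \<comment> \<open>Any finite exponent above 1/\<alpha> and at least 1 would do; this one gives 1/q
    = \<alpha>/(\<alpha> + 1) < \<alpha>.\<close>
  define q where "q = ennreal (1 + 1 / \<alpha>)"
  have q: "1 \<le> q" "q \<noteq> \<infinity>" "0 < q" using \<alpha> by (auto simp: q_def add_pos_pos)
  have "enn2real (1 / q) = 1 / (1 + 1 / \<alpha>)"
  proof -
    have "enn2real q = 1 + 1 / \<alpha>" unfolding q_def using \<alpha> by (intro enn2real_ennreal) auto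
    then show ?thesis using enn2real_inverse(2)[OF q(3,2)] by simp
  qed
  also have "\<dots> < \<alpha>" using \<alpha> by (simp add: field_simps)
  finally have q\<alpha>: "enn2real (1 / q) < \<alpha>" .
  obtain c where c: "c > 0" "\<forall>n\<ge>2.
    (SUP f \<in> besov_unit_ball l \<alpha> q \<theta>. ennreal (cmod (fib_cubature n (continuous_rep f) - torus_integral f)))
      \<le> ennreal (c * real (fib_b n) powr (- \<alpha>) * ln (real (fib_b n)) powr log_exp \<theta>)"
    using fib_cubature_finite_p[OF q(1,2) assms(2) q\<alpha>, of l] by blast
  have "(SUP f \<in> besov_unit_ball l \<alpha> p \<theta>. ennreal (cmod (fib_cubature n (continuous_rep f) - torus_integral f)))
      \<le> (SUP f \<in> besov_unit_ball l \<alpha> q \<theta>. ennreal (cmod (fib_cubature n (continuous_rep f) - torus_integral f)))" for n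
    unfolding True using besov_unit_ball_top_subset[OF q(2,3) assms(2)] by (intro SUP_subset_mono) auto
  then show ?thesis using c unfolding log_exp_def by (meson order_trans)
qed

end
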